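(* Let $m,n,r$ be fixed integers with $n\ge m>r\ge 1$. Then, as $H\to\infty$: \begin{itemize} \item if $r=1$, then $\#\mathcal{L}_{m,n,1}(\mathbb{Z}^{-1};H)\le H^{n+o(1)}$; \item if $r=2$, then \[\#\mathcal{L}_{m,n,2}(\mathbb{Z}^{-1};H)\ll\begin{cases} H^{7+o(1)}, & \text{if } (m,n)=(3,3),\\ H^{2n+m-3+o(1)}, & \text{if } (m,n)\ne(3,3);\end{cases}\] \item if $r\ge 3$, then \[\#\mathcal{L}_{m,n,r}(\mathbb{Z}^{-1};H)\ll\begin{cases} H^{(n-r)(r+1)/2+mr+o(1)}, & \text{if } 2m\ge n+r,\\ H^{nr+m-r}, & \text{if } 2m<n+r.\end{cases}\] \end{itemize}
   Context: For a real $H\ge 1$, let $\mathcal{E}(H)=\{1/a:\ a\in\mathbb{Z},\ 1\le |a|\le H\}$ (Egyptian or unit fractions). Let $\mathcal{M}_{m,n}(\mathbb{Z}^{-1};H)$ be the set of $m\times n$ matrices all of whose entries lie in $\mathcal{E}(H)$, and $\mathcal{L}_{m,n,r}(\mathbb{Z}^{-1};H)=\{A\in\mathcal{M}_{m,n}(\mathbb{Z}^{-1};H):\ \operatorname{rank}A=r\}$. A bound $X\le H^{c+o(1)}$ means that for every $\varepsilon>0$, $X\le H^{c+\varepsilon}$ for all sufficiently large $H$; implied constants in $\ll$ depend only on $m,n$ (and $r$). *)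

theory Defs
  imports
    "HOL-Library.Landau_Symbols"
    "Jordan_Normal_Form.DL_Rank"
begin

definition unit_fractions :: "real \<Rightarrow> rat set" where
  "unit_fractions H = {1 / of_int a | a :: int. 1 \<le> \<bar>a\<bar> \<and> real_of_int \<bar>a\<bar> \<le> H}"

definition unit_fraction_mats :: "nat \<Rightarrow> nat \<Rightarrow> real \<Rightarrow> rat mat set" where
  "unit_fraction_mats m n H =
     {A \<in> carrier_mat m n. \<forall>i<m. \<forall>j<n. A $$ (i, j) \<in> unit_fractions H}"

text \<open>The first argument of \<^const>\<open>vec_space.rank\<close> is the number of rows.\<close>

definition unit_fraction_mats_rank :: "nat \<Rightarrow> nat \<Rightarrow> nat \<Rightarrow> real \<Rightarrow> rat mat set" where
  "unit_fraction_mats_rank m n r H = {A \<in> unit_fraction_mats m n H. vec_space.rank m A = r}"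

text \<open>The bounds $X(H) \le H^{c+o(1)}$ and $X(H) \ll H^{c+o(1)}$ as $H \to \infty$.
  In the second one the implied constant is independent of $\varepsilon$.\<close>

definition le_powr_o1 :: "(real \<Rightarrow> real) \<Rightarrow> real \<Rightarrow> bool" where
  "le_powr_o1 X c \<longleftrightarrow> (\<forall>\<epsilon>>0. \<forall>\<^sub>F H in at_top. X H \<le> H powr (c + \<epsilon>))"

definition ll_powr_o1 :: "(real \<Rightarrow> real) \<Rightarrow> real \<Rightarrow> bool" where
  "ll_powr_o1 X c \<longleftrightarrow> (\<exists>C>0. \<forall>\<epsilon>>0. \<forall>\<^sub>F H in at_top. X H \<le> C * H powr (c + \<epsilon>))"

text \<open>All the sets involved are finite, so that \<^const>\<open>card\<close> counts their elements.\<close>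

lemma finite_unit_fractions: "finite (unit_fractions H)"
proof (rule finite_subset)
  show "unit_fractions H \<subseteq> (\<lambda>a. 1 / of_int a) ` {- \<lfloor>H\<rfloor>..\<lfloor>H\<rfloor>}"
    unfolding unit_fractions_def by (auto simp: le_floor_iff abs_le_iff intro!: imageI) linarith
qed simp

lemma finite_unit_fraction_mats: "finite (unit_fraction_mats m n H)"
proof (rule finite_subset)
  let ?I = "{..<m} \<times> {..<n}"
  show "unit_fraction_mats m n H \<subseteq> mat m n ` (?I \<rightarrow>\<^sub>E unit_fractions H)"
  proof
    fix A assume A: "A \<in> unit_fraction_mats m n H"
    have "restrict (($$) A) ?I \<in> ?I \<rightarrow>\<^sub>E unit_fractions H"
      using A by (auto simp: unit_fraction_mats_def)
    moreover have "A = mat m n (restrict (($$) A) ?I)"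
      using A by (intro eq_matI) (auto simp: unit_fraction_mats_def)
    ultimately show "A \<in> mat m n ` (?I \<rightarrow>\<^sub>E unit_fractions H)" by blast
  qed
  show "finite (mat m n ` (?I \<rightarrow>\<^sub>E unit_fractions H))"
    by (intro finite_imageI finite_PiE) (auto simp: finite_unit_fractions)
qed

lemma finite_unit_fraction_mats_rank: "finite (unit_fraction_mats_rank m n r H)"
  unfolding unit_fraction_mats_rank_def using finite_unit_fraction_mats by simp

end

theory Submission
  imports Defs "HOL-Computational_Algebra.Squarefree"
begin

text \<open>Fix an invertible $r \times r$ minor of $A$ with rows $I$ and columns $J$. Every row
  $i \notin I$ is a combination of $h_i \ge 1$ rows of $I$ with nonzero coefficients, and these
  are determined by the columns $J$, where row $i$ leaves only $O(H^{h_i})$ choices. Let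
  $h = \max h_i$. Each column $l \notin J$ is determined by its entries in $I$, and $h$ of these
  together with one further entry solve a fixed linear equation in $h + 1$ unit fractions. Its
  coefficients are polynomially bounded, and by the divisor bound it has $H^{(h+1)/2 + o(1)}$
  solutions, since the product of the denominators is essentially squareful; for $h = 1$ there are
  $O(H)$ and for $h = 2$ there are $H^{1 + o(1)}$. The resulting exponent
  $r^2 + (m - r) h + (n - r)(r - (h - 1) / 2)$ is linear in $h$, so it is largest at $h = 1$ or
  $h = r$, which is the bound for $r \ge 3$.

  For $r = 1$, the diagonal of an $m \times m$ block determines the block up to $H^{o(1)}$ choices
  because $b_{ij} b_{ji} = b_{ii} b_{jj}$ for the denominators, and each other column is then
  fixed by one entry. For $r = 2$, either some row and some column both have full support, and the
  equation in three unit fractions is used for the rows as well as for the columns, or all rows, or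
  all columns, outside the minor are proportional to one in it. In the latter case two proportional
  lines are counted as a matrix of rank one.\<close>

section \<open>The divisor bound\<close>

text \<open>The matrix is filled block by block, and each factor must bound the ways to fill a block
  uniformly in what is already filled. The coefficients of the equation for a new column come from
  entries already fixed, so all that may be used about them is that they are nonzero and at most a
  fixed power of \<open>H\<close>. That suffices because the divisor bound costs only
  \<open>H powr \<epsilon>\<close> on numbers of polynomial size. The longest support is the one to
  use for columns, whose cost \<open>r - (h - 1) / 2\<close> falls with \<open>h\<close>, while the
  cost of the rows rises. The slope in \<open>h\<close> is \<open>(m - r) - (n - r) / 2\<close>,
  with the sign of \<open>2 m - (n + r)\<close>: this is the origin of the two cases for
  \<open>r \<ge> 3\<close>. A negative slope is at most \<open>- 1 / 2\<close>, which leaves room to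
  absorb \<epsilon>, so that no \<open>o(1)\<close> remains when \<open>2 m < n + r\<close>. For
  \<open>r = 2\<close> the same count gives \<open>2 n + m - 2\<close> at \<open>h = 1\<close>,
  which exceeds the claim by one unless \<open>(m, n) = (3, 3)\<close>, and
  \<open>2 m + n - 2\<close> at \<open>h = 2\<close>, which exceeds it when
  \<open>m = n \<ge> 4\<close>. Hence the separate argument.\<close>

lemma card_divisors_prime_power_mult:
  fixes p m :: nat
  assumes "prime p" "m > 0"
  shows "card {d. d dvd p ^ v * m} \<le> (v + 1) * card {d. d dvd m}"
proof -
  have "{d. d dvd p ^ v * m} \<subseteq> (\<lambda>(i, d). p ^ i * d) ` ({..v} \<times> {d. d dvd m})"
  proof
    fix d assume "d \<in> {d. d dvd p ^ v * m}"
    then obtain a b where ab: "d = a * b" "a dvd p ^ v" "b dvd m"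
      using division_decomp by blast
    then obtain i where "i \<le> v" "a = p ^ i" using divides_primepow_nat[OF assms(1)] by auto
    with ab show "d \<in> (\<lambda>(i, d). p ^ i * d) ` ({..v} \<times> {d. d dvd m})" by force
  qed
  moreover have "finite {d. d dvd m}" using assms by simp
  ultimately have "card {d. d dvd p ^ v * m} \<le> card ({..v} \<times> {d. d dvd m})"
    by (meson card_image_le card_mono finite_SigmaI finite_atMost finite_imageI le_trans)
  thus ?thesis by (simp add: card_cartesian_product)
qed

text \<open>The number of divisors is the product of \<open>v + 1\<close> over the exact prime
  powers \<open>p ^ v\<close> of \<open>n\<close>, compared factor by factor with
  \<open>(p ^ v) powr \<epsilon>\<close>. Large primes lose nothing; each of the boundedly many
  small primes loses at most a constant.\<close>

lemma divisor_bound: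
  fixes \<epsilon> :: real
  assumes "\<epsilon> > 0"
  shows "\<exists>K\<ge>1. \<forall>n>0. real (card {d. d dvd n}) \<le> K * real n powr \<epsilon>"
proof -
  \<comment> \<open>With this \<open>x\<close>, \<open>exp (x * v)\<close> equals
    \<open>(2 ^ v) powr \<epsilon>\<close>, and \<open>K0\<close> is large enough for
    \<open>v + 1 \<le> K0 * (1 + x * v)\<close>.\<close>
  define x where "x = \<epsilon> * ln 2"
  have x: "x > 0" using assms by (simp add: x_def)
  define K0 where "K0 = 1 + 1 / x"
  have K0: "K0 \<ge> 1" using x by (simp add: K0_def)
  have K0v: "real v + 1 \<le> K0 * (real p ^ v) powr \<epsilon>" if "p \<ge> 2" for p v :: nat
  proof -
    have "real v + 1 \<le> K0 * (1 + x * real v)" using x by (simp add: K0_def field_simps)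
    also have "1 + x * real v \<le> exp (x * real v)" by (rule exp_ge_add_one_self)
    also have "exp (x * real v) = (2 ^ v) powr \<epsilon>" by (simp add: powr_def x_def ln_realpow mult_ac)
    also have "(2 ^ v) powr \<epsilon> \<le> (real p ^ v) powr \<epsilon>"
      using that assms by (intro powr_mono2 power_mono) auto
    finally show ?thesis using K0 by (simp add: mult_left_mono)
  qed
  \<comment> \<open>From \<open>P\<close> on, \<open>p powr \<epsilon>\<close> is at least 2, so
    \<open>v + 1 \<le> 2 ^ v\<close> already gives the factor without a constant.\<close>
  obtain P :: nat where P: "2 powr (1 / \<epsilon>) \<le> real P" using real_arch_simple by blast
  have big: "real v + 1 \<le> (real p ^ v) powr \<epsilon>" if "p \<ge> P" for p v :: nat
  proof -
    have p: "p > 0" using P that by (metis gr0I le_zero_eq of_nat_0 powr_gt_zero not_less zero_neq_numeral)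
    have "(2::real) = (2 powr (1 / \<epsilon>)) powr \<epsilon>" using assms by (simp add: powr_powr)
    also have "\<dots> \<le> real p powr \<epsilon>" using P that assms by (intro powr_mono2) auto
    finally have *: "2 ^ v \<le> (real p powr \<epsilon>) ^ v" by (intro power_mono) auto
    have "real (v + 1) \<le> real (2 ^ v)" using Suc_leI[OF less_exp[of v]] by (subst of_nat_le_iff) simp
    also have "\<dots> \<le> (real p powr \<epsilon>) ^ v" using * by simp
    also have "\<dots> = (real p ^ v) powr \<epsilon>" using p
      by (simp add: powr_powr mult.commute flip: powr_realpow)
    finally show ?thesis by simp
  qed
  define S where "S = (\<lambda>n. {p. prime p \<and> p dvd n \<and> p < P})"
  have finS: "finite (S n)" for n by (rule finite_subset[of _ "{..<P}"]) (auto simp: S_def)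
  \<comment> \<open>Induction strips the full power of one prime at a time. The exponent of
    \<open>K0\<close> counts only the prime divisors below \<open>P\<close>, so it stays at most
    \<open>P\<close>.\<close>
  have main: "n > 0 \<Longrightarrow> real (card {d. d dvd n}) \<le> K0 ^ card (S n) * real n powr \<epsilon>" for n
  proof (induction n rule: less_induct)
    case (less n)
    show ?case
    proof (cases "n = 1")
      case True
      then have "{d. d dvd n} = {1}" by auto
      then show ?thesis using True K0 by simp
    next
      case False
      then obtain p where p: "prime p" "p dvd n" by (metis prime_factor_nat)
      define v where "v = multiplicity p n"
      obtain m where m: "n = p ^ v * m" "\<not> p dvd m"
        using multiplicity_decompose'[of n p] p less.prems unfolding v_def by (metis not_prime_unit not_gr0)
      have v: "v > 0" using p m by (metis gr0I mult_1 power_0)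
      have m0: "m > 0" using m less.prems by (cases m) auto
      have "p ^ v > 1" using p v by (metis one_less_power prime_gt_1_nat)
      then have mn: "m < n" using m m0 by simp
      have p2: "p \<ge> 2" using p by (simp add: prime_ge_2_nat)
      have "real (card {d. d dvd n}) \<le> (real v + 1) * real (card {d. d dvd m})"
        using of_nat_mono[OF card_divisors_prime_power_mult[OF p(1) m0, of v], where 'a = real]
        unfolding m(1)[symmetric] by (simp only: of_nat_add of_nat_mult of_nat_1)
      also have "\<dots> \<le> (real v + 1) * (K0 ^ card (S m) * real m powr \<epsilon>)"
        using less.IH[OF mn m0] by (intro mult_left_mono) auto
      also have "\<dots> \<le> K0 ^ card (S n) * real n powr \<epsilon>"
      proof (cases "p < P")
        case True
        have "q = p" if "prime q" "q dvd p ^ v" for q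
          using that p(1) by (metis prime_dvd_power primes_dvd_imp_eq)
        then have "S n = insert p (S m)" using p m True by (auto simp: S_def prime_dvd_mult_iff)
        moreover have "p \<notin> S m" using m by (simp add: S_def)
        ultimately have "card (S n) = Suc (card (S m))" using finS by simp
        moreover have "(real v + 1) * (K0 ^ card (S m) * real m powr \<epsilon>)
            \<le> (K0 * (real p ^ v) powr \<epsilon>) * (K0 ^ card (S m) * real m powr \<epsilon>)"
          using K0v[OF p2, of v] K0 by (intro mult_right_mono) auto
        ultimately show ?thesis by (simp add: m(1) powr_mult mult_ac)
      next
        case False
        have "S m \<subseteq> S n" using m by (auto simp: S_def)
        then have "K0 ^ card (S m) \<le> K0 ^ card (S n)"
          using K0 finS by (intro power_increasing card_mono) auto
        then have "(real v + 1) * (K0 ^ card (S m) * real m powr \<epsilon>)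
            \<le> ((real p ^ v) powr \<epsilon>) * (K0 ^ card (S n) * real m powr \<epsilon>)"
          using big[of p v] False K0 by (intro mult_mono mult_right_mono) auto
        then show ?thesis by (simp add: m(1) powr_mult mult_ac)
      qed
      finally show ?thesis .
    qed
  qed
  show ?thesis
  proof (intro exI[of _ "K0 ^ P"] conjI allI impI)
    show "1 \<le> K0 ^ P" using K0 by simp
    fix n :: nat assume n: "n > 0"
    have "card (S n) \<le> P" using card_mono[of "{..<P}" "S n"] by (auto simp: S_def)
    then have "K0 ^ card (S n) \<le> K0 ^ P" using K0 by (intro power_increasing) auto
    then show "real (card {d. d dvd n}) \<le> K0 ^ P * real n powr \<epsilon>"
      using main[OF n] by (meson mult_right_mono order_trans powr_ge_zero)
  qed
qed

lemma int_divisor_bound: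
  fixes \<epsilon> :: real
  assumes "\<epsilon> > 0"
  shows "\<exists>K\<ge>1. \<forall>z. z \<noteq> 0 \<longrightarrow> real (card {d :: int. d dvd z}) \<le> K * real_of_int \<bar>z\<bar> powr \<epsilon>"
proof -
  obtain K where K: "K \<ge> 1" "\<And>n. n > 0 \<Longrightarrow> real (card {d. d dvd n}) \<le> K * real n powr \<epsilon>"
    using divisor_bound[OF assms] by blast
  show ?thesis
  proof (intro exI[of _ "2 * K"] conjI allI impI)
    show "1 \<le> 2 * K" using K by simp
    fix z :: int assume z: "z \<noteq> 0"
    let ?D = "{d. d dvd nat \<bar>z\<bar>}"
    have "{d. d dvd z} \<subseteq> int ` ?D \<union> (\<lambda>d. - int d) ` ?D"
    proof
      fix d assume "d \<in> {d. d dvd z}"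
      then have "nat \<bar>d\<bar> \<in> ?D" by (simp add: nat_abs_dvd_iff) 
      moreover have "d = int (nat \<bar>d\<bar>) \<or> d = - int (nat \<bar>d\<bar>)" by auto
      ultimately show "d \<in> int ` ?D \<union> (\<lambda>d. - int d) ` ?D" by blast
    qed
    moreover have fin: "finite ?D" using z by (intro finite_divisors_nat) simp
    ultimately have "card {d. d dvd z} \<le> card (int ` ?D \<union> (\<lambda>d. - int d) ` ?D)"
      by (intro card_mono) auto
    also have "\<dots> \<le> card ?D + card ?D"
      by (rule order_trans[OF card_Un_le]) (intro add_mono card_image_le fin)
    finally have "real (card {d. d dvd z}) \<le> 2 * real (card ?D)" by linarith
    also have "\<dots> \<le> 2 * (K * real (nat \<bar>z\<bar>) powr \<epsilon>)" using K(2)[of "nat \<bar>z\<bar>"] z by simp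
    finally show "real (card {d. d dvd z}) \<le> 2 * K * real_of_int \<bar>z\<bar> powr \<epsilon>"
      using z by simp
  qed
qed

section \<open>Linear equations in unit fractions\<close>

definition nonzero_ints :: "real \<Rightarrow> int set" where
  "nonzero_ints H = {a. a \<noteq> 0 \<and> real_of_int \<bar>a\<bar> \<le> H}"

lemma finite_nonzero_ints: "finite (nonzero_ints H)"
proof (rule finite_subset)
  show "nonzero_ints H \<subseteq> {- \<lfloor>H\<rfloor>..\<lfloor>H\<rfloor>}"
    unfolding nonzero_ints_def by (auto simp: le_floor_iff abs_le_iff) linarith
qed simp

lemma card_nonzero_ints: "H \<ge> 1 \<Longrightarrow> real (card (nonzero_ints H)) \<le> 2 * H"
proof -
  assume H: "H \<ge> 1"
  have "nonzero_ints H \<subseteq> {- \<lfloor>H\<rfloor>..\<lfloor>H\<rfloor>} - {0}"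
    unfolding nonzero_ints_def by (auto simp: le_floor_iff abs_le_iff) linarith
  then have "card (nonzero_ints H) \<le> card ({- \<lfloor>H\<rfloor>..\<lfloor>H\<rfloor>} - {0})" by (intro card_mono) auto
  also have "\<dots> = nat (2 * \<lfloor>H\<rfloor>)" using H by (simp add: card_Diff_subset)
  finally have "real (card (nonzero_ints H)) \<le> real (nat (2 * \<lfloor>H\<rfloor>))" by simp
  also have "\<dots> = 2 * of_int \<lfloor>H\<rfloor>" using H by simp
  finally show ?thesis by linarith
qed

lemma unit_fractions_eq: "unit_fractions H = (\<lambda>a. 1 / of_int a) ` nonzero_ints H"
  unfolding unit_fractions_def nonzero_ints_def by auto

lemma card_unit_fractions: "H \<ge> 1 \<Longrightarrow> real (card (unit_fractions H)) \<le> 2 * H"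
  unfolding unit_fractions_eq
  using card_nonzero_ints[of H] card_image_le[OF finite_nonzero_ints, of "\<lambda>a. 1 / of_int a :: rat" H]
  by linarith

lemma unit_fractions_nonzero: "x \<in> unit_fractions H \<Longrightarrow> x \<noteq> 0"
  by (auto simp: unit_fractions_def)

definition solutions :: "real \<Rightarrow> nat set \<Rightarrow> (nat \<Rightarrow> int) \<Rightarrow> (nat \<Rightarrow> rat) set" where
  "solutions H S d = {x \<in> S \<rightarrow>\<^sub>E unit_fractions H. (\<Sum>s\<in>S. of_int (d s) * x s) = 0}"

text \<open>The equation of \<open>solutions\<close> with \<open>x s = 1 / b s\<close>, multiplied
  by the product of all denominators.\<close>

definition int_solutions :: "real \<Rightarrow> nat set \<Rightarrow> (nat \<Rightarrow> int) \<Rightarrow> (nat \<Rightarrow> int) set" where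
  "int_solutions H S d =
     {b \<in> S \<rightarrow>\<^sub>E nonzero_ints H. (\<Sum>s\<in>S. d s * (\<Prod>t\<in>S - {s}. b t)) = 0}"

lemma finite_int_solutions: "finite S \<Longrightarrow> finite (int_solutions H S d)"
  unfolding int_solutions_def by (simp add: finite_PiE finite_nonzero_ints)

lemma finite_solutions: "finite S \<Longrightarrow> finite (solutions H S d)"
  unfolding solutions_def by (simp add: finite_PiE finite_unit_fractions)

lemma card_solutions_le:
  assumes S: "finite S"
  shows "card (solutions H S d) \<le> card (int_solutions H S d)"
proof (rule surj_card_le[OF finite_int_solutions[OF S]])
  show "solutions H S d \<subseteq> (\<lambda>b. \<lambda>s\<in>S. 1 / of_int (b s)) ` int_solutions H S d"
  proof
    fix x assume x: "x \<in> solutions H S d"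
    then have "\<forall>s\<in>S. \<exists>a\<in>nonzero_ints H. x s = 1 / of_int a"
      by (auto simp: solutions_def unit_fractions_eq)
    then obtain b0 where b0: "\<And>s. s \<in> S \<Longrightarrow> b0 s \<in> nonzero_ints H \<and> x s = 1 / of_int (b0 s)"
      by metis
    define b where "b = restrict b0 S"
    have b: "b s \<in> nonzero_ints H" "x s = 1 / of_int (b s)" "b s \<noteq> 0" if "s \<in> S" for s
      using b0[OF that] that by (auto simp: b_def nonzero_ints_def)
    have xb: "x = (\<lambda>s\<in>S. 1 / of_int (b s))"
      using x b(2) by (intro extensionalityI[of _ S]) (auto simp: solutions_def PiE_def)
    have "of_int (\<Sum>s\<in>S. d s * (\<Prod>t\<in>S - {s}. b t)) = (\<Sum>s\<in>S. (\<Prod>t\<in>S. of_int (b t)) * (of_int (d s) * x s))"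
      unfolding of_int_sum
    proof (intro sum.cong refl)
      fix s assume s: "s \<in> S"
      have "(\<Prod>t\<in>S. of_int (b t)) = of_int (b s) * (\<Prod>t\<in>S - {s}. of_int (b t) :: rat)"
        by (rule prod.remove[OF S s])
      then show "of_int (d s * (\<Prod>t\<in>S - {s}. b t)) = (\<Prod>t\<in>S. of_int (b t)) * (of_int (d s) * x s)"
        using b[OF s] by simp
    qed
    also have "\<dots> = 0" using x by (simp add: solutions_def flip: sum_distrib_left)
    finally have "(\<Sum>s\<in>S. d s * (\<Prod>t\<in>S - {s}. b t)) = 0" by (simp only: of_int_eq_0_iff)
    then have "b \<in> int_solutions H S d" using b(1) by (auto simp: int_solutions_def b_def)
    then show "x \<in> (\<lambda>b. \<lambda>s\<in>S. 1 / of_int (b s)) ` int_solutions H S d" using xb by blast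
  qed
qed

text \<open>\<open>k\<close> counts the terms and \<open>t\<close> is the exponent gained. The
  constant \<open>K\<close> is chosen before \<open>H\<close>, \<open>S\<close> and
  \<open>d\<close>, because the coefficients depend on the part of the matrix that is already fixed
  and are controlled only by \<open>C\<close> and \<open>B\<close>.\<close>

definition eqn_bound :: "nat \<Rightarrow> real \<Rightarrow> bool" where
  "eqn_bound k t \<longleftrightarrow> (\<forall>C B. \<exists>K. \<forall>H\<ge>1. \<forall>S d. finite S \<longrightarrow> card S = k \<longrightarrow>
     (\<forall>s\<in>S. d s \<noteq> 0 \<and> real_of_int \<bar>d s\<bar> \<le> C * H ^ B) \<longrightarrow>
     real (card (solutions H S d)) \<le> K * H powr t)"

text \<open>One unknown determines the other. The exponent is 1 with no \<epsilon>, which is what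
  allows a bound without \<open>o(1)\<close> in the last case of the theorem.\<close>

lemma eqn_bound_2: "eqn_bound 2 1"
  unfolding eqn_bound_def
proof (intro allI, rule exI[of _ 2], intro allI impI)
  fix C :: real and B H and S :: "nat set" and d
  assume H: "1 \<le> H" and S: "finite S" "card S = 2"
    and d: "\<forall>s\<in>S. d s \<noteq> (0::int) \<and> real_of_int \<bar>d s\<bar> \<le> C * H ^ B"
  obtain s1 s2 where s: "S = {s1, s2}" "s1 \<noteq> s2" using S(2) by (auto simp: card_2_iff)
  have "card (solutions H S d) \<le> card (unit_fractions H)"
  proof (rule card_inj_on_le)
    show "inj_on (\<lambda>x. x s1) (solutions H S d)"
    proof (rule inj_onI)
      fix x y assume xy: "x \<in> solutions H S d" "y \<in> solutions H S d" "x s1 = y s1"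
      then have "of_int (d s2) * x s2 = of_int (d s2) * y s2"
        using s by (auto simp: solutions_def add_eq_0_iff)
      then have "x s2 = y s2" using d s by simp
      then show "x = y" using xy s by (intro extensionalityI[of _ S]) (auto simp: solutions_def PiE_def)
    qed
  qed (use s in \<open>auto simp: solutions_def finite_unit_fractions\<close>)
  then show "real (card (solutions H S d)) \<le> 2 * H powr 1"
    using card_unit_fractions[OF H] H by simp
qed

text \<open>The cleared equation
  \<open>d p * b q * b r + d q * b p * b r + d r * b p * b q = 0\<close>, multiplied by
  \<open>d p\<close>, factors as \<open>(d p * b q + d q * b p) * (d p * b r + d r * b p) = d q * d
  r * (b p)\<^sup>2\<close>. So for each of the \<open>O(H)\<close> values of \<open>b p\<close> the
  first factor is a divisor of a known nonzero number; it gives \<open>b q\<close>, and then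
  \<open>b r\<close>.\<close>

lemma eqn_bound_3:
  assumes "\<epsilon> > 0"
  shows "eqn_bound 3 (1 + \<epsilon>)"
  unfolding eqn_bound_def
proof (intro allI)
  fix C :: real and B :: nat
  define C' where "C' = max 1 C"
  \<comment> \<open>The number whose divisors are counted is at most
    \<open>C'\<^sup>2 * H ^ (2 * B + 2)\<close>.\<close>
  define \<delta> where "\<delta> = \<epsilon> / real (2 * B + 2)"
  have \<delta>: "\<delta> > 0" using assms by (simp add: \<delta>_def)
  obtain K where K: "K \<ge> 1"
    "\<And>z. z \<noteq> 0 \<Longrightarrow> real (card {d :: int. d dvd z}) \<le> K * real_of_int \<bar>z\<bar> powr \<delta>"
    using int_divisor_bound[OF \<delta>] by blast
  define K' where "K' = 2 * K * (C'^2) powr \<delta>"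
  show "\<exists>K. \<forall>H\<ge>1. \<forall>(S :: nat set) d. finite S \<longrightarrow> card S = 3 \<longrightarrow>
     (\<forall>s\<in>S. d s \<noteq> (0::int) \<and> real_of_int \<bar>d s\<bar> \<le> C * H ^ B) \<longrightarrow>
     real (card (solutions H S d)) \<le> K * H powr (1 + \<epsilon>)"
  proof (rule exI[of _ K'], intro allI impI)
    fix H and S :: "nat set" and d
    assume H: "1 \<le> H" and S: "finite S" "card S = 3"
      and d: "\<forall>s\<in>S. d s \<noteq> (0::int) \<and> real_of_int \<bar>d s\<bar> \<le> C * H ^ B"
    obtain p q r where s: "S = {p, q, r}" "p \<noteq> q" "p \<noteq> r" "q \<noteq> r"
      using S(2) by (auto simp: card_3_iff)
    let ?Y = "\<lambda>b. {u. u dvd d q * d r * b\<^sup>2}"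
    let ?f = "\<lambda>b. (b p, d p * b q + d q * b p)"
    have d0: "d p \<noteq> 0" "d q \<noteq> 0" "d r \<noteq> 0" using d s by auto
    have rel: "b r * (d p * b q + d q * b p) = - (d r * b p * b q)"
      if "b \<in> int_solutions H S d" for b
    proof -
      have "S - {p} = {q, r}" "S - {q} = {p, r}" "S - {r} = {p, q}" using s by auto
      then show ?thesis using that s
        by (simp add: int_solutions_def algebra_simps eq_neg_iff_add_eq_0)
    qed
    have nz: "b p \<noteq> 0" "b q \<noteq> 0" "b r \<noteq> 0" "b p \<in> nonzero_ints H" if "b \<in> int_solutions H S d" for b
      using that s by (auto simp: int_solutions_def nonzero_ints_def)
    have "card (int_solutions H S d) \<le> card (SIGMA b : nonzero_ints H. ?Y b)"
    proof (rule card_inj_on_le)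
      show "inj_on ?f (int_solutions H S d)"
      proof (rule inj_onI)
        fix b c assume bc: "b \<in> int_solutions H S d" "c \<in> int_solutions H S d" "?f b = ?f c"
        then have e: "b p = c p" "b q = c q" using d0 by auto
        have "b r * (d p * b q + d q * b p) = c r * (d p * b q + d q * b p)"
          using rel[OF bc(1)] rel[OF bc(2)] e by simp
        moreover have "d p * b q + d q * b p \<noteq> 0"
          using rel[OF bc(1)] nz[OF bc(1)] d0 by auto
        ultimately have "b r = c r" by simp
        then show "b = c"
          using bc e s by (intro extensionalityI[of _ S]) (auto simp: int_solutions_def PiE_def)
      qed
      show "?f ` int_solutions H S d \<subseteq> (SIGMA b : nonzero_ints H. ?Y b)"
      proof safe
        fix b assume b: "b \<in> int_solutions H S d"
        show "b p \<in> nonzero_ints H" using nz[OF b] by simp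
        have "(d p * b q + d q * b p) * (d p * b r + d r * b p) = d q * d r * (b p)\<^sup>2"
        proof -
          have "(d p * b q + d q * b p) * (d p * b r + d r * b p) =
              d p * (b r * (d p * b q + d q * b p)) + d r * b p * (d p * b q + d q * b p)"
            by (simp add: algebra_simps)
          then show ?thesis unfolding rel[OF b] by (simp add: algebra_simps power2_eq_square)
        qed
        then show "d p * b q + d q * b p dvd d q * d r * (b p)\<^sup>2" by (metis dvd_triv_left)
      qed
      have "finite (?Y b)" if "b \<in> nonzero_ints H" for b
        using that d0 finite_divisors_int[of "d q * d r * b\<^sup>2"] by (auto simp: nonzero_ints_def)
      then show "finite (SIGMA b : nonzero_ints H. ?Y b)" by (intro finite_SigmaI finite_nonzero_ints)
    qed
    also have "\<dots> = (\<Sum>b\<in>nonzero_ints H. card (?Y b))"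
    proof (rule card_SigmaI[OF finite_nonzero_ints], rule ballI)
      fix b assume "b \<in> nonzero_ints H" 
      then show "finite (?Y b)" using d0 finite_divisors_int[of "d q * d r * b\<^sup>2"] by (auto simp: nonzero_ints_def)
    qed
    finally have "real (card (int_solutions H S d)) \<le> (\<Sum>b\<in>nonzero_ints H. real (card (?Y b)))"
      by (metis of_nat_le_iff of_nat_sum)
    also have "\<dots> \<le> (\<Sum>b\<in>nonzero_ints H. K * (C'\<^sup>2) powr \<delta> * H powr \<epsilon>)"
    proof (rule sum_mono)
      fix b assume b: "b \<in> nonzero_ints H"
      have dC: "real_of_int \<bar>d s\<bar> \<le> C' * H ^ B" if "s \<in> S" for s
      proof -
        have "real_of_int \<bar>d s\<bar> \<le> C * H ^ B" using d that by auto
        also have "\<dots> \<le> C' * H ^ B" using H by (intro mult_right_mono) (auto simp: C'_def)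
        finally show ?thesis .
      qed
      have "real_of_int \<bar>d q * d r * b\<^sup>2\<bar> = real_of_int \<bar>d q\<bar> * real_of_int \<bar>d r\<bar> * (real_of_int \<bar>b\<bar>)\<^sup>2"
        by (simp add: abs_mult)
      also have "\<dots> \<le> (C' * H ^ B) * (C' * H ^ B) * H\<^sup>2"
        using b dC[of q] dC[of r] s H
        by (intro mult_mono power_mono) (auto simp: nonzero_ints_def C'_def)
      also have "\<dots> = C'\<^sup>2 * H powr real (2 * B + 2)"
        using H by (subst powr_realpow) (auto simp: power2_eq_square power_add mult_2)
      finally have "real_of_int \<bar>d q * d r * b\<^sup>2\<bar> powr \<delta> \<le> (C'\<^sup>2 * H powr real (2 * B + 2)) powr \<delta>"
        using \<delta> by (intro powr_mono2) auto
      also have "\<dots> = (C'\<^sup>2) powr \<delta> * H powr \<epsilon>"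
        by (simp add: powr_mult powr_powr \<delta>_def)
      finally have "K * real_of_int \<bar>d q * d r * b\<^sup>2\<bar> powr \<delta> \<le> K * ((C'\<^sup>2) powr \<delta> * H powr \<epsilon>)"
        using K by (intro mult_left_mono) auto
      moreover have "d q * d r * b\<^sup>2 \<noteq> 0" using b d0 by (auto simp: nonzero_ints_def)
      ultimately show "real (card (?Y b)) \<le> K * (C'\<^sup>2) powr \<delta> * H powr \<epsilon>"
        using K(2)[of "d q * d r * b\<^sup>2"] by simp
    qed
    also have "\<dots> = real (card (nonzero_ints H)) * (K * (C'\<^sup>2) powr \<delta> * H powr \<epsilon>)" by simp
    also have "\<dots> \<le> (2 * H) * (K * (C'\<^sup>2) powr \<delta> * H powr \<epsilon>)"
      using K card_nonzero_ints[OF H] by (intro mult_right_mono) auto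
    also have "\<dots> = K' * H powr (1 + \<epsilon>)" using H by (simp add: K'_def powr_add)
    finally show "real (card (solutions H S d)) \<le> K' * H powr (1 + \<epsilon>)"
      using card_solutions_le[OF S(1), of H d] by linarith
  qed
qed

text \<open>A prime dividing exactly one of the denominators, to the first power, divides its coefficient.
  So away from the coefficients the product of the denominators is squareful.\<close>

lemma prod_denominators_dvd:
  fixes b d :: "nat \<Rightarrow> int"
  assumes S: "finite S" and b: "\<And>s. s \<in> S \<Longrightarrow> b s \<noteq> 0" and d: "\<And>s. s \<in> S \<Longrightarrow> d s \<noteq> 0"
    and eq: "(\<Sum>s\<in>S. d s * (\<Prod>t\<in>S - {s}. b t)) = 0"
  shows "(\<Prod>s\<in>S. b s) dvd (\<Prod>s\<in>S. d s) * square_part (\<Prod>s\<in>S. b s) ^ 3"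
proof -
  define N where "N = (\<Prod>s\<in>S. b s)"
  define D where "D = (\<Prod>s\<in>S. d s)"
  have N0: "N \<noteq> 0" and D0: "D \<noteq> 0" using b d S by (auto simp: N_def D_def)
  show ?thesis unfolding N_def[symmetric] D_def[symmetric]
  proof (rule multiplicity_le_imp_dvd)
    fix p :: int assume p: "prime p"
    \<comment> \<open>The exponent 3 is what \<open>v \<le> 3 * (v div 2)\<close> needs for all
      \<open>v \<ge> 2\<close>; it is attained at \<open>v = 3\<close>. Only \<open>v = 1\<close>
      fails, and there a factor \<open>p\<close> of the coefficients makes up for it.\<close>
    have 1: "multiplicity p (D * square_part N ^ 3) = multiplicity p D + 3 * (multiplicity p N div 2)"
      using prime_imp_prime_elem[OF p] p N0 D0 by (simp add: prime_elem_multiplicity_mult_distrib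
          prime_elem_multiplicity_power_distrib prime_multiplicity_square_part)
    have 2: "multiplicity p D \<ge> 1" if m: "multiplicity p N = 1"
    proof -
      have "p dvd N" using m by (metis not_dvd_imp_multiplicity_0 zero_neq_one)
      then obtain s where s: "s \<in> S" "p dvd b s"
        using p S prime_dvd_prod_iff[of S p b] by (auto simp: N_def)
      have Ns: "N = b s * (\<Prod>t\<in>S - {s}. b t)" unfolding N_def by (rule prod.remove[OF S s(1)])
      have "\<not> p dvd (\<Prod>t\<in>S - {s}. b t)"
      proof
        assume "p dvd (\<Prod>t\<in>S - {s}. b t)"
        then have "p ^ 2 dvd N" using s Ns by (simp add: mult_dvd_mono power2_eq_square)
        then have "2 \<le> multiplicity p N" using p N0
          by (metis multiplicity_geI not_prime_unit)
        then show False using m by simp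
      qed
      \<comment> \<open>Every term of the equation other than that of \<open>s\<close> contains the
        factor \<open>b s\<close>, hence \<open>p\<close>; so \<open>p\<close> divides the term of
        \<open>s\<close> as well.\<close>
      moreover have "p dvd d s * (\<Prod>t\<in>S - {s}. b t)"
      proof -
        have "d s * (\<Prod>t\<in>S - {s}. b t) = - (\<Sum>s'\<in>S - {s}. d s' * (\<Prod>t\<in>S - {s'}. b t))"
          using eq sum.remove[OF S s(1), of "\<lambda>s. d s * (\<Prod>t\<in>S - {s}. b t)"] by simp
        moreover have "p dvd (\<Sum>s'\<in>S - {s}. d s' * (\<Prod>t\<in>S - {s'}. b t))"
        proof (rule dvd_sum)
          fix s' assume "s' \<in> S - {s}"
          then have "s \<in> S - {s'}" using s by auto
          then have "b s dvd (\<Prod>t\<in>S - {s'}. b t)" using S by (intro dvd_prodI) auto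
          then show "p dvd d s' * (\<Prod>t\<in>S - {s'}. b t)" using s(2) by (meson dvd_mult dvd_trans)
        qed
        ultimately show ?thesis by simp
      qed
      ultimately have "p dvd d s" using p by (simp add: prime_dvd_mult_iff)
      also have "d s dvd D" unfolding D_def using S s by (intro dvd_prodI) auto
      finally show ?thesis using p D0
        by (metis multiplicity_geI not_prime_unit power_one_right)
    qed
    show "multiplicity p N \<le> multiplicity p (D * square_part N ^ 3)"
      unfolding 1 using 2 by (cases "multiplicity p N = 1") auto
  qed (rule N0)
qed

text \<open>Let \<open>w\<close> be the square part of the product \<open>N\<close> of the
  denominators. Since \<open>w\<^sup>2\<close> divides \<open>N\<close>, there are at most
  \<open>H powr (k / 2)\<close> values of \<open>w\<close>. Once \<open>w\<close> is known, every
  denominator divides the known number \<open>D * w ^ 3\<close>, so the \<open>k\<close> of them are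
  chosen in \<open>H powr \<epsilon>\<close> ways by the divisor bound.\<close>

lemma eqn_bound_half:
  assumes "\<epsilon> > 0"
  shows "eqn_bound k (real k / 2 + \<epsilon>)"
  unfolding eqn_bound_def
proof (intro allI)
  fix C :: real and B :: nat
  define C' where "C' = max 1 C"
  \<comment> \<open>The power of \<open>H\<close> in the bound for \<open>D * w ^ 3\<close>:
    \<open>B * k\<close> from the coefficients and \<open>3 * k / 2\<close> from
    \<open>w ^ 3\<close>.\<close>
  define B' where "B' = real (B * k) + 3 * real k / 2"
  have B': "B' \<ge> 0" by (simp add: B'_def)
  \<comment> \<open>Each of the \<open>k\<close> divisors costs
    \<open>H powr (B' * \<delta>)\<close>. The summand 1 keeps the denominator positive when
    \<open>k = 0\<close>.\<close>
  define \<delta> where "\<delta> = \<epsilon> / (B' * real k + 1)"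
  have den: "B' * real k + 1 > 0" using B' by (simp add: add_nonneg_pos)
  have \<delta>: "\<delta> > 0" using assms den by (simp add: \<delta>_def)
  obtain K where K: "K \<ge> 1"
    "\<And>z. z \<noteq> 0 \<Longrightarrow> real (card {d :: int. d dvd z}) \<le> K * real_of_int \<bar>z\<bar> powr \<delta>"
    using int_divisor_bound[OF \<delta>] by blast
  define K' where "K' = (K * (C' ^ k) powr \<delta>) ^ k"
  show "\<exists>K. \<forall>H\<ge>1. \<forall>(S :: nat set) d. finite S \<longrightarrow> card S = k \<longrightarrow>
     (\<forall>s\<in>S. d s \<noteq> (0::int) \<and> real_of_int \<bar>d s\<bar> \<le> C * H ^ B) \<longrightarrow>
     real (card (solutions H S d)) \<le> K * H powr (real k / 2 + \<epsilon>)"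
  proof (rule exI[of _ K'], intro allI impI)
    fix H and S :: "nat set" and d
    assume H: "1 \<le> H" and S: "finite S" "card S = k"
      and d: "\<forall>s\<in>S. d s \<noteq> (0::int) \<and> real_of_int \<bar>d s\<bar> \<le> C * H ^ B"
    define D where "D = (\<Prod>s\<in>S. d s)"
    define W where "W = {1..\<lfloor>H powr (real k / 2)\<rfloor>}"
    let ?Y = "\<lambda>w. S \<rightarrow>\<^sub>E {t. t dvd D * w ^ 3}"
    have D0: "D \<noteq> 0" using d S by (auto simp: D_def)
    have cardW: "real (card W) \<le> H powr (real k / 2)" by (simp add: W_def)
    have "real_of_int \<bar>D\<bar> = (\<Prod>s\<in>S. real_of_int \<bar>d s\<bar>)" by (simp add: D_def abs_prod)
    also have "\<dots> \<le> (\<Prod>s\<in>S. C' * H ^ B)"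
    proof (rule prod_mono)
      fix s assume "s \<in> S"
      then have "real_of_int \<bar>d s\<bar> \<le> C * H ^ B" using d by auto
      also have "\<dots> \<le> C' * H ^ B" using H by (intro mult_right_mono) (auto simp: C'_def)
      finally show "0 \<le> real_of_int \<bar>d s\<bar> \<and> real_of_int \<bar>d s\<bar> \<le> C' * H ^ B" by simp
    qed
    also have "\<dots> = C' ^ k * H powr real (B * k)"
      using H S by (subst powr_realpow) (auto simp: power_mult_distrib power_mult)
    finally have DH: "real_of_int \<bar>D\<bar> \<le> C' ^ k * H powr real (B * k)" .
    have fin: "finite {t. t dvd D * w ^ 3}" if "w \<in> W" for w
      using that D0 finite_divisors_int[of "D * w ^ 3"] by (auto simp: W_def)
    have "int_solutions H S d \<subseteq> (\<Union>w\<in>W. ?Y w)"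
    proof
      fix b assume b: "b \<in> int_solutions H S d"
      define N where "N = (\<Prod>s\<in>S. b s)"
      have b0: "b s \<noteq> 0" "real_of_int \<bar>b s\<bar> \<le> H" if "s \<in> S" for s
        using b that by (auto simp: int_solutions_def nonzero_ints_def)
      have N0: "N \<noteq> 0" using b0 S by (auto simp: N_def)
      have dvd: "N dvd D * square_part N ^ 3" unfolding N_def D_def
        using b0 b d S by (intro prod_denominators_dvd) (auto simp: int_solutions_def)
      define w where "w = square_part N"
      \<comment> \<open>Over the integers a normalized element is nonnegative, so only positive
        \<open>w\<close> have to be counted.\<close>
      have "normalize w = w" by (simp add: w_def square_part_nonzero[OF N0])
      then have "w \<ge> 0" by simp
      moreover have "w \<noteq> 0" using N0 by (simp add: w_def)
      ultimately have w1: "w \<ge> 1" by simp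
      have "w ^ 2 dvd N" by (simp add: w_def)
      then have "w ^ 2 \<le> \<bar>N\<bar>" using dvd_imp_le_int[OF N0, of "w ^ 2"] by simp
      then have "(real_of_int w) ^ 2 \<le> real_of_int \<bar>N\<bar>" by (metis of_int_le_iff of_int_power)
      also have "\<dots> = (\<Prod>s\<in>S. real_of_int \<bar>b s\<bar>)" by (simp add: N_def abs_prod)
      also have "\<dots> \<le> (\<Prod>s\<in>S. H)" using b0 by (intro prod_mono) auto
      also have "\<dots> = (H powr (real k / 2)) ^ 2"
        using H S by (simp add: powr_power powr_realpow)
      finally have "real_of_int w \<le> H powr (real k / 2)" by (rule power2_le_imp_le) simp
      then have "w \<in> W" using w1 by (simp add: W_def le_floor_iff)
      moreover have "b s dvd D * w ^ 3" if "s \<in> S" for s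
      proof -
        have "b s dvd N" unfolding N_def using S that by (intro dvd_prodI) auto
        then show ?thesis using dvd unfolding w_def by (rule dvd_trans)
      qed
      moreover have "b \<in> extensional S" using b by (simp add: int_solutions_def PiE_def)
      ultimately show "b \<in> (\<Union>w\<in>W. ?Y w)" by (auto simp: PiE_def)
    qed
    then have "card (int_solutions H S d) \<le> card (\<Union>w\<in>W. ?Y w)"
      using fin S by (intro card_mono finite_UN_I finite_PiE) (auto simp: W_def)
    also have "\<dots> \<le> (\<Sum>w\<in>W. card (?Y w))" by (rule card_UN_le) (simp add: W_def)
    also have "\<dots> = (\<Sum>w\<in>W. card {t. t dvd D * w ^ 3} ^ k)"
      using S by (simp add: card_PiE)
    finally have "real (card (int_solutions H S d)) \<le> (\<Sum>w\<in>W. real (card {t. t dvd D * w ^ 3}) ^ k)"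
      by (metis (no_types, lifting) of_nat_le_iff of_nat_power of_nat_sum sum.cong)
    also have "\<dots> \<le> (\<Sum>w\<in>W. K' * H powr \<epsilon>)"
    proof (rule sum_mono)
      fix w assume w: "w \<in> W"
      then have w0: "w \<ge> 1" "real_of_int w \<le> H powr (real k / 2)" by (auto simp: W_def le_floor_iff)
      have "real_of_int \<bar>D * w ^ 3\<bar> = real_of_int \<bar>D\<bar> * real_of_int w ^ 3" 
        using w0 by (simp add: abs_mult)
      also have "\<dots> \<le> (C' ^ k * H powr real (B * k)) * (H powr (real k / 2)) ^ 3"
        using DH w0 by (intro mult_mono power_mono) auto
      also have "(H powr (real k / 2)) ^ 3 = H powr (3 * real k / 2)"
        using H by (simp add: powr_power)
      also have "(C' ^ k * H powr real (B * k)) * H powr (3 * real k / 2) = C' ^ k * H powr B'"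
        by (simp add: B'_def powr_add)
      finally have "real_of_int \<bar>D * w ^ 3\<bar> powr \<delta> \<le> (C' ^ k * H powr B') powr \<delta>"
        using \<delta> by (intro powr_mono2) auto
      also have "\<dots> = (C' ^ k) powr \<delta> * H powr (B' * \<delta>)"
        by (simp add: powr_mult powr_powr)
      finally have "K * real_of_int \<bar>D * w ^ 3\<bar> powr \<delta> \<le> K * ((C' ^ k) powr \<delta> * H powr (B' * \<delta>))"
        using K by (intro mult_left_mono) auto
      then have "real (card {t. t dvd D * w ^ 3}) \<le> K * ((C' ^ k) powr \<delta> * H powr (B' * \<delta>))"
        using order_trans[OF K(2)[of "D * w ^ 3"]] D0 w0 by simp
      then have "real (card {t. t dvd D * w ^ 3}) ^ k \<le> (K * ((C' ^ k) powr \<delta> * H powr (B' * \<delta>))) ^ k"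
        by (intro power_mono) auto
      also have "\<dots> = K' * (H powr (B' * \<delta>)) ^ k" by (simp add: K'_def power_mult_distrib)
      also have "(H powr (B' * \<delta>)) ^ k = H powr (B' * \<delta> * k)"
        using H by (simp add: powr_power mult_ac)
      also have "B' * \<delta> * k \<le> \<epsilon>" 
      proof -
        have "B' * real k * \<epsilon> \<le> (B' * real k + 1) * \<epsilon>" using assms by simp
        then have "B' * real k * \<epsilon> / (B' * real k + 1) \<le> \<epsilon>" using den by (simp add: pos_divide_le_eq mult.commute)
        then show ?thesis by (simp add: \<delta>_def mult_ac)
      qed
      then have "H powr (B' * \<delta> * k) \<le> H powr \<epsilon>" using H by (intro powr_mono) auto
      finally show "real (card {t. t dvd D * w ^ 3}) ^ k \<le> K' * H powr \<epsilon>"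
        using K by (simp add: mult_left_mono K'_def)
    qed
    also have "\<dots> = real (card W) * (K' * H powr \<epsilon>)" by simp
    also have "\<dots> \<le> H powr (real k / 2) * (K' * H powr \<epsilon>)"
      using K cardW by (intro mult_right_mono) (auto simp: K'_def)
    also have "\<dots> = K' * H powr (real k / 2 + \<epsilon>)" by (simp add: powr_add)
    finally show "real (card (solutions H S d)) \<le> K' * H powr (real k / 2 + \<epsilon>)"
      using card_solutions_le[OF S(1), of H d] by linarith
  qed
qed

section \<open>Integer relations and rank\<close>

text \<open>Fraction-free Gaussian elimination for \<open>r\<close> equations in
  \<open>r + 1\<close> unknowns. One step replaces the bound \<open>M\<close> on the entries by
  \<open>2 * M\<^sup>2\<close>, so after \<open>r\<close> steps the solution is still bounded by a
  polynomial in \<open>M\<close>; its degree is irrelevant later.\<close>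

lemma integer_kernel_vector:
  "\<exists>(C :: int) (B :: nat). C \<ge> 0 \<and> (\<forall>M\<ge>1. \<forall>(I :: nat set) (K :: nat set) (a :: nat \<Rightarrow> nat \<Rightarrow> int).
     finite I \<longrightarrow> finite K \<longrightarrow> card I = r \<longrightarrow> card K = Suc r \<longrightarrow> (\<forall>i\<in>I. \<forall>k\<in>K. \<bar>a i k\<bar> \<le> M) \<longrightarrow>
     (\<exists>d. (\<exists>k\<in>K. d k \<noteq> 0) \<and> (\<forall>k\<in>K. \<bar>d k\<bar> \<le> C * M ^ B) \<and> (\<forall>i\<in>I. (\<Sum>k\<in>K. a i k * d k) = 0)))"
proof (induction r)
  case 0
  show ?case
  proof (rule exI[of _ 1], rule exI[of _ 0], intro conjI allI impI)
    fix M :: int and I K :: "nat set" and a :: "nat \<Rightarrow> nat \<Rightarrow> int"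
    assume "finite I" "finite K" "card I = 0" "card K = Suc 0"
    then show "\<exists>d. (\<exists>k\<in>K. d k \<noteq> 0) \<and> (\<forall>k\<in>K. \<bar>d k\<bar> \<le> 1 * M ^ 0) \<and> (\<forall>i\<in>I. (\<Sum>k\<in>K. a i k * d k) = 0)"
      by (intro exI[of _ "\<lambda>_. 1"]) (auto simp: card_Suc_eq)
  qed simp
next
  case (Suc r)
  then obtain C :: int and B :: nat where C: "C \<ge> 0" and IH0:
      "\<forall>M\<ge>1. \<forall>(I :: nat set) (K :: nat set) (a :: nat \<Rightarrow> nat \<Rightarrow> int).
       finite I \<longrightarrow> finite K \<longrightarrow> card I = r \<longrightarrow> card K = Suc r \<longrightarrow> (\<forall>i\<in>I. \<forall>k\<in>K. \<bar>a i k\<bar> \<le> M) \<longrightarrow>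
       (\<exists>d. (\<exists>k\<in>K. d k \<noteq> 0) \<and> (\<forall>k\<in>K. \<bar>d k\<bar> \<le> C * M ^ B) \<and> (\<forall>i\<in>I. (\<Sum>k\<in>K. a i k * d k) = 0))"
    by (elim exE conjE) (erule (1) that)
  note IH = IH0[rule_format]
  \<comment> \<open>The induction hypothesis at \<open>2 * M\<^sup>2\<close> bounds the reduced
    solution by \<open>Q\<close>; back substitution is a sum of \<open>r + 1\<close> terms of size
    at most \<open>M * Q\<close>.\<close>
  show ?case
  proof (rule exI[of _ "int (Suc r) * C * 2 ^ B"], rule exI[of _ "2 * B + 1"], intro conjI allI impI)
    show "0 \<le> int (Suc r) * C * 2 ^ B" using C by simp
    fix M :: int and I K :: "nat set" and a :: "nat \<Rightarrow> nat \<Rightarrow> int"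
    assume M: "1 \<le> M" and fin: "finite I" "finite K" and cI: "card I = Suc r" and cK: "card K = Suc (Suc r)"
      and a: "\<forall>i\<in>I. \<forall>k\<in>K. \<bar>a i k\<bar> \<le> M"
    define Q where "Q = C * (2 * M\<^sup>2) ^ B"
    have Q: "Q \<ge> 0" using C by (simp add: Q_def)
    have target: "int (Suc r) * C * 2 ^ B * M ^ (2 * B + 1) = int (Suc r) * M * Q"
      by (simp add: Q_def power_mult_distrib power_mult)
    have M2: "M \<le> 2 * M\<^sup>2" "1 \<le> 2 * M\<^sup>2"
    proof -
      have "M * 1 \<le> M * M" using M by (intro mult_left_mono) auto
      then show "M \<le> 2 * M\<^sup>2" "1 \<le> 2 * M\<^sup>2" using M unfolding power2_eq_square by linarith+
    qed
    have Q1: "Q \<le> int (Suc r) * M * Q"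
    proof -
      have "1 * 1 \<le> int (Suc r) * M" using M by (intro mult_mono) auto
      then have "1 * Q \<le> int (Suc r) * M * Q" using Q by (intro mult_right_mono) auto
      then show ?thesis by simp
    qed
    obtain i0 where i0: "i0 \<in> I" using cI by (auto simp: card_Suc_eq)
    define I' where "I' = I - {i0}"
    have I': "finite I'" "card I' = r" "I = insert i0 I'" using fin cI i0 by (auto simp: I'_def)
    have "\<exists>d. (\<exists>k\<in>K. d k \<noteq> 0) \<and>
        (\<forall>k\<in>K. \<bar>d k\<bar> \<le> int (Suc r) * M * Q) \<and> (\<forall>i\<in>I. (\<Sum>k\<in>K. a i k * d k) = 0)"
    proof (cases "\<exists>k\<in>K. a i0 k \<noteq> 0")
      \<comment> \<open>Equation \<open>i0\<close> is empty, so one unknown can be set to 0 and the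
        other \<open>r\<close> equations solved in the remaining \<open>r + 1\<close>
        unknowns.\<close>
      case False
      obtain k1 where k1: "k1 \<in> K" using cK by (auto simp: card_Suc_eq)
      have "\<bar>a i k\<bar> \<le> 2 * M\<^sup>2" if "i \<in> I'" "k \<in> K - {k1}" for i k
        using a that I' order_trans[OF _ M2(1), of "\<bar>a i k\<bar>"] by auto
      then have "\<exists>d. (\<exists>k\<in>K - {k1}. d k \<noteq> 0) \<and> (\<forall>k\<in>K - {k1}. \<bar>d k\<bar> \<le> Q) \<and>
          (\<forall>i\<in>I'. (\<Sum>k\<in>K - {k1}. a i k * d k) = 0)"
        using fin cK k1 I' M2 unfolding Q_def by (intro IH) auto
      then obtain d where d: "\<exists>k\<in>K - {k1}. d k \<noteq> 0" "\<forall>k\<in>K - {k1}. \<bar>d k\<bar> \<le> Q"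
          "\<forall>i\<in>I'. (\<Sum>k\<in>K - {k1}. a i k * d k) = 0"
        by blast
      have sum: "(\<Sum>k\<in>K. a i k * (d(k1 := 0)) k) = (\<Sum>k\<in>K - {k1}. a i k * d k)" for i
        by (subst sum.remove[OF fin(2) k1]) (auto intro!: sum.cong)
      have z: "(\<Sum>k\<in>K - {k1}. a i0 k * d k) = 0" using False by (intro sum.neutral) auto
      show ?thesis
      proof (intro exI[of _ "d(k1 := 0)"] conjI ballI)
        show "\<exists>k\<in>K. (d(k1 := 0)) k \<noteq> 0" using d(1) by auto
        show "\<bar>(d(k1 := 0)) k\<bar> \<le> int (Suc r) * M * Q" if "k \<in> K" for k
        proof (cases "k = k1")
          case True then show ?thesis using Q1 Q by simp
        next
          case False
          then have "\<bar>d k\<bar> \<le> Q" using d(2) that by auto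
          then show ?thesis using Q1 False by simp
        qed
        show "(\<Sum>k\<in>K. a i k * (d(k1 := 0)) k) = 0" if "i \<in> I" for i
          unfolding sum using that d(3) z I' by auto
      qed
    next
      case True
      then obtain k1 where k1: "k1 \<in> K" "a i0 k1 \<noteq> 0" by blast
      define a' where "a' = (\<lambda>i k. a i0 k1 * a i k - a i k1 * a i0 k)"
      have "\<bar>a' i k\<bar> \<le> 2 * M\<^sup>2" if "i \<in> I'" "k \<in> K - {k1}" for i k
      proof -
        have "\<bar>a' i k\<bar> \<le> \<bar>a i0 k1\<bar> * \<bar>a i k\<bar> + \<bar>a i k1\<bar> * \<bar>a i0 k\<bar>"
          unfolding a'_def by (rule order_trans[OF abs_triangle_ineq4]) (simp add: abs_mult)
        also have "\<dots> \<le> M * M + M * M"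
          using a that k1 i0 I' M by (intro add_mono mult_mono) auto
        finally show ?thesis by (simp add: power2_eq_square)
      qed
      then have "\<exists>d. (\<exists>k\<in>K - {k1}. d k \<noteq> 0) \<and> (\<forall>k\<in>K - {k1}. \<bar>d k\<bar> \<le> Q) \<and>
          (\<forall>i\<in>I'. (\<Sum>k\<in>K - {k1}. a' i k * d k) = 0)"
        using fin cK k1 I' M2 unfolding Q_def by (intro IH) auto
      then obtain d where d: "\<exists>k\<in>K - {k1}. d k \<noteq> 0" "\<forall>k\<in>K - {k1}. \<bar>d k\<bar> \<le> Q"
          "\<forall>i\<in>I'. (\<Sum>k\<in>K - {k1}. a' i k * d k) = 0"
        by blast
      define \<Sigma> where "\<Sigma> = (\<Sum>k\<in>K - {k1}. a i0 k * d k)"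
      \<comment> \<open>Multiplying the other unknowns by the pivot, instead of dividing the
        eliminated one by it, keeps the vector integral.\<close>
      define d' where "d' = (\<lambda>k. if k = k1 then - \<Sigma> else a i0 k1 * d k)"
      have sum: "(\<Sum>k\<in>K. a i k * d' k) = (\<Sum>k\<in>K - {k1}. a' i k * d k)" for i
      proof -
        have "(\<Sum>k\<in>K. a i k * d' k) = - a i k1 * \<Sigma> + (\<Sum>k\<in>K - {k1}. a i k * (a i0 k1 * d k))"
          by (subst sum.remove[OF fin(2) k1(1)]) (auto simp: d'_def intro!: sum.cong)
        also have "\<dots> = (\<Sum>k\<in>K - {k1}. a' i k * d k)"
          unfolding \<Sigma>_def sum_distrib_left sum.distrib[symmetric]
          by (intro sum.cong) (auto simp: a'_def algebra_simps)
        finally show ?thesis .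
      qed
      show ?thesis
      proof (intro exI[of _ d'] conjI ballI)
        show "\<exists>k\<in>K. d' k \<noteq> 0" using d(1) k1 by (auto simp: d'_def)
        show "\<bar>d' k\<bar> \<le> int (Suc r) * M * Q" if "k \<in> K" for k
        proof (cases "k = k1")
          case True
          have "\<bar>\<Sigma>\<bar> \<le> (\<Sum>k\<in>K - {k1}. \<bar>a i0 k * d k\<bar>)" unfolding \<Sigma>_def by (rule sum_abs)
          also have "\<dots> \<le> (\<Sum>k\<in>K - {k1}. M * Q)"
            using a i0 d(2) M unfolding abs_mult by (intro sum_mono mult_mono) auto
          also have "\<dots> = int (Suc r) * M * Q" using cK k1 fin by simp
          finally show ?thesis using True by (simp add: d'_def)
        next
          case False
          have "\<bar>d' k\<bar> = \<bar>a i0 k1\<bar> * \<bar>d k\<bar>" using False by (simp add: d'_def abs_mult)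
          also have "\<dots> \<le> M * Q" using a i0 k1 d(2) that False M by (intro mult_mono) auto
          also have "\<dots> \<le> int (Suc r) * M * Q" using M Q mult_nonneg_nonneg[of M Q]
            by (simp add: algebra_simps)
          finally show ?thesis .
        qed
        show "(\<Sum>k\<in>K. a i k * d' k) = 0" if "i \<in> I" for i
        proof (cases "i = i0")
          case True
          have "a' i0 k = 0" for k by (simp add: a'_def)
          then show ?thesis unfolding sum True by simp
        next
          case False
          then show ?thesis unfolding sum using d(3) that I' by auto
        qed
      qed
    qed
    then show "\<exists>d. (\<exists>k\<in>K. d k \<noteq> 0) \<and>
        (\<forall>k\<in>K. \<bar>d k\<bar> \<le> int (Suc r) * C * 2 ^ B * M ^ (2 * B + 1)) \<and> (\<forall>i\<in>I. (\<Sum>k\<in>K. a i k * d k) = 0)"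
      unfolding target .
  qed
qed

text \<open>Multiplying each equation by the product of its \<open>r + 1\<close> denominators makes
  every coefficient a product of \<open>r\<close> of them, so \<open>integer_kernel_vector\<close>
  applies with \<open>M = \<lfloor>H\<rfloor> ^ r\<close>.\<close>

lemma unit_fraction_kernel_vector:
  "\<exists>C B. \<forall>H\<ge>1. \<forall>(I :: nat set) (K :: nat set) (a :: nat \<Rightarrow> nat \<Rightarrow> rat).
     finite I \<longrightarrow> finite K \<longrightarrow> card I = r \<longrightarrow> card K = Suc r \<longrightarrow> (\<forall>i\<in>I. \<forall>k\<in>K. a i k \<in> unit_fractions H) \<longrightarrow>
     (\<exists>d. (\<exists>k\<in>K. d k \<noteq> 0) \<and> (\<forall>k\<in>K. real_of_int \<bar>d k\<bar> \<le> C * H ^ B) \<and>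
       (\<forall>i\<in>I. (\<Sum>k\<in>K. of_int (d k) * a i k) = 0))"
proof -
  obtain C :: int and B :: nat where C: "C \<ge> 0" and ker0:
      "\<forall>M\<ge>1. \<forall>(I :: nat set) (K :: nat set) (a :: nat \<Rightarrow> nat \<Rightarrow> int).
       finite I \<longrightarrow> finite K \<longrightarrow> card I = r \<longrightarrow> card K = Suc r \<longrightarrow> (\<forall>i\<in>I. \<forall>k\<in>K. \<bar>a i k\<bar> \<le> M) \<longrightarrow>
       (\<exists>d. (\<exists>k\<in>K. d k \<noteq> 0) \<and> (\<forall>k\<in>K. \<bar>d k\<bar> \<le> C * M ^ B) \<and> (\<forall>i\<in>I. (\<Sum>k\<in>K. a i k * d k) = 0))"
    using integer_kernel_vector[of r] by (elim exE conjE) (erule (1) that)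
  note ker = ker0[rule_format]
  show ?thesis
  proof (rule exI[of _ "real_of_int C"], rule exI[of _ "r * B"], intro allI impI)
    fix H :: real and I K :: "nat set" and a :: "nat \<Rightarrow> nat \<Rightarrow> rat"
    assume H: "1 \<le> H" and fin: "finite I" "finite K" and c: "card I = r" "card K = Suc r"
      and a: "\<forall>i\<in>I. \<forall>k\<in>K. a i k \<in> unit_fractions H"
    have "\<forall>i\<in>I. \<forall>k\<in>K. \<exists>b\<in>nonzero_ints H. a i k = 1 / of_int b"
      using a by (auto simp: unit_fractions_eq)
    then obtain b where b: "\<And>i k. i \<in> I \<Longrightarrow> k \<in> K \<Longrightarrow> b i k \<in> nonzero_ints H \<and> a i k = 1 / of_int (b i k)"
      by metis
    define M where "M = \<lfloor>H\<rfloor> ^ r"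
    have M: "M \<ge> 1" using H by (simp add: M_def)
    have MH: "real_of_int M \<le> H ^ r" using H by (simp add: M_def power_mono)
    define a' where "a' = (\<lambda>i k. \<Prod>k'\<in>K - {k}. b i k')"
    have "\<bar>a' i k\<bar> \<le> M" if "i \<in> I" "k \<in> K" for i k
    proof -
      have "\<bar>a' i k\<bar> = (\<Prod>k'\<in>K - {k}. \<bar>b i k'\<bar>)" by (simp add: a'_def abs_prod)
      also have "\<dots> \<le> (\<Prod>k'\<in>K - {k}. \<lfloor>H\<rfloor>)"
        using b[OF that(1)] by (intro prod_mono) (auto simp: nonzero_ints_def le_floor_iff)
      also have "\<dots> = M" using c fin that by (simp add: M_def)
      finally show ?thesis .
    qed
    then have "\<exists>d. (\<exists>k\<in>K. d k \<noteq> 0) \<and> (\<forall>k\<in>K. \<bar>d k\<bar> \<le> C * M ^ B) \<and>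
        (\<forall>i\<in>I. (\<Sum>k\<in>K. a' i k * d k) = 0)"
      by (intro ker[OF M fin c])
    then obtain d where d: "\<exists>k\<in>K. d k \<noteq> 0" "\<forall>k\<in>K. \<bar>d k\<bar> \<le> C * M ^ B"
        "\<forall>i\<in>I. (\<Sum>k\<in>K. a' i k * d k) = 0"
      by blast
    show "\<exists>d. (\<exists>k\<in>K. d k \<noteq> 0) \<and> (\<forall>k\<in>K. real_of_int \<bar>d k\<bar> \<le> C * H ^ (r * B)) \<and>
       (\<forall>i\<in>I. (\<Sum>k\<in>K. of_int (d k) * a i k) = 0)"
    proof (intro exI[of _ d] conjI ballI d(1))
      fix k assume "k \<in> K"
      then have "real_of_int \<bar>d k\<bar> \<le> real_of_int (C * M ^ B)" using d(2) by (simp only: of_int_le_iff)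
      also have "\<dots> = real_of_int C * real_of_int M ^ B" by simp
      also have "\<dots> \<le> real_of_int C * (H ^ r) ^ B"
        using MH M C by (intro mult_left_mono power_mono) auto
      finally show "real_of_int \<bar>d k\<bar> \<le> C * H ^ (r * B)" by (simp add: power_mult)
    next
      fix i assume i: "i \<in> I"
      let ?P = "\<Prod>k\<in>K. of_int (b i k) :: rat"
      have "?P * (\<Sum>k\<in>K. of_int (d k) * a i k) = (\<Sum>k\<in>K. of_int (a' i k * d k))"
        unfolding sum_distrib_left
      proof (intro sum.cong refl)
        fix k assume k: "k \<in> K"
        have "b i k \<noteq> 0" using b[OF i k] by (simp add: nonzero_ints_def)
        then show "?P * (of_int (d k) * a i k) = of_int (a' i k * d k)"
          using b[OF i k] prod.remove[OF fin(2) k, of "\<lambda>k. of_int (b i k) :: rat"]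
          by (simp add: a'_def)
      qed
      also have "\<dots> = 0" using d(3) i by (metis of_int_0 of_int_sum)
      finally have "?P * (\<Sum>k\<in>K. of_int (d k) * a i k) = 0" .
      moreover have "?P \<noteq> 0" using b[OF i] fin by (auto simp: nonzero_ints_def)
      ultimately show "(\<Sum>k\<in>K. of_int (d k) * a i k) = 0" by simp
    qed
  qed
qed

section \<open>Independence of rows and columns, nonsingular minors, and rank\<close>

text \<open>Matrices are functions of two indices, so a submatrix is a pair of index sets and the
  transpose is \<open>\<lambda>j i. a i j\<close>. Independence of columns is
  \<open>indep_rows\<close> of the transpose.\<close>

definition indep_rows :: "(nat \<Rightarrow> nat \<Rightarrow> rat) \<Rightarrow> nat set \<Rightarrow> nat set \<Rightarrow> bool" where
  "indep_rows a I J \<longleftrightarrow> (\<forall>c. (\<forall>j\<in>J. (\<Sum>i\<in>I. c i * a i j) = 0) \<longrightarrow> (\<forall>i\<in>I. c i = 0))"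

definition units_on :: "real \<Rightarrow> (nat \<Rightarrow> nat \<Rightarrow> rat) \<Rightarrow> nat set \<Rightarrow> nat set \<Rightarrow> bool" where
  "units_on H a I J \<longleftrightarrow> (\<forall>i\<in>I. \<forall>j\<in>J. a i j \<in> unit_fractions H)"

lemma indep_rowsD:
  "indep_rows a I J \<Longrightarrow> (\<And>j. j \<in> J \<Longrightarrow> (\<Sum>i\<in>I. c i * a i j) = 0) \<Longrightarrow> i \<in> I \<Longrightarrow> c i = 0"
  unfolding indep_rows_def by blast

lemma indep_rows_cong:
  "(\<And>i j. i \<in> I \<Longrightarrow> j \<in> J \<Longrightarrow> a i j = b i j) \<Longrightarrow> indep_rows a I J \<longleftrightarrow> indep_rows b I J"
  unfolding indep_rows_def by simp

lemma indep_rows_unique: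
  assumes "indep_rows a I J" "\<And>j. j \<in> J \<Longrightarrow> (\<Sum>i\<in>I. c i * a i j) = (\<Sum>i\<in>I. c' i * a i j)" "i \<in> I"
  shows "c i = c' i"
proof -
  have "(\<Sum>i\<in>I. (c i - c' i) * a i j) = 0" if "j \<in> J" for j
    using assms(2)[OF that] by (simp add: left_diff_distrib sum_subtractf)
  from indep_rowsD[OF assms(1) this assms(3)] show ?thesis by simp
qed

lemma indep_rows_subset:
  assumes "indep_rows a I J" "S \<subseteq> I" "finite I"
  shows "indep_rows a S J"
  unfolding indep_rows_def
proof (intro allI impI ballI)
  fix c i assume c: "\<forall>j\<in>J. (\<Sum>i\<in>S. c i * a i j) = 0" and i: "i \<in> S"
  have "(\<Sum>i\<in>I. (if i \<in> S then c i else 0) * a i j) = (\<Sum>i\<in>S. c i * a i j)" for j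
    using assms by (intro sum.mono_neutral_cong_right) auto
  then have "(if i \<in> S then c i else 0) = 0"
    using c i assms by (intro indep_rowsD[OF assms(1), of "\<lambda>i. if i \<in> S then c i else 0"]) auto
  then show "c i = 0" using i by simp
qed

text \<open>Otherwise some \<open>card J + 1\<close> rows satisfy a nontrivial relation on
  \<open>J\<close>, by \<open>unit_fraction_kernel_vector\<close> with the columns as equations and
  the rows as unknowns.\<close>

lemma indep_rows_card_le:
  assumes "indep_rows a I J" "finite I" "finite J" "units_on H a I J" "H \<ge> 1"
  shows "card I \<le> card J"
proof (rule ccontr)
  assume "\<not> card I \<le> card J"
  then obtain K where K: "K \<subseteq> I" "card K = Suc (card J)" by (meson not_less_eq_eq obtain_subset_with_card_n)
  then have "finite K" using assms(2) finite_subset by blast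
  moreover have "\<forall>j\<in>J. \<forall>k\<in>K. a k j \<in> unit_fractions H" using assms(4) K by (auto simp: units_on_def)
  ultimately have "\<exists>d :: nat \<Rightarrow> int. (\<exists>k\<in>K. d k \<noteq> 0) \<and> (\<forall>j\<in>J. (\<Sum>k\<in>K. of_int (d k) * a k j) = 0)"
    using unit_fraction_kernel_vector[of "card J"] assms K
    by (elim exE) (drule spec[of _ H], drule mp, simp, drule spec[of _ J], drule spec[of _ K],
      drule spec[of _ "\<lambda>j k. a k j"], blast)
  then obtain d :: "nat \<Rightarrow> int" where "\<exists>k\<in>K. d k \<noteq> 0" "\<forall>j\<in>J. (\<Sum>k\<in>K. of_int (d k) * a k j) = 0"
    by blast
  moreover have "indep_rows a K J" by (rule indep_rows_subset[OF assms(1) K(1) assms(2)])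
  moreover have "(of_int (d k) :: rat) = 0" if "k \<in> K" for k
    using calculation that by (intro indep_rowsD[of a K J "\<lambda>k. of_int (d k)"]) auto
  ultimately show False by auto
qed

text \<open>A smallest column set on which the rows remain independent has independent columns,
  since a column that depends on the others could be dropped. The comparison of cardinalities, for
  the minor and its transpose, then shows that it is square.\<close>

lemma minor_exists:
  assumes "indep_rows a I J" "finite I" "finite J" "units_on H a I J" "H \<ge> 1"
  obtains J' where "J' \<subseteq> J" "card J' = card I" "indep_rows a I J'" "indep_rows (\<lambda>j i. a i j) J' I"
proof -
  let ?P = "\<lambda>J'. J' \<subseteq> J \<and> indep_rows a I J'"
  obtain J' where J': "?P J'" and min: "\<And>J''. ?P J'' \<Longrightarrow> card J' \<le> card J''"
    using ex_has_least_nat[of ?P J card] assms(1) by blast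
  have finJ': "finite J'" using J' assms(3) finite_subset by blast
  have cols: "indep_rows (\<lambda>j i. a i j) J' I"
    unfolding indep_rows_def
  proof (intro allI impI ballI, rule ccontr)
    fix c j0 assume c: "\<forall>i\<in>I. (\<Sum>j\<in>J'. c j * a i j) = 0" and j0: "j0 \<in> J'" "c j0 \<noteq> 0"
    have "indep_rows a I (J' - {j0})"
      unfolding indep_rows_def
    proof (intro allI impI)
      fix e assume e: "\<forall>j\<in>J' - {j0}. (\<Sum>i\<in>I. e i * a i j) = 0"
      have "0 = (\<Sum>i\<in>I. e i * (\<Sum>j\<in>J'. c j * a i j))" using c by simp
      also have "\<dots> = (\<Sum>j\<in>J'. c j * (\<Sum>i\<in>I. e i * a i j))"
        unfolding sum_distrib_left by (subst sum.swap) (simp add: mult_ac)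
      also have "\<dots> = c j0 * (\<Sum>i\<in>I. e i * a i j0)"
        by (subst sum.remove[OF finJ' j0(1)]) (use e in simp)
      finally have "(\<Sum>i\<in>I. e i * a i j0) = 0" using j0 by simp
      then have "\<forall>j\<in>J'. (\<Sum>i\<in>I. e i * a i j) = 0" using e by blast
      then show "\<forall>i\<in>I. e i = 0" using J' unfolding indep_rows_def by blast
    qed
    then have "card J' \<le> card (J' - {j0})" using J' by (intro min) auto
    then show False using j0 finJ' by (metis card_Diff1_less not_le)
  qed
  have "card I \<le> card J'"
    using J' assms finJ' by (intro indep_rows_card_le[of a I J' H]) (auto simp: units_on_def)
  moreover have "card J' \<le> card I"
    using J' assms finJ' cols by (intro indep_rows_card_le[of "\<lambda>j i. a i j" J' I H]) (auto simp: units_on_def)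
  ultimately show ?thesis using that J' cols by auto
qed

text \<open>The coefficients $c$ are unique, so after scaling they form the bounded integer vector $d$
  provided by \<open>unit_fraction_kernel_vector\<close>.\<close>

lemma integer_relation:
  "\<exists>C B. \<forall>H\<ge>1. \<forall>S J i0 a. finite S \<longrightarrow> finite J \<longrightarrow> card S = h \<longrightarrow> i0 \<notin> S \<longrightarrow> indep_rows a S J \<longrightarrow>
     units_on H a (insert i0 S) J \<longrightarrow>
     (\<exists>c. (\<forall>s\<in>S. c s \<noteq> 0) \<and> (\<forall>j\<in>J. a i0 j = (\<Sum>s\<in>S. c s * a s j))) \<longrightarrow>
     (\<exists>d. (\<forall>s\<in>insert i0 S. d s \<noteq> 0 \<and> real_of_int \<bar>d s\<bar> \<le> C * H ^ B) \<and>
       (\<forall>c x. (\<forall>j\<in>J. a i0 j = (\<Sum>s\<in>S. c s * a s j)) \<longrightarrow> x i0 = (\<Sum>s\<in>S. c s * x s) \<longrightarrow>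
         (\<Sum>s\<in>insert i0 S. of_int (d s) * x s) = 0))"
proof -
  obtain C B where ker0: "\<forall>H\<ge>1. \<forall>(I :: nat set) (K :: nat set) (a :: nat \<Rightarrow> nat \<Rightarrow> rat).
     finite I \<longrightarrow> finite K \<longrightarrow> card I = h \<longrightarrow> card K = Suc h \<longrightarrow> (\<forall>i\<in>I. \<forall>k\<in>K. a i k \<in> unit_fractions H) \<longrightarrow>
     (\<exists>d. (\<exists>k\<in>K. d k \<noteq> 0) \<and> (\<forall>k\<in>K. real_of_int \<bar>d k\<bar> \<le> C * H ^ B) \<and>
       (\<forall>i\<in>I. (\<Sum>k\<in>K. of_int (d k) * a i k) = 0))"
    using unit_fraction_kernel_vector[of h] by (elim exE) (rule that)
  note ker = ker0[rule_format]
  show ?thesis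
  proof (rule exI[of _ C], rule exI[of _ B], intro allI impI)
    fix H :: real and S J i0 and a :: "nat \<Rightarrow> nat \<Rightarrow> rat"
    assume H: "1 \<le> H" and fin: "finite S" "finite J" and h: "card S = h" and i0: "i0 \<notin> S"
      and ind: "indep_rows a S J" and u: "units_on H a (insert i0 S) J"
      and ex: "\<exists>c. (\<forall>s\<in>S. c s \<noteq> 0) \<and> (\<forall>j\<in>J. a i0 j = (\<Sum>s\<in>S. c s * a s j))"
    obtain c where c: "\<And>s. s \<in> S \<Longrightarrow> c s \<noteq> 0" "\<And>j. j \<in> J \<Longrightarrow> a i0 j = (\<Sum>s\<in>S. c s * a s j)"
      using ex by blast
    have "units_on H a S J" using u by (auto simp: units_on_def)
    \<comment> \<open>Passing to a square minor leaves exactly \<open>h\<close> equations for the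
      \<open>h + 1\<close> unknowns.\<close>
    then obtain J' where J': "J' \<subseteq> J" "card J' = card S" "indep_rows a S J'"
      using minor_exists[OF ind fin _ H] by blast
    have "finite J'" using J' fin finite_subset by blast
    then have "\<exists>d. (\<exists>k\<in>insert i0 S. d k \<noteq> 0) \<and>
        (\<forall>k\<in>insert i0 S. real_of_int \<bar>d k\<bar> \<le> C * H ^ B) \<and>
        (\<forall>j\<in>J'. (\<Sum>k\<in>insert i0 S. of_int (d k) * a k j) = 0)"
      using fin h i0 J' u by (intro ker[OF H, where a = "\<lambda>j k. a k j"]) (auto simp: units_on_def subset_iff)
    then obtain d :: "nat \<Rightarrow> int" where d: "\<exists>k\<in>insert i0 S. d k \<noteq> 0"
        "\<forall>k\<in>insert i0 S. real_of_int \<bar>d k\<bar> \<le> C * H ^ B"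
        "\<forall>j\<in>J'. (\<Sum>k\<in>insert i0 S. of_int (d k) * a k j) = 0"
      by blast
    \<comment> \<open>Independence on \<open>J'\<close> forces the kernel vector to be a multiple of
      the relation given by \<open>c\<close>. As not all of \<open>d\<close> vanishes,
      \<open>d i0\<close> is nonzero, and then so is every \<open>d s\<close>.\<close>
    have ds: "of_int (d s) = - of_int (d i0) * c s" if "s \<in> S" for s
    proof (rule indep_rows_unique[OF J'(3) _ that, of "\<lambda>s. of_int (d s)" "\<lambda>s. - of_int (d i0) * c s"])
      fix j assume j: "j \<in> J'"
      have "(\<Sum>s\<in>S. of_int (d s) * a s j) = - (of_int (d i0) * a i0 j)"
        using d(3) j fin i0 by (simp add: eq_neg_iff_add_eq_0 add.commute)
      also have "\<dots> = (\<Sum>s\<in>S. - of_int (d i0) * c s * a s j)"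
        using c(2)[of j] j J' by (auto simp: sum_distrib_left sum_negf mult_ac)
      finally show "(\<Sum>s\<in>S. of_int (d s) * a s j) = (\<Sum>s\<in>S. - of_int (d i0) * c s * a s j)" .
    qed
    have d0: "d i0 \<noteq> 0" using d(1) ds by auto
    show "\<exists>d. (\<forall>s\<in>insert i0 S. d s \<noteq> 0 \<and> real_of_int \<bar>d s\<bar> \<le> C * H ^ B) \<and>
       (\<forall>c x. (\<forall>j\<in>J. a i0 j = (\<Sum>s\<in>S. c s * a s j)) \<longrightarrow> x i0 = (\<Sum>s\<in>S. c s * x s) \<longrightarrow>
         (\<Sum>s\<in>insert i0 S. of_int (d s) * x s) = 0)"
    proof (intro exI[of _ d] conjI allI impI)
      show "\<forall>s\<in>insert i0 S. d s \<noteq> 0 \<and> real_of_int \<bar>d s\<bar> \<le> C * H ^ B"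
      proof
        fix s assume s: "s \<in> insert i0 S"
        have "d s \<noteq> 0"
        proof (cases "s = i0")
          case False
          then have "(of_int (d s) :: rat) \<noteq> 0" using ds[of s] d0 c(1)[of s] s by simp
          then show ?thesis by simp
        qed (use d0 in simp)
        then show "d s \<noteq> 0 \<and> real_of_int \<bar>d s\<bar> \<le> C * H ^ B" using d(2) s by blast
      qed
    next
      fix c' and x :: "nat \<Rightarrow> rat"
      assume c': "\<forall>j\<in>J. a i0 j = (\<Sum>s\<in>S. c' s * a s j)" and x: "x i0 = (\<Sum>s\<in>S. c' s * x s)"
      have "c s = c' s" if "s \<in> S" for s
        using c(2) c' by (intro indep_rows_unique[OF ind _ that, of c c']) auto
      then have "x i0 = (\<Sum>s\<in>S. c s * x s)" unfolding x by (intro sum.cong) auto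
      then have "of_int (d i0) * x i0 = (\<Sum>s\<in>S. - (of_int (d s) * x s))"
        by (simp add: sum_distrib_left ds sum_negf mult_ac)
      then show "(\<Sum>s\<in>insert i0 S. of_int (d s) * x s) = 0" using fin i0 by (simp add: sum_negf)
    qed
  qed
qed

section \<open>Columns and rows that extend known entries\<close>

lemma restrict_eqD: "restrict f A = restrict g A \<Longrightarrow> s \<in> A \<Longrightarrow> f s = g s"
  by (metis restrict_apply')

text \<open>The vectors that can stand next to the known columns \<open>J\<close> of a matrix \<open>a\<close> with rows \<open>R\<close> in which
  each row is a combination of the rows \<open>I\<close> and row \<open>i0\<close> is one of the rows \<open>S\<close>.\<close>

definition column_extensions ::
  "real \<Rightarrow> nat set \<Rightarrow> nat set \<Rightarrow> nat set \<Rightarrow> nat set \<Rightarrow> nat \<Rightarrow> (nat \<Rightarrow> nat \<Rightarrow> rat) \<Rightarrow> (nat \<Rightarrow> rat) set" where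
  "column_extensions H R I J S i0 a = {x \<in> R \<rightarrow>\<^sub>E unit_fractions H.
     (\<forall>i\<in>R. \<exists>c. (\<forall>j\<in>J. a i j = (\<Sum>s\<in>I. c s * a s j)) \<and> x i = (\<Sum>s\<in>I. c s * x s)) \<and>
     (\<exists>c. (\<forall>j\<in>J. a i0 j = (\<Sum>s\<in>S. c s * a s j)) \<and> x i0 = (\<Sum>s\<in>S. c s * x s))}"

lemma finite_column_extensions: "finite R \<Longrightarrow> finite (column_extensions H R I J S i0 a)"
  unfolding column_extensions_def by (simp add: finite_PiE finite_unit_fractions)

text \<open>The rows \<open>I\<close> are independent on \<open>J\<close>, so the coefficients of
  each row are known and the entries in \<open>I\<close> determine the vector. Those in
  \<open>I - S\<close> are free, which gives \<open>r - h\<close>; those in \<open>S\<close>,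
  together with the entry in row \<open>i0\<close>, solve the integer equation with
  \<open>h + 1\<close> terms, which gives \<open>t\<close>.\<close>

lemma card_column_extensions:
  assumes t: "eqn_bound (Suc h) t"
  shows "\<exists>K. \<forall>H\<ge>1. \<forall>R I J S i0 a. finite R \<longrightarrow> I \<subseteq> R \<longrightarrow> S \<subseteq> I \<longrightarrow> i0 \<in> R - I \<longrightarrow> finite J \<longrightarrow>
     card S = h \<longrightarrow> card I = r \<longrightarrow> indep_rows a I J \<longrightarrow> units_on H a R J \<longrightarrow>
     (\<exists>c. (\<forall>s\<in>S. c s \<noteq> 0) \<and> (\<forall>j\<in>J. a i0 j = (\<Sum>s\<in>S. c s * a s j))) \<longrightarrow>
     real (card (column_extensions H R I J S i0 a)) \<le> K * H powr (real (r - h) + t)"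
proof -
  obtain C B where rel: "\<forall>H\<ge>1. \<forall>S J i0 a. finite S \<longrightarrow> finite J \<longrightarrow> card S = h \<longrightarrow> i0 \<notin> S \<longrightarrow> indep_rows a S J \<longrightarrow>
     units_on H a (insert i0 S) J \<longrightarrow>
     (\<exists>c. (\<forall>s\<in>S. c s \<noteq> 0) \<and> (\<forall>j\<in>J. a i0 j = (\<Sum>s\<in>S. c s * a s j))) \<longrightarrow>
     (\<exists>d. (\<forall>s\<in>insert i0 S. d s \<noteq> 0 \<and> real_of_int \<bar>d s\<bar> \<le> C * H ^ B) \<and>
       (\<forall>c x. (\<forall>j\<in>J. a i0 j = (\<Sum>s\<in>S. c s * a s j)) \<longrightarrow> x i0 = (\<Sum>s\<in>S. c s * x s) \<longrightarrow>
         (\<Sum>s\<in>insert i0 S. of_int (d s) * x s) = 0))"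
    using integer_relation[of h] by (elim exE) (rule that)
  obtain K where K0: "\<forall>H\<ge>1. \<forall>S d. finite S \<longrightarrow> card S = Suc h \<longrightarrow>
     (\<forall>s\<in>S. d s \<noteq> 0 \<and> real_of_int \<bar>d s\<bar> \<le> C * H ^ B) \<longrightarrow>
     real (card (solutions H S d)) \<le> K * H powr t"
    using t[unfolded eqn_bound_def, rule_format, of C B] by (elim exE) (rule that)
  note K = K0[rule_format]
  show ?thesis
  proof (rule exI[of _ "2 ^ (r - h) * K"], intro allI impI)
    fix H :: real and R I J S i0 and a :: "nat \<Rightarrow> nat \<Rightarrow> rat"
    assume H: "1 \<le> H" and R: "finite R" "I \<subseteq> R" "S \<subseteq> I" "i0 \<in> R - I" and J: "finite J"
      and h: "card S = h" and r: "card I = r" and ind: "indep_rows a I J" and u: "units_on H a R J"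
      and ex: "\<exists>c. (\<forall>s\<in>S. c s \<noteq> 0) \<and> (\<forall>j\<in>J. a i0 j = (\<Sum>s\<in>S. c s * a s j))"
    have fin: "finite I" "finite S"
      using R(1-3) by (auto intro: rev_finite_subset dest: rev_finite_subset)
    have indS: "indep_rows a S J" by (rule indep_rows_subset[OF ind R(3) fin(1)])
    have "i0 \<notin> S" "units_on H a (insert i0 S) J" using R u by (auto simp: units_on_def)
    then have "\<exists>d. (\<forall>s\<in>insert i0 S. d s \<noteq> 0 \<and> real_of_int \<bar>d s\<bar> \<le> C * H ^ B) \<and>
       (\<forall>c x. (\<forall>j\<in>J. a i0 j = (\<Sum>s\<in>S. c s * a s j)) \<longrightarrow> x i0 = (\<Sum>s\<in>S. c s * x s) \<longrightarrow>
         (\<Sum>s\<in>insert i0 S. of_int (d s) * x s) = 0)"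
      by (intro rel[rule_format, OF H fin(2) J h _ indS _ ex])
    then obtain d :: "nat \<Rightarrow> int" where d: "\<forall>s\<in>insert i0 S. d s \<noteq> 0 \<and> real_of_int \<bar>d s\<bar> \<le> C * H ^ B"
       "\<And>c x. (\<forall>j\<in>J. a i0 j = (\<Sum>s\<in>S. c s * a s j)) \<Longrightarrow> x i0 = (\<Sum>s\<in>S. c s * x s) \<Longrightarrow>
         (\<Sum>s\<in>insert i0 S. of_int (d s) * x s) = 0"
      by blast
    let ?X = "column_extensions H R I J S i0 a"
    let ?Y = "((I - S) \<rightarrow>\<^sub>E unit_fractions H) \<times> solutions H (insert i0 S) d"
    have "card ?X \<le> card ?Y"
    proof (rule card_inj_on_le)
      show "inj_on (\<lambda>x. (restrict x (I - S), restrict x (insert i0 S))) ?X"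
      proof (rule inj_onI)
        fix x y assume xy: "x \<in> ?X" "y \<in> ?X"
          and eq: "(restrict x (I - S), restrict x (insert i0 S)) = (restrict y (I - S), restrict y (insert i0 S))"
        have eqI: "x s = y s" if "s \<in> I" for s
          using eq that restrict_eqD[of x "I - S" y s] restrict_eqD[of x "insert i0 S" y s]
          by (cases "s \<in> S") auto
        show "x = y"
        proof (rule extensionalityI[of _ R])
          show "x \<in> extensional R" "y \<in> extensional R"
            using xy by (auto simp: column_extensions_def PiE_def)
          fix i assume i: "i \<in> R"
          obtain c where c: "\<forall>j\<in>J. a i j = (\<Sum>s\<in>I. c s * a s j)" "x i = (\<Sum>s\<in>I. c s * x s)"
            using xy(1) i unfolding column_extensions_def by blast
          obtain c' where c': "\<forall>j\<in>J. a i j = (\<Sum>s\<in>I. c' s * a s j)" "y i = (\<Sum>s\<in>I. c' s * y s)"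
            using xy(2) i unfolding column_extensions_def by blast
          have "c s = c' s" if "s \<in> I" for s
            using c(1) c'(1) by (intro indep_rows_unique[OF ind _ that, of c c']) auto
          then show "x i = y i" unfolding c(2) c'(2) using eqI by (intro sum.cong) auto
        qed
      qed
      show "(\<lambda>x. (restrict x (I - S), restrict x (insert i0 S))) ` ?X \<subseteq> ?Y"
      proof (rule image_subsetI, rule SigmaI)
        fix x assume x: "x \<in> ?X"
        then show "restrict x (I - S) \<in> (I - S) \<rightarrow>\<^sub>E unit_fractions H"
          using R by (auto simp: column_extensions_def)
        have "(\<Sum>s\<in>insert i0 S. of_int (d s) * x s) = 0"
          using x d(2) by (auto simp: column_extensions_def)
        then show "restrict x (insert i0 S) \<in> solutions H (insert i0 S) d"
          using x R by (auto simp: solutions_def column_extensions_def)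
      qed
      show "finite ?Y" using fin by (auto intro!: finite_PiE finite_unit_fractions finite_solutions)
    qed
    also have "\<dots> = card (unit_fractions H) ^ (r - h) * card (solutions H (insert i0 S) d)"
      using fin R h r by (simp add: card_PiE card_cartesian_product card_Diff_subset)
    finally have "real (card ?X) \<le> real (card (unit_fractions H)) ^ (r - h) * real (card (solutions H (insert i0 S) d))"
      by (metis of_nat_le_iff of_nat_mult of_nat_power)
    also have "\<dots> \<le> (2 * H) ^ (r - h) * (K * H powr t)"
    proof (intro mult_mono power_mono card_unit_fractions H)
      show "real (card (solutions H (insert i0 S) d)) \<le> K * H powr t"
        using d(1) fin h \<open>i0 \<notin> S\<close> by (intro K H) auto
    qed (use H in auto)
    also have "\<dots> = 2 ^ (r - h) * K * H powr (real (r - h) + t)"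
      using H by (simp add: powr_add powr_realpow power_mult_distrib)
    finally show "real (card ?X) \<le> 2 ^ (r - h) * K * H powr (real (r - h) + t)" .
  qed
qed

text \<open>The entries in the columns of a nonsingular minor determine the coefficients, and these
  determine the whole row.\<close>

lemma card_row_span:
  assumes "indep_rows a S J" "finite S" "finite J" "units_on H a S J" "H \<ge> 1"
  shows "card {y \<in> J \<rightarrow>\<^sub>E unit_fractions H. \<exists>c. \<forall>j\<in>J. y j = (\<Sum>s\<in>S. c s * a s j)}
    \<le> card (unit_fractions H) ^ card S" (is "card ?Y \<le> _")
proof -
  obtain J' where J': "J' \<subseteq> J" "card J' = card S" "indep_rows a S J'"
    using minor_exists[OF assms] by blast
  have finJ': "finite J'" using J' assms finite_subset by blast
  have "card ?Y \<le> card (J' \<rightarrow>\<^sub>E unit_fractions H)"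
  proof (rule card_inj_on_le)
    show "inj_on (\<lambda>y. restrict y J') ?Y"
    proof (rule inj_onI)
      fix x y assume xy: "x \<in> ?Y" "y \<in> ?Y" "restrict x J' = restrict y J'"
      obtain c c' where c: "\<forall>j\<in>J. x j = (\<Sum>s\<in>S. c s * a s j)" "\<forall>j\<in>J. y j = (\<Sum>s\<in>S. c' s * a s j)"
        using xy by blast
      have "x j = y j" if "j \<in> J'" for j using restrict_eqD[OF xy(3) that] .
      then have "c s = c' s" if "s \<in> S" for s
        using c J' by (intro indep_rows_unique[OF J'(3) _ that, of c c']) (metis subsetD)
      then have "x j = y j" if "j \<in> J" for j using c that by simp
      then show "x = y" using xy by (intro extensionalityI[of _ J]) (auto simp: PiE_def)
    qed
    show "(\<lambda>y. restrict y J') ` ?Y \<subseteq> J' \<rightarrow>\<^sub>E unit_fractions H" using J' by auto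
  qed (simp add: finJ' finite_PiE finite_unit_fractions)
  also have "\<dots> = card (unit_fractions H) ^ card S" using J' finJ' by (simp add: card_PiE)
  finally show ?thesis .
qed

text \<open>Passage from \<open>vec_space.rank\<close>, which is the size of a maximal independent
  set of column vectors, to a set of column indices.\<close>

lemma rank_columns:
  assumes A: "A \<in> carrier_mat m n" and r: "vec_space.rank m (A :: rat mat) = r"
  obtains J where "J \<subseteq> {..<n}" "card J = r" "indep_rows (\<lambda>j i. A $$ (i, j)) J {..<m}"
    "\<And>l. l < n \<Longrightarrow> \<exists>d. \<forall>i<m. A $$ (i, l) = (\<Sum>j\<in>J. d j * A $$ (i, j))"
proof -
  interpret vec_space "TYPE(rat)" m .
  let ?P = "\<lambda>T. T \<subseteq> set (cols A) \<and> lin_indpt T"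
  have carr: "set (cols A) \<subseteq> carrier_vec m" using cols_dim[of A] A by simp
  obtain S where S: "maximal S ?P"
    using maximal_exists_superset[of "set (cols A)" ?P "{}"] by (auto simp: lin_dep_def)
  have SA: "S \<subseteq> set (cols A)" and ind: "lin_indpt S" using S by (auto simp: maximal_def)
  have finS: "finite S" using SA finite_subset by blast
  have SC: "S \<subseteq> carrier_vec m" using SA carr by blast
  have "\<forall>v\<in>S. \<exists>j<n. col A j = v" using SA A by (fastforce simp: cols_def)
  \<comment> \<open>Equal columns are one element of \<open>S\<close>, so \<open>f\<close> picks one
    index for each column vector.\<close>
  then obtain f where f: "\<And>v. v \<in> S \<Longrightarrow> f v < n \<and> col A (f v) = v" by metis
  have inj: "inj_on f S" by (rule inj_onI) (metis f)
  have comp: "v $ i = A $$ (i, f v)" if "v \<in> S" "i < m" for v i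
    using f[OF that(1)] A that(2) by (metis carrier_matD index_col)
  show ?thesis
  proof (rule that[of "f ` S"])
    show "f ` S \<subseteq> {..<n}" using f by auto
    show "card (f ` S) = r" using rank_card_indpt[OF A S] r card_image[OF inj] by simp
    show "indep_rows (\<lambda>j i. A $$ (i, j)) (f ` S) {..<m}"
      unfolding indep_rows_def
    proof (intro allI impI ballI, rule ccontr)
      fix c j assume c: "\<forall>i\<in>{..<m}. (\<Sum>j\<in>f ` S. c j * A $$ (i, j)) = 0" and j: "j \<in> f ` S" "c j \<noteq> 0"
      obtain v where v: "v \<in> S" "j = f v" using j by auto
      have "lincomb (c \<circ> f) S = 0\<^sub>v m"
      proof (rule eq_vecI)
        fix i assume "i < dim_vec (0\<^sub>v m)"
        then have i: "i < m" by simp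
        have "lincomb (c \<circ> f) S $ i = (\<Sum>v\<in>S. c (f v) * A $$ (i, f v))"
          using comp i by (simp add: lincomb_index[OF i SC])
        also have "\<dots> = (\<Sum>j\<in>f ` S. c j * A $$ (i, j))" by (simp add: sum.reindex[OF inj])
        finally show "lincomb (c \<circ> f) S $ i = 0\<^sub>v m $ i" using c i by simp
      qed (use lincomb_dim[OF finS SC] in simp)
      then have "lin_dep S" using v j finS by (intro lin_dep_crit[where A = S and a = "c \<circ> f" and v = v]) auto
      then show False using ind by simp
    qed
    fix l assume l: "l < n"
    show "\<exists>d. \<forall>i<m. A $$ (i, l) = (\<Sum>j\<in>f ` S. d j * A $$ (i, j))"
    proof (cases "col A l \<in> S")
      case True
      \<comment> \<open>Here \<open>l\<close> may differ from the chosen index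
        \<open>f (col A l)\<close>, but the two columns are equal.\<close>
      have "A $$ (i, l) = (\<Sum>j\<in>f ` S. (if j = f (col A l) then 1 else 0) * A $$ (i, j))" if i: "i < m" for i
      proof -
        have "(\<Sum>j\<in>f ` S. (if j = f (col A l) then 1 else 0) * A $$ (i, j)) =
            (\<Sum>j\<in>f ` S. if f (col A l) = j then A $$ (i, j) else 0)"
          by (intro sum.cong) auto
        also have "\<dots> = A $$ (i, f (col A l))" using True finS by (subst sum.delta') auto
        also have "\<dots> = col A l $ i" using comp[OF True i] by simp
        finally show ?thesis using A l i by simp
      qed
      then show ?thesis by (intro exI[of _ "\<lambda>j. if j = f (col A l) then 1 else 0"]) blast
    next
      case False
      let ?v = "col A l"
      have vA: "?v \<in> set (cols A)" using l A by (auto simp: cols_def)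
      have vC: "insert ?v S \<subseteq> carrier_vec m" using SC A carr vA by auto
      have "lin_dep (insert ?v S)"
      proof (rule ccontr)
        assume "\<not> lin_dep (insert ?v S)"
        then have "insert ?v S = S" using S vA SA unfolding maximal_def by blast
        then show False using False by blast
      qed
      then obtain a w where a: "lincomb a (insert ?v S) = 0\<^sub>v m" "w \<in> insert ?v S" "a w \<noteq> 0"
        using finite_lin_dep[of "insert ?v S"] finS vC by auto
      have eq: "a ?v * A $$ (i, l) + (\<Sum>s\<in>S. a s * A $$ (i, f s)) = 0" if i: "i < m" for i
      proof -
        have "0 = lincomb a (insert ?v S) $ i" using a(1) i by simp
        also have "\<dots> = (\<Sum>x\<in>insert ?v S. a x * x $ i)" by (rule lincomb_index[OF i vC])
        also have "\<dots> = a ?v * ?v $ i + (\<Sum>s\<in>S. a s * s $ i)" using False finS by simp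
        also have "\<dots> = a ?v * A $$ (i, l) + (\<Sum>s\<in>S. a s * A $$ (i, f s))"
          using comp[OF _ i] l A i by simp
        finally show ?thesis by simp
      qed
      have av: "a ?v \<noteq> 0"
      proof
        assume av: "a ?v = 0"
        then have w: "w \<in> S" using a by auto
        have "lincomb a S = 0\<^sub>v m"
        proof (rule eq_vecI)
          fix i assume "i < dim_vec (0\<^sub>v m)"
          then have i: "i < m" by simp
          show "lincomb a S $ i = 0\<^sub>v m $ i"
            using eq[OF i] av comp[OF _ i] i by (simp add: lincomb_index[OF i SC])
        qed (use lincomb_dim[OF finS SC] in simp)
        then have "lin_dep S" using w a finS by (intro lin_dep_crit[where A = S and a = a and v = w]) auto
        then show False using ind by simp
      qed
      have "A $$ (i, l) = (\<Sum>j\<in>f ` S. (- a (col A j) / a ?v) * A $$ (i, j))" if i: "i < m" for i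
      proof -
        have "(\<Sum>j\<in>f ` S. (- a (col A j) / a ?v) * A $$ (i, j)) = (\<Sum>s\<in>S. (- a s / a ?v) * A $$ (i, f s))"
          using f by (simp add: sum.reindex[OF inj])
        also have "\<dots> = - (\<Sum>s\<in>S. a s * A $$ (i, f s)) / a ?v"
          by (simp add: sum_divide_distrib sum_negf)
        also have "\<dots> = A $$ (i, l)" using eq[OF i] av by (simp add: field_simps)
        finally show ?thesis by simp
      qed
      then show ?thesis by (intro exI[of _ "\<lambda>j. - a (col A j) / a ?v"]) blast
    qed
  qed
qed

section \<open>Counting by successive restriction\<close>

text \<open>The number of ways in which the positions \<open>D\<close> are filled by members of
  \<open>X\<close>. A matrix is a function on positions, and the counts let \<open>D\<close> grow
  from a minor to the whole matrix.\<close>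

definition patterns :: "('p \<Rightarrow> 'v) set \<Rightarrow> 'p set \<Rightarrow> nat" where
  "patterns X D = card ((\<lambda>f. restrict f D) ` X)"

definition agreeing :: "('p \<Rightarrow> 'v) set \<Rightarrow> ('p \<Rightarrow> 'v) \<Rightarrow> 'p set \<Rightarrow> ('p \<Rightarrow> 'v) set" where
  "agreeing X f D = {g \<in> X. \<forall>p\<in>D. g p = f p}"

lemma patterns_mono: "finite X \<Longrightarrow> Y \<subseteq> X \<Longrightarrow> patterns Y D \<le> patterns X D"
  unfolding patterns_def by (intro card_mono) auto

lemma patterns_extensional: "X \<subseteq> extensional D \<Longrightarrow> patterns X D = card X"
proof -
  assume "X \<subseteq> extensional D"
  then have "(\<lambda>f. restrict f D) ` X = (\<lambda>f. f) ` X" by (intro image_cong) (auto simp: extensional_restrict)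
  then show ?thesis by (simp add: patterns_def)
qed

lemma patterns_le_card:
  assumes "finite Y" "\<And>f. f \<in> X \<Longrightarrow> \<phi> f \<in> Y"
    and det: "\<And>f g p. f \<in> X \<Longrightarrow> g \<in> X \<Longrightarrow> \<phi> f = \<phi> g \<Longrightarrow> p \<in> D \<Longrightarrow> f p = g p"
  shows "patterns X D \<le> card Y"
proof -
  \<comment> \<open>Decoding: any member with the given code will do, since the code determines the
    values on \<open>D\<close>.\<close>
  define \<psi> where "\<psi> = (\<lambda>y. restrict (SOME f. f \<in> X \<and> \<phi> f = y) D)"
  have "restrict f D = \<psi> (\<phi> f)" if f: "f \<in> X" for f
  proof -
    have "\<exists>g. g \<in> X \<and> \<phi> g = \<phi> f" using f by blast
    from someI_ex[OF this] show ?thesis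
      unfolding \<psi>_def using det f by (intro restrict_ext) metis
  qed
  then have "(\<lambda>f. restrict f D) ` X \<subseteq> \<psi> ` Y" using assms(2) by auto
  then show ?thesis unfolding patterns_def
    using assms(1) by (meson card_image_le card_mono finite_imageI le_trans)
qed

lemma patterns_free:
  assumes "finite D" "finite E" "\<And>f p. f \<in> X \<Longrightarrow> p \<in> D \<Longrightarrow> f p \<in> E"
  shows "patterns X D \<le> card E ^ card D"
proof -
  have "patterns X D \<le> card (D \<rightarrow>\<^sub>E E)"
    using assms by (intro patterns_le_card[where \<phi> = "\<lambda>f. restrict f D"]) (auto simp: finite_PiE dest: restrict_eqD)
  then show ?thesis using assms by (simp add: card_PiE)
qed

text \<open>Sums the sizes of the fibers over the fillings of \<open>D\<close>; the bound
  \<open>k\<close> has to hold for every filling of \<open>D\<close>.\<close>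

lemma patterns_step:
  assumes X: "finite X"
    and k: "\<And>f. f \<in> X \<Longrightarrow> real (patterns (agreeing X f D) D') \<le> k"
  shows "real (patterns X (D \<union> D')) \<le> real (patterns X D) * k"
proof -
  let ?U = "(\<lambda>f. restrict f D) ` X"
  let ?A = "\<lambda>u. (\<lambda>g. restrict g (D \<union> D')) ` {g \<in> X. restrict g D = u}"
  have le: "real (card (?A u)) \<le> k" if u: "u \<in> ?U" for u
  proof -
    obtain f where f: "f \<in> X" "u = restrict f D" using u by blast
    have "card (?A u) \<le> patterns (agreeing X f D) D'"
      unfolding patterns_def
    proof (rule card_inj_on_le)
      show "inj_on (\<lambda>h. restrict h D') (?A u)"
      proof (rule inj_onI)
        fix h h' assume "h \<in> ?A u" "h' \<in> ?A u" and eq: "restrict h D' = restrict h' D'"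
        then obtain g g' where g: "h = restrict g (D \<union> D')" "h' = restrict g' (D \<union> D')"
          "restrict g D = restrict g' D" by auto
        show "h = h'" unfolding g(1,2)
        proof (rule restrict_ext)
          fix p assume "p \<in> D \<union> D'"
          then show "g p = g' p"
            using restrict_eqD[OF g(3)] restrict_eqD[OF eq] g(1,2) by (metis UnE restrict_apply' UnCI)
        qed
      qed
      show "(\<lambda>h. restrict h D') ` ?A u \<subseteq> (\<lambda>f. restrict f D') ` agreeing X f D"
      proof (rule image_subsetI)
        fix h assume "h \<in> ?A u"
        then obtain g where g: "h = restrict g (D \<union> D')" "g \<in> X" "restrict g D = restrict f D"
          using f(2) by auto
        have "g \<in> agreeing X f D" using g(2) restrict_eqD[OF g(3)] by (simp add: agreeing_def)
        moreover have "restrict h D' = restrict g D'" unfolding g(1) by (auto simp: Int_absorb1)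
        ultimately show "restrict h D' \<in> (\<lambda>f. restrict f D') ` agreeing X f D" by simp
      qed
      show "finite ((\<lambda>f. restrict f D') ` agreeing X f D)" using X by (simp add: agreeing_def)
    qed
    then show ?thesis using k[OF f(1)] by linarith
  qed
  have "(\<lambda>g. restrict g (D \<union> D')) ` X \<subseteq> (\<Union>u\<in>?U. ?A u)" by auto
  then have "patterns X (D \<union> D') \<le> card (\<Union>u\<in>?U. ?A u)"
    unfolding patterns_def using X by (intro card_mono) auto
  also have "\<dots> \<le> (\<Sum>u\<in>?U. card (?A u))" by (intro card_UN_le finite_imageI X)
  finally have "real (patterns X (D \<union> D')) \<le> (\<Sum>u\<in>?U. real (card (?A u)))"
    by (simp only: of_nat_le_iff flip: of_nat_sum)
  also have "\<dots> \<le> (\<Sum>u\<in>?U. k)" by (intro sum_mono le)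
  finally show ?thesis by (simp add: patterns_def)
qed

text \<open>Each block \<open>D' l\<close> is bounded given \<open>D\<close> alone. When earlier
  blocks are fixed as well, its fiber can only shrink, so the factors multiply.\<close>

lemma patterns_family:
  assumes X: "finite X" and L: "finite L" and k0: "k \<ge> 0"
    and k: "\<And>l f. l \<in> L \<Longrightarrow> f \<in> X \<Longrightarrow> real (patterns (agreeing X f D) (D' l)) \<le> k"
  shows "real (patterns X (D \<union> (\<Union>l\<in>L. D' l))) \<le> real (patterns X D) * k ^ card L"
  using L k
proof (induction L rule: finite_induct)
  case empty
  then show ?case by simp
next
  case (insert l L)
  have "D \<union> (\<Union>l\<in>insert l L. D' l) = (D \<union> (\<Union>l\<in>L. D' l)) \<union> D' l" by auto
  then have "real (patterns X (D \<union> (\<Union>l\<in>insert l L. D' l))) \<le> real (patterns X (D \<union> (\<Union>l\<in>L. D' l))) * k"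
  proof (simp only:, intro patterns_step X)
    fix f assume f: "f \<in> X"
    have "patterns (agreeing X f (D \<union> (\<Union>l\<in>L. D' l))) (D' l) \<le> patterns (agreeing X f D) (D' l)"
      using X by (intro patterns_mono) (auto simp: agreeing_def)
    then show "real (patterns (agreeing X f (D \<union> (\<Union>l\<in>L. D' l))) (D' l)) \<le> k"
      using insert.prems[of l f] f by simp
  qed
  also have "\<dots> \<le> (real (patterns X D) * k ^ card L) * k"
    using insert k0 by (intro mult_right_mono) auto
  finally show ?case using insert.hyps by (simp add: mult_ac)
qed

section \<open>Bookkeeping for powers of \<open>H\<close>\<close>

text \<open>Holding for all \<open>H \<ge> 1\<close>, with an explicit constant, such bounds can be
  added over finite unions. The asymptotic forms of the theorem are derived only at the end.\<close>

definition pow_bound :: "(real \<Rightarrow> real) \<Rightarrow> real \<Rightarrow> bool" where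
  "pow_bound F c \<longleftrightarrow> (\<exists>K. \<forall>H\<ge>1. F H \<le> K * H powr c)"

lemma pow_boundI: "(\<And>H. H \<ge> 1 \<Longrightarrow> F H \<le> K * H powr c) \<Longrightarrow> pow_bound F c"
  unfolding pow_bound_def by blast

lemma pow_bound_mono:
  assumes "pow_bound F c" "\<And>H. H \<ge> 1 \<Longrightarrow> G H \<le> F H" "c \<le> c'"
  shows "pow_bound G c'"
proof -
  obtain K where K: "\<And>H. H \<ge> 1 \<Longrightarrow> F H \<le> K * H powr c" using assms(1) by (auto simp: pow_bound_def)
  show ?thesis
  proof (rule pow_boundI)
    fix H :: real assume H: "H \<ge> 1"
    have "G H \<le> K * H powr c" using assms(2)[OF H] K[OF H] by linarith
    also have "\<dots> \<le> \<bar>K\<bar> * H powr c" using H by (intro mult_right_mono) auto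
    also have "\<dots> \<le> \<bar>K\<bar> * H powr c'" using H assms(3) by (intro mult_left_mono powr_mono) auto
    finally show "G H \<le> \<bar>K\<bar> * H powr c'" .
  qed
qed

lemma pow_bound_sum:
  assumes "\<And>p. p \<in> P \<Longrightarrow> pow_bound (F p) c"
  shows "pow_bound (\<lambda>H. \<Sum>p\<in>P. F p H) c"
proof -
  obtain K where K: "\<And>p H. p \<in> P \<Longrightarrow> H \<ge> 1 \<Longrightarrow> F p H \<le> K p * H powr c"
    using assms unfolding pow_bound_def by metis
  show ?thesis
    by (rule pow_boundI[where K = "\<Sum>p\<in>P. K p"]) (auto simp: sum_distrib_right intro!: sum_mono K)
qed

lemma pow_bound_UN:
  assumes "finite P" "\<And>p. p \<in> P \<Longrightarrow> pow_bound (\<lambda>H. real (card (X p H))) c"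
    "\<And>p H. p \<in> P \<Longrightarrow> finite (X p H)" "\<And>H. H \<ge> 1 \<Longrightarrow> F H \<subseteq> (\<Union>p\<in>P. X p H)"
  shows "pow_bound (\<lambda>H. real (card (F H))) c"
proof (rule pow_bound_mono[OF pow_bound_sum[OF assms(2)]])
  fix H :: real assume H: "H \<ge> 1"
  have "card (F H) \<le> card (\<Union>p\<in>P. X p H)" using assms H by (intro card_mono) auto
  also have "\<dots> \<le> (\<Sum>p\<in>P. card (X p H))" by (rule card_UN_le[OF assms(1)])
  finally show "real (card (F H)) \<le> (\<Sum>p\<in>P. real (card (X p H)))" by (simp only: of_nat_le_iff flip: of_nat_sum)
qed auto

text \<open>The hypothesis is used at \<open>\<epsilon> / 2\<close>, and the other
  \<open>H powr (\<epsilon> / 2)\<close> eventually exceeds the constant.\<close>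

lemma pow_bound_imp_le_powr_o1:
  assumes "\<And>\<epsilon>. \<epsilon> > 0 \<Longrightarrow> pow_bound F (c + \<epsilon>)"
  shows "le_powr_o1 F c"
  unfolding le_powr_o1_def
proof (intro allI impI)
  fix \<epsilon> :: real assume \<epsilon>: "\<epsilon> > 0"
  obtain K where K: "\<And>H. H \<ge> 1 \<Longrightarrow> F H \<le> K * H powr (c + \<epsilon> / 2)"
    using assms[of "\<epsilon> / 2"] \<epsilon> by (auto simp: pow_bound_def)
  have "\<forall>\<^sub>F H in at_top. K \<le> H powr (\<epsilon> / 2)"
    using eventually_ge_at_top[of "max K 1 powr (2 / \<epsilon>)"]
  proof eventually_elim
    case (elim H)
    have "max K 1 = (max K 1 powr (2 / \<epsilon>)) powr (\<epsilon> / 2)" using \<epsilon> by (simp add: powr_powr)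
    also have "\<dots> \<le> H powr (\<epsilon> / 2)" using elim \<epsilon> by (intro powr_mono2) auto
    finally show ?case by simp
  qed
  then show "\<forall>\<^sub>F H in at_top. F H \<le> H powr (c + \<epsilon>)"
    using eventually_ge_at_top[of 1]
  proof eventually_elim
    case (elim H)
    have "F H \<le> K * H powr (c + \<epsilon> / 2)" using K elim by simp
    also have "\<dots> \<le> H powr (\<epsilon> / 2) * H powr (c + \<epsilon> / 2)" using elim by (intro mult_right_mono) auto
    also have "\<dots> = H powr (c + \<epsilon>)" by (simp add: add.commute flip: powr_add)
    finally show ?case .
  qed
qed

lemma le_powr_o1_imp_ll_powr_o1: "le_powr_o1 F c \<Longrightarrow> ll_powr_o1 F c"
  unfolding le_powr_o1_def ll_powr_o1_def by (intro exI[of _ 1]) auto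

lemma pow_bound_imp_bigo:
  assumes "pow_bound F c" "\<And>H. F H \<ge> 0"
  shows "F \<in> O[at_top](\<lambda>H. H powr c)"
proof -
  obtain K where K: "\<And>H. H \<ge> 1 \<Longrightarrow> F H \<le> K * H powr c" using assms(1) by (auto simp: pow_bound_def)
  show ?thesis
    by (rule bigoI[of _ K], rule eventually_mono[OF eventually_ge_at_top[of 1]]) (use assms(2) K in auto)
qed

section \<open>Matrices with a given nonsingular minor\<close>

lemma indep_rows_mono_cols: "indep_rows a I J \<Longrightarrow> J \<subseteq> C \<Longrightarrow> indep_rows a I C"
  unfolding indep_rows_def by blast

text \<open>Since no coefficient vanishes, \<open>S\<close> is the exact support, and the resulting
  equation has exactly \<open>card S + 1\<close> terms with nonzero coefficients.\<close>

definition row_comb :: "(nat \<Rightarrow> nat \<Rightarrow> rat) \<Rightarrow> nat set \<Rightarrow> nat set \<Rightarrow> nat \<Rightarrow> bool" where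
  "row_comb a C S i \<longleftrightarrow> (\<exists>c. (\<forall>s\<in>S. c s \<noteq> 0) \<and> (\<forall>l\<in>C. a i l = (\<Sum>s\<in>S. c s * a s l)))"

text \<open>The matrix has rank \<open>card I\<close> and its minor on \<open>I\<close> and
  \<open>J\<close> is nonsingular. Rows and columns enter symmetrically, so transposing exchanges
  them.\<close>

definition skeleton :: "nat set \<Rightarrow> nat set \<Rightarrow> nat set \<Rightarrow> nat set \<Rightarrow> (nat \<Rightarrow> nat \<Rightarrow> rat) \<Rightarrow> bool" where
  "skeleton R C I J a \<longleftrightarrow> I \<subseteq> R \<and> J \<subseteq> C \<and> card J = card I \<and>
     indep_rows a I J \<and> indep_rows (\<lambda>j i. a i j) J I \<and>
     (\<forall>i\<in>R. \<exists>c. \<forall>l\<in>C. a i l = (\<Sum>s\<in>I. c s * a s l)) \<and>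
     (\<forall>l\<in>C. \<exists>d. \<forall>i\<in>R. a i l = (\<Sum>j\<in>J. d j * a i j))"

lemma skeleton_transpose: "skeleton C R J I (\<lambda>j i. a i j) \<longleftrightarrow> skeleton R C I J a"
  unfolding skeleton_def by auto

lemma skeleton_row_span:
  "skeleton R C I J a \<Longrightarrow> i \<in> R \<Longrightarrow> \<exists>c. \<forall>l\<in>C. a i l = (\<Sum>s\<in>I. c s * a s l)"
  by (simp add: skeleton_def)

lemma row_combD: "row_comb a C S i \<Longrightarrow> \<exists>c. \<forall>l\<in>C. a i l = (\<Sum>s\<in>S. c s * a s l)"
  unfolding row_comb_def by blast

lemma skeleton_row_comb:
  assumes "skeleton R C I J a" "finite I" "i \<in> R"
  shows "\<exists>S\<subseteq>I. row_comb a C S i"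
proof -
  obtain c where c: "\<forall>l\<in>C. a i l = (\<Sum>s\<in>I. c s * a s l)"
    using skeleton_row_span[OF assms(1,3)] by blast
  define S where "S = {s \<in> I. c s \<noteq> 0}"
  have "(\<Sum>s\<in>I. c s * a s l) = (\<Sum>s\<in>S. c s * a s l)" for l
    unfolding S_def using assms(2) by (intro sum.mono_neutral_right) auto
  then have "row_comb a C S i" unfolding row_comb_def using c by (intro exI[of _ c]) (auto simp: S_def)
  then show ?thesis by (intro exI[of _ S]) (auto simp: S_def)
qed

text \<open>An empty support would mean a zero row, but unit fractions are nonzero. This is where
  \<open>h \<ge> 1\<close> comes from.\<close>

lemma row_comb_nonempty: "row_comb a C S i \<Longrightarrow> units_on H a R C \<Longrightarrow> i \<in> R \<Longrightarrow> C \<noteq> {} \<Longrightarrow> S \<noteq> {}"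
  unfolding row_comb_def units_on_def using unit_fractions_nonzero by fastforce

definition skeletal :: "nat set \<Rightarrow> nat set \<Rightarrow> nat set \<Rightarrow> nat set \<Rightarrow> real \<Rightarrow> (nat \<times> nat \<Rightarrow> rat) set" where
  "skeletal R C I J H =
     {f \<in> R \<times> C \<rightarrow>\<^sub>E unit_fractions H. skeleton R C I J (curry f)}"

lemma finite_skeletal: "finite R \<Longrightarrow> finite C \<Longrightarrow> finite (skeletal R C I J H)"
  unfolding skeletal_def by (simp add: finite_PiE finite_unit_fractions)

lemma skeletal_units: "f \<in> skeletal R C I J H \<Longrightarrow> units_on H (curry f) R C"
  by (auto simp: skeletal_def units_on_def)

lemma units_on_subset: "units_on H a R C \<Longrightarrow> R' \<subseteq> R \<Longrightarrow> C' \<subseteq> C \<Longrightarrow> units_on H a R' C'"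
  unfolding units_on_def by blast

lemma patterns_skeletal:
  assumes "finite R" "finite C" "X \<subseteq> skeletal R C I J H" "D \<subseteq> R \<times> C" "H \<ge> 1"
  shows "real (patterns X D) \<le> (2 * H) ^ card D"
proof -
  have "finite D" using assms by (meson finite_SigmaI finite_subset)
  then have "patterns X D \<le> card (unit_fractions H) ^ card D"
    using assms by (intro patterns_free finite_unit_fractions) (auto simp: skeletal_def)
  then have "real (patterns X D) \<le> real (card (unit_fractions H)) ^ card D"
    by (simp only: of_nat_le_iff flip: of_nat_power)
  also have "\<dots> \<le> (2 * H) ^ card D" using card_unit_fractions assms by (intro power_mono) auto
  finally show ?thesis .
qed

text \<open>On any \<open>C'\<close> containing \<open>J\<close> the rows \<open>S\<close> stay
  independent, so row \<open>i\<close> lies in a span counted by \<open>card_row_span\<close>. It is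
  used both for \<open>C' = J\<close> and for \<open>C' = C\<close>.\<close>

lemma patterns_row_fiber:
  assumes fin: "finite R" "finite C" and X: "X \<subseteq> skeletal R C I J H" and H: "H \<ge> 1"
    and S: "S \<subseteq> I" and C': "J \<subseteq> C'" "C' \<subseteq> C" and i: "i \<in> R"
    and comb: "\<And>g. g \<in> X \<Longrightarrow> row_comb (curry g) C S i" and f: "f \<in> X"
  shows "real (patterns (agreeing X f (S \<times> C')) ({i} \<times> C')) \<le> (2 * H) ^ card S"
proof -
  let ?a = "curry f"
  let ?Y = "{y \<in> C' \<rightarrow>\<^sub>E unit_fractions H. \<exists>c. \<forall>j\<in>C'. y j = (\<Sum>s\<in>S. c s * ?a s j)}"
  have sk: "skeleton R C I J ?a" using f X by (auto simp: skeletal_def)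
  have finI: "finite I" using sk fin by (auto simp: skeleton_def intro: finite_subset)
  have ind: "indep_rows ?a S C'"
    using sk S finI C' by (auto simp: skeleton_def intro: indep_rows_mono_cols indep_rows_subset)
  have finC': "finite C'" using C' fin finite_subset by blast
  have finS: "finite S" using S finI finite_subset by blast
  have SR: "S \<subseteq> R" using S sk by (auto simp: skeleton_def)
  have u: "units_on H ?a S C'" using units_on_subset[OF skeletal_units SR C'(2)] f X by blast
  have "patterns (agreeing X f (S \<times> C')) ({i} \<times> C') \<le> card ?Y"
  proof (rule patterns_le_card[where \<phi> = "\<lambda>g. restrict (\<lambda>j. g (i, j)) C'"])
    show "finite ?Y"
      by (rule finite_subset[of _ "C' \<rightarrow>\<^sub>E unit_fractions H"])
        (auto simp: finite_PiE finite_unit_fractions finC')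
    fix g assume g: "g \<in> agreeing X f (S \<times> C')"
    then have gX: "g \<in> X" and ag: "\<And>s j. s \<in> S \<Longrightarrow> j \<in> C' \<Longrightarrow> g (s, j) = f (s, j)"
      by (auto simp: agreeing_def)
    obtain c where c: "\<And>l. l \<in> C \<Longrightarrow> g (i, l) = (\<Sum>s\<in>S. c s * g (s, l))"
      using row_combD[OF comb[OF gX]] unfolding curry_conv by blast
    have "g (i, j) = (\<Sum>s\<in>S. c s * f (s, j))" if "j \<in> C'" for j
      using c[of j] that C' ag by auto
    moreover have "g (i, j) \<in> unit_fractions H" if "j \<in> C'" for j
      using gX X i that C' by (auto simp: skeletal_def)
    ultimately show "restrict (\<lambda>j. g (i, j)) C' \<in> ?Y" by auto
  next
    fix g g' p assume "restrict (\<lambda>j. g (i, j)) C' = restrict (\<lambda>j. g' (i, j)) C'" "p \<in> {i} \<times> C'"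
    then show "g p = g' p" by (auto dest: restrict_eqD)
  qed
  also have "\<dots> \<le> card (unit_fractions H) ^ card S"
    by (rule card_row_span[OF ind finS finC' u H])
  finally have "real (patterns (agreeing X f (S \<times> C')) ({i} \<times> C')) \<le> real (card (unit_fractions H)) ^ card S"
    by (simp only: of_nat_le_iff flip: of_nat_power)
  also have "\<dots> \<le> (2 * H) ^ card S" using card_unit_fractions[OF H] by (intro power_mono) auto
  finally show ?thesis .
qed

text \<open>The coefficients of a row are the same in all columns: those that express the known
  columns \<open>J\<close> also express column \<open>l\<close>.\<close>

lemma column_mem_column_extensions:
  assumes sk: "skeleton R C I J b" and u: "units_on H b R C"
    and comb: "row_comb b C S i0" and R': "R' \<subseteq> R" "insert i0 I \<subseteq> R'" and S: "S \<subseteq> I" and l: "l \<in> C"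
    and ag: "\<And>i j. i \<in> R' \<Longrightarrow> j \<in> J \<Longrightarrow> b i j = a i j"
  shows "restrict (\<lambda>i. b i l) R' \<in> column_extensions H R' I J S i0 a"
  unfolding column_extensions_def
proof (intro CollectI conjI ballI)
  have JC: "J \<subseteq> C" using sk by (auto simp: skeleton_def)
  show "restrict (\<lambda>i. b i l) R' \<in> R' \<rightarrow>\<^sub>E unit_fractions H" using u R' l by (auto simp: units_on_def)
  fix i assume i: "i \<in> R'"
  then have "i \<in> R" using R' by blast
  then obtain c where c: "\<And>l. l \<in> C \<Longrightarrow> b i l = (\<Sum>s\<in>I. c s * b s l)"
    using skeleton_row_span[OF sk] by blast
  have "\<forall>j\<in>J. a i j = (\<Sum>s\<in>I. c s * a s j)"
  proof
    fix j assume j: "j \<in> J"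
    have "a i j = b i j" using ag i j by simp
    also have "\<dots> = (\<Sum>s\<in>I. c s * b s j)" using c j JC by auto
    also have "\<dots> = (\<Sum>s\<in>I. c s * a s j)" using ag j R' by (intro sum.cong) auto
    finally show "a i j = (\<Sum>s\<in>I. c s * a s j)" .
  qed
  moreover have "restrict (\<lambda>i. b i l) R' i = (\<Sum>s\<in>I. c s * restrict (\<lambda>i. b i l) R' s)"
  proof -
    have "(\<Sum>s\<in>I. c s * restrict (\<lambda>i. b i l) R' s) = (\<Sum>s\<in>I. c s * b s l)"
      using R' by (intro sum.cong) auto
    then show ?thesis using c[OF l] i by simp
  qed
  ultimately show "\<exists>c. (\<forall>j\<in>J. a i j = (\<Sum>s\<in>I. c s * a s j)) \<and>
      restrict (\<lambda>i. b i l) R' i = (\<Sum>s\<in>I. c s * restrict (\<lambda>i. b i l) R' s)" by blast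
next
  have JC: "J \<subseteq> C" using sk by (auto simp: skeleton_def)
  obtain c where c: "\<And>l. l \<in> C \<Longrightarrow> b i0 l = (\<Sum>s\<in>S. c s * b s l)"
    using row_combD[OF comb] by blast
  have "\<forall>j\<in>J. a i0 j = (\<Sum>s\<in>S. c s * a s j)"
  proof
    fix j assume j: "j \<in> J"
    have "a i0 j = b i0 j" using ag j R' by simp
    also have "\<dots> = (\<Sum>s\<in>S. c s * b s j)" using c j JC by auto
    also have "\<dots> = (\<Sum>s\<in>S. c s * a s j)" using ag j R' S by (intro sum.cong) auto
    finally show "a i0 j = (\<Sum>s\<in>S. c s * a s j)" .
  qed
  moreover have "restrict (\<lambda>i. b i l) R' i0 = (\<Sum>s\<in>S. c s * restrict (\<lambda>i. b i l) R' s)"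
  proof -
    have "(\<Sum>s\<in>S. c s * restrict (\<lambda>i. b i l) R' s) = (\<Sum>s\<in>S. c s * b s l)"
      using R' S by (intro sum.cong) auto
    then show ?thesis using c[OF l] R' by simp
  qed
  ultimately show "\<exists>c. (\<forall>j\<in>J. a i0 j = (\<Sum>s\<in>S. c s * a s j)) \<and>
      restrict (\<lambda>i. b i l) R' i0 = (\<Sum>s\<in>S. c s * restrict (\<lambda>i. b i l) R' s)" by blast
qed

text \<open>Fixes the constant of \<open>card_column_extensions\<close> before \<open>H\<close> and
  the matrix are chosen, and makes it nonnegative so that powers of it can be multiplied into
  inequalities.\<close>

definition column_fiber_bound :: "nat \<Rightarrow> nat \<Rightarrow> real \<Rightarrow> real \<Rightarrow> bool" where
  "column_fiber_bound r h t K \<longleftrightarrow> K \<ge> 0 \<and>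
    (\<forall>H\<ge>1. \<forall>R I J S i0 a. finite R \<longrightarrow> I \<subseteq> R \<longrightarrow> S \<subseteq> I \<longrightarrow> i0 \<in> R - I \<longrightarrow> finite J \<longrightarrow>
     card S = h \<longrightarrow> card I = r \<longrightarrow> indep_rows a I J \<longrightarrow> units_on H a R J \<longrightarrow> row_comb a J S i0 \<longrightarrow>
     real (card (column_extensions H R I J S i0 a)) \<le> K * H powr (real (r - h) + t))"

lemma column_fiber_bound_exists: "eqn_bound (Suc h) t \<Longrightarrow> \<exists>K. column_fiber_bound r h t K"
proof -
  assume "eqn_bound (Suc h) t"
  from card_column_extensions[OF this, of r, folded row_comb_def] obtain K where
    K: "\<forall>H\<ge>1. \<forall>R I J S i0 a. finite R \<longrightarrow> I \<subseteq> R \<longrightarrow> S \<subseteq> I \<longrightarrow> i0 \<in> R - I \<longrightarrow> finite J \<longrightarrow>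
     card S = h \<longrightarrow> card I = r \<longrightarrow> indep_rows a I J \<longrightarrow> units_on H a R J \<longrightarrow> row_comb a J S i0 \<longrightarrow>
     real (card (column_extensions H R I J S i0 a)) \<le> K * H powr (real (r - h) + t)"
    by (elim exE) (rule that)
  have "column_fiber_bound r h t (max K 0)"
    unfolding column_fiber_bound_def
  proof (intro conjI allI impI)
    fix H :: real and R I J S :: "nat set" and i0 :: nat and a :: "nat \<Rightarrow> nat \<Rightarrow> rat"
    assume "1 \<le> H" "finite R" "I \<subseteq> R" "S \<subseteq> I" "i0 \<in> R - I" "finite J" "card S = h" "card I = r"
      "indep_rows a I J" "units_on H a R J" "row_comb a J S i0"
    then have "real (card (column_extensions H R I J S i0 a)) \<le> K * H powr (real (r - h) + t)"
      by (intro K[rule_format])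
    also have "\<dots> \<le> max K 0 * H powr (real (r - h) + t)" by (intro mult_right_mono) auto
    finally show "real (card (column_extensions H R I J S i0 a)) \<le> max K 0 * H powr (real (r - h) + t)" .
  qed simp
  then show ?thesis by blast
qed

lemma column_fiber_boundD:
  assumes "column_fiber_bound r h t K" "H \<ge> 1" "finite R" "I \<subseteq> R" "S \<subseteq> I" "i0 \<in> R - I" "finite J"
    "card S = h" "card I = r" "indep_rows a I J" "units_on H a R J" "row_comb a J S i0"
  shows "real (card (column_extensions H R I J S i0 a)) \<le> K * H powr (real (r - h) + t)"
  using assms unfolding column_fiber_bound_def by blast

lemma row_comb_subset: "row_comb a C S i \<Longrightarrow> J \<subseteq> C \<Longrightarrow> row_comb a J S i"
  unfolding row_comb_def by blast

lemma patterns_column_fiber: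
  assumes K: "column_fiber_bound r h t K" and fin: "finite R" "finite C"
    and X: "X \<subseteq> skeletal R C I J H" and H: "H \<ge> 1"
    and R': "R' \<subseteq> R" "I \<subseteq> R'" "i0 \<in> R' - I" and S: "S \<subseteq> I" "card S = h" "card I = r"
    and comb: "\<And>g. g \<in> X \<Longrightarrow> row_comb (curry g) C S i0" and l: "l \<in> C" and f: "f \<in> X"
  shows "real (patterns (agreeing X f (R' \<times> J)) (R' \<times> {l})) \<le> K * H powr (real (r - h) + t)"
proof -
  let ?a = "curry f"
  have sk: "skeleton R C I J ?a" using f X by (auto simp: skeletal_def)
  have finR': "finite R'" using R' fin finite_subset by blast
  have J: "J \<subseteq> C" "finite J" using sk fin by (auto simp: skeleton_def intro: finite_subset)
  have "patterns (agreeing X f (R' \<times> J)) (R' \<times> {l}) \<le> card (column_extensions H R' I J S i0 ?a)"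
  proof (rule patterns_le_card[where \<phi> = "\<lambda>g. restrict (\<lambda>i. curry g i l) R'"])
    show "finite (column_extensions H R' I J S i0 ?a)" by (rule finite_column_extensions[OF finR'])
    fix g assume g: "g \<in> agreeing X f (R' \<times> J)"
    then have gX: "g \<in> X" and ag: "\<And>i j. i \<in> R' \<Longrightarrow> j \<in> J \<Longrightarrow> curry g i j = ?a i j"
      by (auto simp: agreeing_def)
    show "restrict (\<lambda>i. curry g i l) R' \<in> column_extensions H R' I J S i0 ?a"
    proof (rule column_mem_column_extensions[OF _ skeletal_units comb[OF gX]])
      show "skeleton R C I J (curry g)" "g \<in> skeletal R C I J H" using gX X by (auto simp: skeletal_def)
    qed (use R' S l ag in auto)
  next
    fix g g' p assume "restrict (\<lambda>i. curry g i l) R' = restrict (\<lambda>i. curry g' i l) R'" "p \<in> R' \<times> {l}"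
    then show "g p = g' p" by (auto dest: restrict_eqD)
  qed
  moreover have "real (card (column_extensions H R' I J S i0 ?a)) \<le> K * H powr (real (r - h) + t)"
  proof (rule column_fiber_boundD[OF K H finR' R'(2) S(1) R'(3) J(2) S(2,3)])
    show "indep_rows ?a I J" using sk by (simp add: skeleton_def)
    show "units_on H ?a R' J" using units_on_subset[OF skeletal_units R'(1) J(1)] f X by blast
    show "row_comb ?a J S i0" by (rule row_comb_subset[OF comb[OF f] J(1)])
  qed
  ultimately show ?thesis by linarith
qed

text \<open>Rows added by means of an equation: the known rows \<open>I\<close> determine how column
  \<open>l0\<close> depends on the columns in \<open>S\<close>, and every further row satisfies that
  relation.\<close>

lemma patterns_column_fiber_transpose:
  assumes K: "column_fiber_bound r h t K" and fin: "finite R" "finite C"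
    and X: "X \<subseteq> skeletal R C I J H" and H: "H \<ge> 1"
    and C': "C' \<subseteq> C" "J \<subseteq> C'" "l0 \<in> C' - J" and S: "S \<subseteq> J" "card S = h" "card J = r"
    and comb: "\<And>g. g \<in> X \<Longrightarrow> row_comb (\<lambda>j i. g (i, j)) R S l0" and i: "i \<in> R" and f: "f \<in> X"
  shows "real (patterns (agreeing X f (I \<times> C')) ({i} \<times> C')) \<le> K * H powr (real (r - h) + t)"
proof -
  let ?a = "\<lambda>j i. f (i, j)"
  have skT: "skeleton C R J I (\<lambda>j i. g (i, j))" if "g \<in> X" for g
    using that X skeleton_transpose[of C R J I "curry g"] by (auto simp: skeletal_def)
  have uT: "units_on H (\<lambda>j i. g (i, j)) C R" if "g \<in> X" for g
    using that X by (auto simp: skeletal_def units_on_def)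
  have finC': "finite C'" using C' fin finite_subset by blast
  have I: "I \<subseteq> R" "finite I" using skT[OF f] fin by (auto simp: skeleton_def intro: finite_subset)
  have "patterns (agreeing X f (I \<times> C')) ({i} \<times> C') \<le> card (column_extensions H C' J I S l0 ?a)"
  proof (rule patterns_le_card[where \<phi> = "\<lambda>g. restrict (\<lambda>j. g (i, j)) C'"])
    show "finite (column_extensions H C' J I S l0 ?a)" by (rule finite_column_extensions[OF finC'])
    fix g assume g: "g \<in> agreeing X f (I \<times> C')"
    then have gX: "g \<in> X" and ag: "\<And>i j. i \<in> I \<Longrightarrow> j \<in> C' \<Longrightarrow> g (i, j) = f (i, j)"
      by (auto simp: agreeing_def)
    show "restrict (\<lambda>j. g (i, j)) C' \<in> column_extensions H C' J I S l0 ?a"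
      by (rule column_mem_column_extensions[OF skT[OF gX] uT[OF gX] comb[OF gX]])
        (use C' S i ag in auto)
  next
    fix g g' p assume "restrict (\<lambda>j. g (i, j)) C' = restrict (\<lambda>j. g' (i, j)) C'" "p \<in> {i} \<times> C'"
    then show "g p = g' p" by (auto dest: restrict_eqD)
  qed
  moreover have "real (card (column_extensions H C' J I S l0 ?a)) \<le> K * H powr (real (r - h) + t)"
  proof (rule column_fiber_boundD[OF K H finC' C'(2) S(1) C'(3) I(2) S(2,3)])
    show "indep_rows ?a J I" using skT[OF f] by (simp add: skeleton_def)
    show "units_on H ?a C' I" by (rule units_on_subset[OF uT[OF f] C'(1) I(1)])
    show "row_comb ?a I S l0" by (rule row_comb_subset[OF comb[OF f] I(1)])
  qed
  ultimately show ?thesis by linarith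
qed

lemma agreeing_antimono: "D \<subseteq> D' \<Longrightarrow> agreeing X f D' \<subseteq> agreeing X f D"
  unfolding agreeing_def by blast

lemma patterns_agreeing_antimono:
  assumes "finite X" "D \<subseteq> D'" "real (patterns (agreeing X f D) E) \<le> k"
  shows "real (patterns (agreeing X f D') E) \<le> k"
proof -
  have "patterns (agreeing X f D') E \<le> patterns (agreeing X f D) E"
    using assms by (intro patterns_mono agreeing_antimono) (auto simp: agreeing_def)
  then show ?thesis using assms(3) by linarith
qed

lemma power_mult_powr:
  fixes H :: real
  shows "H > 0 \<Longrightarrow> (2 * H) ^ a * (K * H powr x) ^ b = 2 ^ a * K ^ b * H powr (real a + real b * x)"
  by (simp add: power_mult_distrib powr_power powr_add powr_realpow)

lemma pow_bound_row_supports: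
  assumes fin: "finite R" "finite C" and IJ: "I \<subseteq> R" "J \<subseteq> C" "card I = r" "card J = r"
    and \<sigma>: "\<And>i. i \<in> R - I \<Longrightarrow> \<sigma> i \<subseteq> I \<and> card (\<sigma> i) \<le> h"
    and i0: "i0 \<in> R - I" "card (\<sigma> i0) = h" and t: "eqn_bound (Suc h) t"
  shows "pow_bound (\<lambda>H. real (card {f \<in> skeletal R C I J H. \<forall>i\<in>R - I. row_comb (curry f) C (\<sigma> i) i}))
    (real (r * r + h * (card R - r)) + real (card C - r) * (real (r - h) + t))"
proof -
  obtain K where K: "column_fiber_bound r h t K" using column_fiber_bound_exists[OF t] by blast
  have K0: "K \<ge> 0" using K by (simp add: column_fiber_bound_def)
  show ?thesis
  proof (rule pow_boundI)
    fix H :: real assume H: "H \<ge> 1"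
    let ?X = "{f \<in> skeletal R C I J H. \<forall>i\<in>R - I. row_comb (curry f) C (\<sigma> i) i}"
    let ?m = "card R - r" and ?n = "card C - r"
    have X: "?X \<subseteq> skeletal R C I J H" by blast
    have finX: "finite ?X" using finite_skeletal[OF fin] by simp
    have finI: "finite I" using IJ fin finite_subset by blast
    have finJ: "finite J" using IJ fin finite_subset by blast
    have cards: "card (R - I) = ?m" "card (C - J) = ?n" using IJ finI finJ by (simp_all add: card_Diff_subset)
    have 0: "real (patterns ?X (I \<times> J)) \<le> (2 * H) ^ (r * r)"
      using patterns_skeletal[OF fin X _ H, of "I \<times> J"] IJ by (simp add: Sigma_mono card_cartesian_product)
    \<comment> \<open>The minor is filled, and each further row costs at most \<open>h\<close>
      within \<open>J\<close>. After this the relation for row \<open>i0\<close> is known, and each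
      further column costs \<open>r - h + t\<close>.\<close>
    have "real (patterns ?X (I \<times> J \<union> (\<Union>i\<in>R - I. {i} \<times> J))) \<le> real (patterns ?X (I \<times> J)) * ((2 * H) ^ h) ^ card (R - I)"
    proof (intro patterns_family finX)
      fix i f assume i: "i \<in> R - I" and f: "f \<in> ?X"
      have "real (patterns (agreeing ?X f (\<sigma> i \<times> J)) ({i} \<times> J)) \<le> (2 * H) ^ card (\<sigma> i)"
        using \<sigma>[OF i] i IJ by (intro patterns_row_fiber[OF fin X H _ _ _ _ _ f]) auto
      also have "\<dots> \<le> (2 * H) ^ h" using \<sigma>[OF i] H by (intro power_increasing) auto
      finally have "real (patterns (agreeing ?X f (\<sigma> i \<times> J)) ({i} \<times> J)) \<le> (2 * H) ^ h" .
      moreover have "\<sigma> i \<times> J \<subseteq> I \<times> J" using \<sigma>[OF i] by blast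
      ultimately show "real (patterns (agreeing ?X f (I \<times> J)) ({i} \<times> J)) \<le> (2 * H) ^ h"
        by (rule patterns_agreeing_antimono[OF finX, rotated])
    qed (use fin H in auto)
    also have "I \<times> J \<union> (\<Union>i\<in>R - I. {i} \<times> J) = R \<times> J" using IJ by auto
    also have "real (patterns ?X (I \<times> J)) * ((2 * H) ^ h) ^ card (R - I) \<le> (2 * H) ^ (r * r) * ((2 * H) ^ h) ^ card (R - I)"
      using 0 H by (intro mult_right_mono) auto
    also have "\<dots> = (2 * H) ^ (r * r + h * ?m)" by (simp only: cards power_add power_mult)
    finally have 1: "real (patterns ?X (R \<times> J)) \<le> (2 * H) ^ (r * r + h * ?m)" .
    have "real (patterns ?X (R \<times> J \<union> (\<Union>l\<in>C - J. R \<times> {l}))) \<le>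
        real (patterns ?X (R \<times> J)) * (K * H powr (real (r - h) + t)) ^ card (C - J)"
    proof (intro patterns_family finX)
      fix l f assume l: "l \<in> C - J" and f: "f \<in> ?X"
      show "real (patterns (agreeing ?X f (R \<times> J)) (R \<times> {l})) \<le> K * H powr (real (r - h) + t)"
        using IJ i0 \<sigma>[OF i0(1)] l by (intro patterns_column_fiber[OF K fin X H _ _ _ _ i0(2) IJ(3) _ _ f]) auto
    qed (use fin K0 in auto)
    also have "R \<times> J \<union> (\<Union>l\<in>C - J. R \<times> {l}) = R \<times> C" using IJ by auto
    also have "patterns ?X (R \<times> C) = card ?X"
      by (rule patterns_extensional) (auto simp: skeletal_def PiE_def)
    also have "real (patterns ?X (R \<times> J)) * (K * H powr (real (r - h) + t)) ^ card (C - J) \<le>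
        (2 * H) ^ (r * r + h * ?m) * (K * H powr (real (r - h) + t)) ^ card (C - J)"
      using 1 K0 by (intro mult_right_mono) auto
    also have "\<dots> = 2 ^ (r * r + h * ?m) * K ^ ?n *
        H powr (real (r * r + h * ?m) + real ?n * (real (r - h) + t))"
      unfolding cards using H by (intro power_mult_powr) simp
    finally show "real (card ?X) \<le> 2 ^ (r * r + h * ?m) * K ^ ?n *
        H powr (real (r * r + h * ?m) + real ?n * (real (r - h) + t))" .
  qed
qed

text \<open>After the minor, only row \<open>i0\<close> is filled within \<open>J\<close>, at cost
  \<open>r\<close>. The equation of row \<open>i0\<close> then extends the \<open>r + 1\<close> rows
  to all columns at cost \<open>t\<close> each. Now the relation of column \<open>l0\<close> is
  known too, and it yields each of the other \<open>card R - r - 1\<close> rows at cost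
  \<open>t\<close> instead of \<open>r\<close>.\<close>

lemma pow_bound_full_supports:
  assumes fin: "finite R" "finite C" and IJ: "I \<subseteq> R" "J \<subseteq> C" "card I = r" "card J = r"
    and i0: "i0 \<in> R - I" and l0: "l0 \<in> C - J" and t: "eqn_bound (Suc r) t"
  shows "pow_bound (\<lambda>H. real (card {f \<in> skeletal R C I J H.
      row_comb (curry f) C I i0 \<and> row_comb (\<lambda>j i. f (i, j)) R J l0}))
    (real (r * r + r) + real (card C - r + (card R - r - 1)) * t)"
proof -
  obtain K where K: "column_fiber_bound r r t K" using column_fiber_bound_exists[OF t] by blast
  have K0: "K \<ge> 0" using K by (simp add: column_fiber_bound_def)
  show ?thesis
  proof (rule pow_boundI)
    fix H :: real assume H: "H \<ge> 1"
    let ?X = "{f \<in> skeletal R C I J H. row_comb (curry f) C I i0 \<and> row_comb (\<lambda>j i. f (i, j)) R J l0}"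
    let ?m = "card R - r - 1" and ?n = "card C - r" and ?I = "insert i0 I" and ?k = "K * H powr t"
    have X: "?X \<subseteq> skeletal R C I J H" by blast
    have finX: "finite ?X" using finite_skeletal[OF fin] by simp
    have finI: "finite I" using IJ fin finite_subset by blast
    have finJ: "finite J" using IJ fin finite_subset by blast
    have cards: "card (R - ?I) = ?m" "card (C - J) = ?n"
      using IJ i0 finI finJ by (simp_all add: card_Diff_subset)
    have k0: "?k \<ge> 0" using K0 by simp
    have "real (patterns ?X (I \<times> J \<union> {i0} \<times> J)) \<le> real (patterns ?X (I \<times> J)) * (2 * H) ^ r"
    proof (intro patterns_step finX)
      fix f assume f: "f \<in> ?X"
      show "real (patterns (agreeing ?X f (I \<times> J)) ({i0} \<times> J)) \<le> (2 * H) ^ r"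
        using patterns_row_fiber[OF fin X H subset_refl subset_refl IJ(2) _ _ f, of i0] i0 IJ by auto
    qed
    also have "I \<times> J \<union> {i0} \<times> J = ?I \<times> J" by auto
    also have "real (patterns ?X (I \<times> J)) * (2 * H) ^ r \<le> (2 * H) ^ (r * r) * (2 * H) ^ r"
      using patterns_skeletal[OF fin X _ H, of "I \<times> J"] IJ H
      by (intro mult_right_mono) (auto simp: Sigma_mono card_cartesian_product)
    finally have 1: "real (patterns ?X (?I \<times> J)) \<le> (2 * H) ^ (r * r + r)"
      by (simp only: power_add)
    have "real (patterns ?X (?I \<times> J \<union> (\<Union>l\<in>C - J. ?I \<times> {l}))) \<le> real (patterns ?X (?I \<times> J)) * ?k ^ card (C - J)"
    proof (intro patterns_family finX k0)
      fix l f assume l: "l \<in> C - J" and f: "f \<in> ?X"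
      show "real (patterns (agreeing ?X f (?I \<times> J)) (?I \<times> {l})) \<le> ?k"
        using patterns_column_fiber[OF K fin X H _ _ _ subset_refl IJ(3) IJ(3) _ _ f, of ?I i0 l] IJ i0 l by auto
    qed (use fin in auto)
    also have "?I \<times> J \<union> (\<Union>l\<in>C - J. ?I \<times> {l}) = ?I \<times> C" using IJ by auto
    also have "real (patterns ?X (?I \<times> J)) * ?k ^ card (C - J) \<le> (2 * H) ^ (r * r + r) * ?k ^ card (C - J)"
      using 1 k0 by (intro mult_right_mono) auto
    finally have 2: "real (patterns ?X (?I \<times> C)) \<le> (2 * H) ^ (r * r + r) * ?k ^ ?n" by (simp only: cards)
    have "real (patterns ?X (?I \<times> C \<union> (\<Union>i\<in>R - ?I. {i} \<times> C))) \<le> real (patterns ?X (?I \<times> C)) * ?k ^ card (R - ?I)"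
    proof (intro patterns_family finX k0)
      fix i f assume i: "i \<in> R - ?I" and f: "f \<in> ?X"
      have "real (patterns (agreeing ?X f (I \<times> C)) ({i} \<times> C)) \<le> ?k"
        using patterns_column_fiber_transpose[OF K fin X H _ _ _ subset_refl IJ(4) IJ(4) _ _ f, of C l0 i] IJ l0 i by auto
      moreover have "I \<times> C \<subseteq> ?I \<times> C" by blast
      ultimately show "real (patterns (agreeing ?X f (?I \<times> C)) ({i} \<times> C)) \<le> ?k"
        by (rule patterns_agreeing_antimono[OF finX, rotated])
    qed (use fin in auto)
    also have "?I \<times> C \<union> (\<Union>i\<in>R - ?I. {i} \<times> C) = R \<times> C" using IJ i0 by auto
    also have "patterns ?X (R \<times> C) = card ?X"
      by (rule patterns_extensional) (auto simp: skeletal_def PiE_def)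
    also have "real (patterns ?X (?I \<times> C)) * ?k ^ card (R - ?I) \<le> (2 * H) ^ (r * r + r) * ?k ^ ?n * ?k ^ card (R - ?I)"
      using 2 k0 by (intro mult_right_mono) auto
    also have "\<dots> = (2 * H) ^ (r * r + r) * ?k ^ (?n + ?m)" by (simp only: cards power_add mult.assoc)
    also have "\<dots> = 2 ^ (r * r + r) * K ^ (?n + ?m) * H powr (real (r * r + r) + real (?n + ?m) * t)"
      using H by (intro power_mult_powr) simp
    finally show "real (card ?X) \<le> 2 ^ (r * r + r) * K ^ (?n + ?m) * H powr (real (r * r + r) + real (?n + ?m) * t)" .
  qed
qed

section \<open>Rank one and proportional rows\<close>

text \<open>Rank one through vanishing 2 by 2 minors, which for the denominators are equalities
  between products of two integers.\<close>

definition rank_one_on :: "real \<Rightarrow> nat set \<Rightarrow> nat set \<Rightarrow> (nat \<times> nat \<Rightarrow> rat) set \<Rightarrow> bool" where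
  "rank_one_on H R C X \<longleftrightarrow> (\<forall>f\<in>X. units_on H (curry f) R C \<and>
     (\<forall>i\<in>R. \<forall>i'\<in>R. \<forall>j\<in>C. \<forall>j'\<in>C. f (i, j) * f (i', j') = f (i, j') * f (i', j)))"

text \<open>The constant depends only on \<open>p\<close>, \<open>q\<close> and \<epsilon>, so the
  bound applies to the whole matrix and also, with \<open>p = 2\<close>, to a pair of proportional
  rows inside a larger one.\<close>

lemma rank_one_patterns:
  assumes "\<epsilon> > 0"
  shows "\<exists>K\<ge>0. \<forall>H\<ge>1. \<forall>R C X. finite R \<longrightarrow> finite C \<longrightarrow> R \<noteq> {} \<longrightarrow> card R = p \<longrightarrow> card C = q \<longrightarrow>
    p \<le> q \<longrightarrow> finite X \<longrightarrow> rank_one_on H R C X \<longrightarrow> real (patterns X (R \<times> C)) \<le> K * H powr (real q + \<epsilon>)"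
proof -
  \<comment> \<open>There are \<open>p * p\<close> divisor choices, each for a product of two
    denominators of size at most \<open>H * H\<close>, so each costs
    \<open>H powr (2 * \<delta>)\<close>.\<close>
  define \<delta> where "\<delta> = \<epsilon> / (2 * real (p * p) + 1)"
  have den: "2 * real (p * p) + 1 > 0" by (simp add: add_nonneg_pos)
  have \<delta>: "\<delta> > 0" using assms den by (simp add: \<delta>_def)
  have \<delta>\<epsilon>: "real (p * p) * (2 * \<delta>) \<le> \<epsilon>"
  proof -
    have "real (p * p) * (2 * \<delta>) \<le> (2 * real (p * p) + 1) * \<delta>" using \<delta> by (simp add: distrib_right)
    also have "\<dots> = \<epsilon>" using den by (simp add: \<delta>_def)
    finally show ?thesis .
  qed
  obtain K where K: "K \<ge> 1"
    "\<And>z. z \<noteq> 0 \<Longrightarrow> real (card {d :: int. d dvd z}) \<le> K * real_of_int \<bar>z\<bar> powr \<delta>"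
    using int_divisor_bound[OF \<delta>] by blast
  show ?thesis
  proof (rule exI[of _ "2 ^ q * K ^ (p * p)"], intro conjI allI impI)
    show "0 \<le> 2 ^ q * K ^ (p * p)" using K by simp
    fix H :: real and R C :: "nat set" and X :: "(nat \<times> nat \<Rightarrow> rat) set"
    assume H: "1 \<le> H" and fin: "finite R" "finite C" and ne: "R \<noteq> {}" and c: "card R = p" "card C = q" "p \<le> q"
      and X: "finite X" and r1: "rank_one_on H R C X"
    have u: "units_on H (curry f) R C" if "f \<in> X" for f using r1 that by (simp add: rank_one_on_def)
    have rel: "f (i, j) * f (i', j') = f (i, j') * f (i', j)"
      if "f \<in> X" "i \<in> R" "i' \<in> R" "j \<in> C" "j' \<in> C" for f i i' j j'
      using r1 that by (simp add: rank_one_on_def)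
    have unit: "f (i, j) \<in> unit_fractions H" if "f \<in> X" "i \<in> R" "j \<in> C" for f i j
      using u that by (auto simp: units_on_def)
    \<comment> \<open>The graph of an injection of the rows into the columns serves as the diagonal
      of a square block.\<close>
    obtain \<tau> where \<tau>: "\<tau> ` R \<subseteq> C" "inj_on \<tau> R" using card_le_inj[OF fin] c by auto
    let ?D = "(\<lambda>i. (i, \<tau> i)) ` R"
    let ?k = "K * H powr (2 * \<delta>)"
    have cardD: "card ?D = p" using c by (subst card_image) (auto intro: inj_onI)
    have "patterns X ?D \<le> card (unit_fractions H) ^ card ?D"
      using fin \<tau> unit by (intro patterns_free finite_unit_fractions) auto
    then have "real (patterns X ?D) \<le> real (card (unit_fractions H)) ^ p"
      unfolding cardD by (simp only: of_nat_le_iff flip: of_nat_power)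
    also have "\<dots> \<le> (2 * H) ^ p" using card_unit_fractions[OF H] by (intro power_mono) auto
    finally have 0: "real (patterns X ?D) \<le> (2 * H) ^ p" .
    have k0: "?k \<ge> 0" using K by simp
    have "real (patterns X (?D \<union> (\<Union>x\<in>R \<times> R. {(fst x, \<tau> (snd x))}))) \<le> real (patterns X ?D) * ?k ^ card (R \<times> R)"
    proof (intro patterns_family X k0)
      fix x f assume "x \<in> R \<times> R" and f: "f \<in> X"
      then obtain i i' where x: "x = (i, i')" "i \<in> R" "i' \<in> R" by auto
      have \<tau>C: "\<tau> i \<in> C" "\<tau> i' \<in> C" using \<tau> x by auto
      obtain v w where vw: "v \<in> nonzero_ints H" "w \<in> nonzero_ints H"
          "f (i, \<tau> i) = 1 / of_int v" "f (i', \<tau> i') = 1 / of_int w"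
        using unit[OF f x(2) \<tau>C(1)] unit[OF f x(3) \<tau>C(2)] by (auto simp: unit_fractions_eq)
      have vw0: "v \<noteq> 0" "w \<noteq> 0" using vw by (auto simp: nonzero_ints_def)
      let ?Y = "(\<lambda>b. 1 / of_int b :: rat) ` {b. b dvd v * w}"
      have finY: "finite {b. b dvd v * w}" using vw0 finite_divisors_int[of "v * w"] by simp
      have "patterns (agreeing X f ?D) {(i, \<tau> i')} \<le> card ?Y"
      proof (rule patterns_le_card[where \<phi> = "\<lambda>g. g (i, \<tau> i')"])
        show "finite ?Y" using finY by simp
        fix g assume "g \<in> agreeing X f ?D"
        then have g: "g \<in> X" "g (i, \<tau> i) = f (i, \<tau> i)" "g (i', \<tau> i') = f (i', \<tau> i')"
          using x by (auto simp: agreeing_def)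
        obtain b b' where b: "b \<in> nonzero_ints H" "b' \<in> nonzero_ints H"
            "g (i, \<tau> i') = 1 / of_int b" "g (i', \<tau> i) = 1 / of_int b'"
          using unit[OF g(1) x(2) \<tau>C(2)] unit[OF g(1) x(3) \<tau>C(1)] by (auto simp: unit_fractions_eq)
        have b0: "b \<noteq> 0" "b' \<noteq> 0" using b by (auto simp: nonzero_ints_def)
        have "g (i, \<tau> i') * g (i', \<tau> i) = g (i, \<tau> i) * g (i', \<tau> i')"
          using rel[OF g(1) x(2,3) \<tau>C(2,1)] .
        then have "(of_int (b * b') :: rat) = of_int (v * w)"
          using b b0 vw vw0 g by (simp add: field_simps)
        then have "b * b' = v * w" by (simp only: of_int_eq_iff)
        then have "b dvd v * w" by (metis dvd_triv_left)
        then show "g (i, \<tau> i') \<in> ?Y" using b by auto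
      qed auto
      also have "\<dots> \<le> card {b. b dvd v * w}" by (rule card_image_le[OF finY])
      finally have "real (patterns (agreeing X f ?D) {(i, \<tau> i')}) \<le> real (card {b. b dvd v * w})" by simp
      also have "\<dots> \<le> K * real_of_int \<bar>v * w\<bar> powr \<delta>" using vw0 by (intro K(2)) simp
      also have "\<dots> \<le> K * (H * H) powr \<delta>"
        using K vw \<delta> H by (intro mult_left_mono powr_mono2) (auto simp: nonzero_ints_def abs_mult intro: mult_mono)
      also have "(H * H) powr \<delta> = H powr (2 * \<delta>)" using H by (simp add: powr_mult flip: powr_add)
      finally show "real (patterns (agreeing X f ?D) {(fst x, \<tau> (snd x))}) \<le> ?k" using x by simp
    qed (use fin in auto)
    also have "?D \<union> (\<Union>x\<in>R \<times> R. {(fst x, \<tau> (snd x))}) = R \<times> \<tau> ` R" by auto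
    also have "real (patterns X ?D) * ?k ^ card (R \<times> R) \<le> (2 * H) ^ p * ?k ^ card (R \<times> R)"
      using 0 k0 by (intro mult_right_mono) auto
    finally have 1: "real (patterns X (R \<times> \<tau> ` R)) \<le> (2 * H) ^ p * ?k ^ (p * p)"
      by (simp only: card_cartesian_product c)
    obtain i1 where i1: "i1 \<in> R" using ne by blast
    \<comment> \<open>A new column \<open>j\<close> is determined by its entry in the fixed row
      \<open>i1\<close>: the minor on rows \<open>i\<close>, \<open>i1\<close> and columns
      \<open>j\<close>, \<open>\<tau> i1\<close> gives the entry in row \<open>i\<close>.\<close>
    have "real (patterns X (R \<times> \<tau> ` R \<union> (\<Union>j\<in>C - \<tau> ` R. R \<times> {j}))) \<le>
        real (patterns X (R \<times> \<tau> ` R)) * (2 * H) ^ card (C - \<tau> ` R)"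
    proof (intro patterns_family X)
      fix j f assume j: "j \<in> C - \<tau> ` R" and f: "f \<in> X"
      have "patterns (agreeing X f (R \<times> \<tau> ` R)) (R \<times> {j}) \<le> card (unit_fractions H)"
      proof (rule patterns_le_card[where \<phi> = "\<lambda>g. g (i1, j)", OF finite_unit_fractions])
        fix g assume "g \<in> agreeing X f (R \<times> \<tau> ` R)"
        then show "g (i1, j) \<in> unit_fractions H" using unit i1 j by (auto simp: agreeing_def)
      next
        fix g h x assume g: "g \<in> agreeing X f (R \<times> \<tau> ` R)" and h: "h \<in> agreeing X f (R \<times> \<tau> ` R)"
          and eq: "g (i1, j) = h (i1, j)" and "x \<in> R \<times> {j}"
        then obtain i where x: "x = (i, j)" "i \<in> R" by auto
        have X': "g \<in> X" "h \<in> X" using g h by (auto simp: agreeing_def)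
        have e: "g (i1, \<tau> i1) = h (i1, \<tau> i1)" "g (i, \<tau> i1) = h (i, \<tau> i1)"
          using g h i1 x by (auto simp: agreeing_def)
        have "g (i, j) * g (i1, \<tau> i1) = g (i, \<tau> i1) * g (i1, j)"
          using rel[OF X'(1) x(2) i1, of j "\<tau> i1"] j \<tau> i1 by auto
        moreover have "h (i, j) * h (i1, \<tau> i1) = h (i, \<tau> i1) * h (i1, j)"
          using rel[OF X'(2) x(2) i1, of j "\<tau> i1"] j \<tau> i1 by auto
        ultimately have "g x * h (i1, \<tau> i1) = h x * h (i1, \<tau> i1)" using e eq x by simp
        moreover have "h (i1, \<tau> i1) \<noteq> 0"
          using unit[OF X'(2) i1, of "\<tau> i1"] \<tau> i1 unit_fractions_nonzero by auto
        ultimately show "g x = h x" by simp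
      qed
      then show "real (patterns (agreeing X f (R \<times> \<tau> ` R)) (R \<times> {j})) \<le> 2 * H"
        using card_unit_fractions[OF H] by linarith
    qed (use fin H in auto)
    also have "R \<times> \<tau> ` R \<union> (\<Union>j\<in>C - \<tau> ` R. R \<times> {j}) = R \<times> C" using \<tau> by auto
    also have "card (C - \<tau> ` R) = q - p"
      using \<tau> fin c by (simp add: card_Diff_subset card_image)
    also have "real (patterns X (R \<times> \<tau> ` R)) * (2 * H) ^ (q - p) \<le> (2 * H) ^ p * ?k ^ (p * p) * (2 * H) ^ (q - p)"
      using 1 H by (intro mult_right_mono) auto
    also have "\<dots> = (2 * H) ^ (p + (q - p)) * ?k ^ (p * p)" by (simp only: power_add mult_ac)
    also have "\<dots> = (2 * H) ^ q * ?k ^ (p * p)" using c by simp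
    also have "\<dots> = 2 ^ q * K ^ (p * p) * H powr (real q + real (p * p) * (2 * \<delta>))"
      using H by (intro power_mult_powr) simp
    also have "\<dots> \<le> 2 ^ q * K ^ (p * p) * H powr (real q + \<epsilon>)"
      using K H \<delta>\<epsilon> by (intro mult_left_mono powr_mono) auto
    finally show "real (patterns X (R \<times> C)) \<le> 2 ^ q * K ^ (p * p) * H powr (real q + \<epsilon>)" .
  qed
qed

text \<open>The saving of a factor $H$ over \<open>pow_bound_row_supports\<close> comes from treating row $i_0$
  together with the row it is proportional to as a matrix of rank one.\<close>

lemma pow_bound_singleton_supports:
  assumes fin: "finite R" "finite C" and IJ: "I \<subseteq> R" "J \<subseteq> C" "card I = r" and C2: "card C \<ge> 2"
    and \<sigma>: "\<And>i. i \<in> R - I \<Longrightarrow> \<sigma> i \<subseteq> I \<and> card (\<sigma> i) = 1"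
    and i0: "i0 \<in> R - I" and \<epsilon>: "\<epsilon> > 0"
  shows "pow_bound (\<lambda>H. real (card {f \<in> skeletal R C I J H. \<forall>i\<in>R - I. row_comb (curry f) C (\<sigma> i) i}))
    (real (r * card C + (card R - r - 1)) + \<epsilon>)"
proof -
  let ?n = "card C" and ?m = "card R - r - 1"
  obtain j0 where j0: "\<sigma> i0 = {j0}" "j0 \<in> I" using \<sigma>[OF i0] by (auto simp: card_1_singleton_iff)
  have ij: "i0 \<noteq> j0" "i0 \<in> R" "i0 \<notin> I" "j0 \<in> R" using i0 j0 IJ by auto
  have finI: "finite I" using IJ fin finite_subset by blast
  have r1: "r \<ge> 1" using j0 IJ finI by (metis One_nat_def Suc_leI card_gt_0_iff empty_iff)
  obtain K where K0: "K \<ge> 0" and K: "\<forall>H\<ge>1. \<forall>R C X. finite R \<longrightarrow> finite C \<longrightarrow> R \<noteq> {} \<longrightarrow> card R = 2 \<longrightarrow>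
      card C = ?n \<longrightarrow> 2 \<le> ?n \<longrightarrow> finite X \<longrightarrow> rank_one_on H R C X \<longrightarrow>
      real (patterns X (R \<times> C)) \<le> K * H powr (real ?n + \<epsilon>)"
    using rank_one_patterns[OF \<epsilon>, of 2 ?n] by (elim exE conjE) (rule that)
  show ?thesis
  proof (rule pow_boundI)
    fix H :: real assume H: "H \<ge> 1"
    let ?X = "{f \<in> skeletal R C I J H. \<forall>i\<in>R - I. row_comb (curry f) C (\<sigma> i) i}"
    let ?B = "{i0, j0}" and ?I = "insert i0 I"
    have X: "?X \<subseteq> skeletal R C I J H" by blast
    have finX: "finite ?X" using finite_skeletal[OF fin] by simp
    have 0: "real (patterns ?X (?B \<times> C)) \<le> K * H powr (real ?n + \<epsilon>)"
    proof (rule K[rule_format])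
      show "rank_one_on H ?B C ?X" unfolding rank_one_on_def
      proof (intro ballI conjI)
        fix f assume f: "f \<in> ?X"
        show "units_on H (curry f) ?B C"
          using units_on_subset[OF skeletal_units, of f R C I J H ?B C] f ij by auto
        fix i i' j j' assume i: "i \<in> ?B" "i' \<in> ?B" and j: "j \<in> C" "j' \<in> C"
        have "row_comb (curry f) C (\<sigma> i0) i0" using f i0 by blast
        from row_combD[OF this[unfolded j0(1)]] obtain c where c: "\<And>l. l \<in> C \<Longrightarrow> f (i0, l) = c j0 * f (j0, l)"
          by auto
        have "\<exists>d. \<forall>l\<in>C. f (k, l) = d * f (j0, l)" if "k \<in> ?B" for k
        proof (cases "k = i0")
          case True then show ?thesis using c by blast
        next
          case False then show ?thesis using that by (intro exI[of _ 1]) auto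
        qed
        then obtain d d' where "\<forall>l\<in>C. f (i, l) = d * f (j0, l)" "\<forall>l\<in>C. f (i', l) = d' * f (j0, l)"
          using i by meson
        then show "f (i, j) * f (i', j') = f (i, j') * f (i', j)" using j by simp
      qed
    qed (use H fin finX C2 ij in auto)
    have k0: "K * H powr (real ?n + \<epsilon>) \<ge> 0" using K0 by simp
    have cI: "card (I - {j0}) = r - 1" using IJ j0 finI by simp
    \<comment> \<open>The other \<open>r - 1\<close> rows of \<open>I\<close> are filled without
      restriction. Each row still missing is then a multiple of a known row and costs one power of
      \<open>H\<close>.\<close>
    have "real (patterns ?X (?B \<times> C \<union> (I - {j0}) \<times> C)) \<le> real (patterns ?X (?B \<times> C)) * (2 * H) ^ ((r - 1) * ?n)"
    proof (intro patterns_step finX)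
      fix f assume f: "f \<in> ?X"
      have "real (patterns (agreeing ?X f (?B \<times> C)) ((I - {j0}) \<times> C)) \<le> (2 * H) ^ card ((I - {j0}) \<times> C)"
        using X IJ by (intro patterns_skeletal[OF fin _ _ H]) (auto simp: agreeing_def)
      then show "real (patterns (agreeing ?X f (?B \<times> C)) ((I - {j0}) \<times> C)) \<le> (2 * H) ^ ((r - 1) * ?n)"
        by (simp only: card_cartesian_product cI)
    qed
    also have "?B \<times> C \<union> (I - {j0}) \<times> C = ?I \<times> C" using j0 by auto
    also have "real (patterns ?X (?B \<times> C)) * (2 * H) ^ ((r - 1) * ?n) \<le> K * H powr (real ?n + \<epsilon>) * (2 * H) ^ ((r - 1) * ?n)"
      using 0 H by (intro mult_right_mono) auto
    finally have 1: "real (patterns ?X (?I \<times> C)) \<le> K * H powr (real ?n + \<epsilon>) * (2 * H) ^ ((r - 1) * ?n)" .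
    have JC: "J \<subseteq> C" by (rule IJ)
    have "real (patterns ?X (?I \<times> C \<union> (\<Union>i\<in>R - ?I. {i} \<times> C))) \<le> real (patterns ?X (?I \<times> C)) * (2 * H) ^ card (R - ?I)"
    proof (intro patterns_family finX)
      fix i f assume i: "i \<in> R - ?I" and f: "f \<in> ?X"
      then have iI: "i \<in> R - I" by blast
      have "real (patterns (agreeing ?X f (\<sigma> i \<times> C)) ({i} \<times> C)) \<le> (2 * H) ^ card (\<sigma> i)"
        using \<sigma>[OF iI] iI by (intro patterns_row_fiber[OF fin X H _ JC subset_refl _ _ f]) auto
      then have b: "real (patterns (agreeing ?X f (\<sigma> i \<times> C)) ({i} \<times> C)) \<le> 2 * H" using \<sigma>[OF iI] by simp
      have "\<sigma> i \<times> C \<subseteq> ?I \<times> C" using \<sigma>[OF iI] by blast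
      from patterns_agreeing_antimono[OF finX this b]
      show "real (patterns (agreeing ?X f (?I \<times> C)) ({i} \<times> C)) \<le> 2 * H" .
    qed (use fin H in auto)
    also have "?I \<times> C \<union> (\<Union>i\<in>R - ?I. {i} \<times> C) = R \<times> C" using IJ ij by auto
    also have "patterns ?X (R \<times> C) = card ?X"
      by (rule patterns_extensional) (auto simp: skeletal_def PiE_def)
    also have "card (R - ?I) = ?m" using IJ ij finI by (simp add: card_Diff_subset)
    also have "real (patterns ?X (?I \<times> C)) * (2 * H) ^ ?m \<le>
        K * H powr (real ?n + \<epsilon>) * (2 * H) ^ ((r - 1) * ?n) * (2 * H) ^ ?m"
      using 1 H by (intro mult_right_mono) auto
    also have "\<dots> = (2 * H) ^ ((r - 1) * ?n + ?m) * (K * H powr (real ?n + \<epsilon>)) ^ 1"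
      by (simp only: power_add power_one_right mult_ac)
    also have "\<dots> = 2 ^ ((r - 1) * ?n + ?m) * K ^ 1 * H powr (real ((r - 1) * ?n + ?m) + real 1 * (real ?n + \<epsilon>))"
      using H by (intro power_mult_powr) simp
    also have "real ((r - 1) * ?n + ?m) + real 1 * (real ?n + \<epsilon>) = real (r * ?n + ?m) + \<epsilon>"
    proof -
      have "r * ?n = (r - 1) * ?n + ?n" using r1 by (metis Suc_pred' add.commute mult_Suc less_eq_Suc_le One_nat_def)
      then show ?thesis by simp
    qed
    finally show "real (card ?X) \<le> 2 ^ ((r - 1) * ?n + ?m) * K ^ 1 * H powr (real (r * ?n + ?m) + \<epsilon>)" .
  qed
qed

section \<open>From matrices of given rank to chosen minors and supports\<close>

text \<open>Independent columns contain a nonsingular minor. A row outside it depends on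
  \<open>I\<close> within \<open>J\<close> because there are only \<open>card J\<close> columns, and
  the relation carries over to every column because each is a combination of those in
  \<open>J\<close>.\<close>

lemma skeleton_of_columns:
  assumes fin: "finite R" "finite C" and u: "units_on H a R C" and H: "H \<ge> 1" and J: "J \<subseteq> C"
    and ind: "indep_rows (\<lambda>j i. a i j) J R"
    and span: "\<And>l. l \<in> C \<Longrightarrow> \<exists>d. \<forall>i\<in>R. a i l = (\<Sum>j\<in>J. d j * a i j)"
  shows "\<exists>I. card I = card J \<and> skeleton R C I J a"
proof -
  have finJ: "finite J" using J fin finite_subset by blast
  have "units_on H (\<lambda>j i. a i j) J R" using u J by (auto simp: units_on_def)
  then obtain I where I: "I \<subseteq> R" "card I = card J" "indep_rows (\<lambda>j i. a i j) J I" "indep_rows a I J"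
    using minor_exists[OF ind finJ fin(1) _ H] by blast
  have finI: "finite I" using I fin finite_subset by blast
  have "\<exists>c. \<forall>l\<in>C. a i l = (\<Sum>s\<in>I. c s * a s l)" if i: "i \<in> R" for i
  proof -
    have "\<exists>c. \<forall>j\<in>J. a i j = (\<Sum>s\<in>I. c s * a s j)"
    proof (cases "i \<in> I")
      case True
      have "a i j = (\<Sum>s\<in>I. (if i = s then 1 else 0) * a s j)" for j
      proof -
        have "(\<Sum>s\<in>I. (if i = s then 1 else 0) * a s j) = (\<Sum>s\<in>I. if i = s then a s j else 0)"
          by (intro sum.cong) auto
        then show ?thesis using True finI by simp
      qed
      then show ?thesis by (intro exI[of _ "\<lambda>s. if i = s then 1 else 0"]) blast
    next
      case False
      have "\<not> indep_rows a (insert i I) J"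
      proof
        assume "indep_rows a (insert i I) J"
        then have "card (insert i I) \<le> card J"
          using finI finJ u H I i J by (intro indep_rows_card_le[of a "insert i I" J H]) (auto simp: units_on_def)
        then show False using False finI I by simp
      qed
      then obtain e where e: "\<forall>j\<in>J. (\<Sum>s\<in>insert i I. e s * a s j) = 0" "\<exists>s\<in>insert i I. e s \<noteq> 0"
        unfolding indep_rows_def by blast
      have sum: "e i * a i j + (\<Sum>s\<in>I. e s * a s j) = 0" if "j \<in> J" for j
        using e(1) that False finI by simp
      have "e i \<noteq> 0"
      proof
        assume ei: "e i = 0"
        then have "(\<Sum>s\<in>I. e s * a s j) = 0" if "j \<in> J" for j using sum[OF that] by simp
        then have "e s = 0" if "s \<in> I" for s using indep_rowsD[OF I(4), of e s] that by blast
        then show False using e(2) ei by auto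
      qed
      then have "a i j = (\<Sum>s\<in>I. (- e s / e i) * a s j)" if "j \<in> J" for j
      proof -
        have "(\<Sum>s\<in>I. (- e s / e i) * a s j) = - (\<Sum>s\<in>I. e s * a s j) / e i"
          by (simp add: sum_divide_distrib sum_negf)
        also have "\<dots> = a i j" using sum[OF that] \<open>e i \<noteq> 0\<close> by (simp add: field_simps eq_neg_iff_add_eq_0)
        finally show ?thesis by simp
      qed
      then show ?thesis by (intro exI[of _ "\<lambda>s. - e s / e i"]) blast
    qed
    then obtain c where c: "\<And>j. j \<in> J \<Longrightarrow> a i j = (\<Sum>s\<in>I. c s * a s j)" by blast
    \<comment> \<open>Exchanging the two sums transfers the relation from the columns
      \<open>J\<close> to column \<open>l\<close>.\<close>
    have "a i l = (\<Sum>s\<in>I. c s * a s l)" if l: "l \<in> C" for l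
    proof -
      obtain d where d: "\<And>i. i \<in> R \<Longrightarrow> a i l = (\<Sum>j\<in>J. d j * a i j)" using span[OF l] by blast
      have "a i l = (\<Sum>j\<in>J. d j * (\<Sum>s\<in>I. c s * a s j))" using d[OF i] c by simp
      also have "\<dots> = (\<Sum>s\<in>I. c s * (\<Sum>j\<in>J. d j * a s j))"
        unfolding sum_distrib_left by (subst sum.swap) (simp add: mult_ac)
      also have "\<dots> = (\<Sum>s\<in>I. c s * a s l)" using d I by (intro sum.cong) auto
      finally show ?thesis .
    qed
    then show ?thesis by blast
  qed
  then have "skeleton R C I J a" unfolding skeleton_def by (intro conjI ballI I J span) (simp_all add: I)
  then show ?thesis using I by blast
qed

text \<open>A matrix may occur for several minors, but their number depends only on
  \<open>R\<close>, \<open>C\<close> and \<open>r\<close>, so overcounting costs a constant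
  factor.\<close>

definition rank_patterns :: "nat set \<Rightarrow> nat set \<Rightarrow> nat \<Rightarrow> real \<Rightarrow> (nat \<times> nat \<Rightarrow> rat) set" where
  "rank_patterns R C r H = (\<Union>(I, J) \<in> {(I, J). I \<subseteq> R \<and> J \<subseteq> C \<and> card I = r \<and> card J = r}. skeletal R C I J H)"

lemma card_unit_fraction_mats_rank_le:
  assumes H: "H \<ge> 1"
  shows "card (unit_fraction_mats_rank m n r H) \<le> card (rank_patterns {..<m} {..<n} r H)"
proof (rule card_inj_on_le)
  let ?R = "{..<m}" and ?C = "{..<n}"
  let ?\<phi> = "\<lambda>A :: rat mat. restrict (($$) A) (?R \<times> ?C)"
  show "inj_on ?\<phi> (unit_fraction_mats_rank m n r H)"
  proof (rule inj_onI)
    fix A B assume AB: "A \<in> unit_fraction_mats_rank m n r H" "B \<in> unit_fraction_mats_rank m n r H" "?\<phi> A = ?\<phi> B"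
    then have "A \<in> carrier_mat m n" "B \<in> carrier_mat m n"
      by (auto simp: unit_fraction_mats_rank_def unit_fraction_mats_def)
    then show "A = B" using restrict_eqD[OF AB(3)] by (intro eq_matI) auto
  qed
  show "?\<phi> ` unit_fraction_mats_rank m n r H \<subseteq> rank_patterns ?R ?C r H"
  proof (rule image_subsetI)
    fix A assume "A \<in> unit_fraction_mats_rank m n r H"
    then have A: "A \<in> carrier_mat m n" and r: "vec_space.rank m A = r"
      and unit: "\<And>i j. i < m \<Longrightarrow> j < n \<Longrightarrow> A $$ (i, j) \<in> unit_fractions H"
      by (auto simp: unit_fraction_mats_rank_def unit_fraction_mats_def)
    let ?a = "curry (?\<phi> A)"
    have a: "?a i j = A $$ (i, j)" if "i < m" "j < n" for i j using that by simp
    obtain J where J: "J \<subseteq> ?C" "card J = r" "indep_rows (\<lambda>j i. A $$ (i, j)) J ?R"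
      "\<And>l. l < n \<Longrightarrow> \<exists>d. \<forall>i<m. A $$ (i, l) = (\<Sum>j\<in>J. d j * A $$ (i, j))"
      by (rule rank_columns[OF A r]) (rule that, assumption+)
    have ind: "indep_rows (\<lambda>j i. ?a i j) J ?R"
      using J(3) by (rule indep_rows_cong[THEN iffD1, rotated]) (use J(1) in auto)
    have span: "\<exists>d. \<forall>i\<in>?R. ?a i l = (\<Sum>j\<in>J. d j * ?a i j)" if l: "l \<in> ?C" for l
    proof -
      obtain d where d: "\<And>i. i < m \<Longrightarrow> A $$ (i, l) = (\<Sum>j\<in>J. d j * A $$ (i, j))" using J(4) l by blast
      have "?a i l = (\<Sum>j\<in>J. d j * ?a i j)" if i: "i \<in> ?R" for i
      proof -
        have "(\<Sum>j\<in>J. d j * ?a i j) = (\<Sum>j\<in>J. d j * A $$ (i, j))" using J(1) i by (intro sum.cong) auto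
        then show ?thesis using d i l by simp
      qed
      then show ?thesis by blast
    qed
    have u: "units_on H ?a ?R ?C" using unit by (auto simp: units_on_def)
    obtain I where I: "card I = card J" "skeleton ?R ?C I J ?a"
      using skeleton_of_columns[OF finite_lessThan finite_lessThan u H J(1) ind span] by blast
    have "?\<phi> A \<in> skeletal ?R ?C I J H"
      unfolding skeletal_def by (intro CollectI conjI I(2)) (use unit in auto)
    moreover have "I \<subseteq> ?R" using I by (simp add: skeleton_def)
    ultimately show "?\<phi> A \<in> rank_patterns ?R ?C r H" using I(1) J(1,2) unfolding rank_patterns_def by blast
  qed
  show "finite (rank_patterns ?R ?C r H)"
  proof (rule finite_subset)
    show "rank_patterns ?R ?C r H \<subseteq> ?R \<times> ?C \<rightarrow>\<^sub>E unit_fractions H"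
      unfolding rank_patterns_def by (auto simp: skeletal_def)
  qed (simp add: finite_PiE finite_unit_fractions)
qed

lemma pow_bound_rank_patterns:
  assumes fin: "finite R" "finite C"
    and "\<And>I J. \<lbrakk>I \<subseteq> R; J \<subseteq> C; card I = r; card J = r\<rbrakk> \<Longrightarrow> pow_bound (\<lambda>H. real (card (skeletal R C I J H))) c"
  shows "pow_bound (\<lambda>H. real (card (rank_patterns R C r H))) c"
proof (rule pow_bound_UN[where P = "{(I, J). I \<subseteq> R \<and> J \<subseteq> C \<and> card I = r \<and> card J = r}"
      and X = "\<lambda>p H. skeletal R C (fst p) (snd p) H"])
  show "finite {(I, J). I \<subseteq> R \<and> J \<subseteq> C \<and> card I = r \<and> card J = r}"
    by (rule finite_subset[of _ "Pow R \<times> Pow C"]) (use fin in auto)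
  fix p assume "p \<in> {(I, J). I \<subseteq> R \<and> J \<subseteq> C \<and> card I = r \<and> card J = r}"
  then show "pow_bound (\<lambda>H. real (card (skeletal R C (fst p) (snd p) H))) c"
    using assms(3)[of "fst p" "snd p"] by auto
next
  fix H :: real
  show "rank_patterns R C r H \<subseteq>
      (\<Union>p\<in>{(I, J). I \<subseteq> R \<and> J \<subseteq> C \<and> card I = r \<and> card J = r}. skeletal R C (fst p) (snd p) H)"
    unfolding rank_patterns_def by (simp add: case_prod_unfold)
qed (rule finite_skeletal[OF fin])

lemma rank_one_bound:
  assumes fin: "finite R" "finite C" and le: "card R \<le> card C" and \<epsilon>: "\<epsilon> > 0"
  shows "pow_bound (\<lambda>H. real (card (rank_patterns R C 1 H))) (real (card C) + \<epsilon>)"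
proof (rule pow_bound_rank_patterns[OF fin])
  fix I J :: "nat set" assume IJ: "I \<subseteq> R" "J \<subseteq> C" "card I = 1" "card J = 1"
  obtain s where s: "I = {s}" using IJ by (auto simp: card_1_singleton_iff)
  obtain K where K: "\<forall>H\<ge>1. \<forall>R' C' X. finite R' \<longrightarrow> finite C' \<longrightarrow> R' \<noteq> {} \<longrightarrow> card R' = card R \<longrightarrow>
      card C' = card C \<longrightarrow> card R \<le> card C \<longrightarrow> finite X \<longrightarrow> rank_one_on H R' C' X \<longrightarrow>
      real (patterns X (R' \<times> C')) \<le> K * H powr (real (card C) + \<epsilon>)"
    using rank_one_patterns[OF \<epsilon>, of "card R" "card C"] by (elim exE conjE) (rule that)
  show "pow_bound (\<lambda>H. real (card (skeletal R C I J H))) (real (card C) + \<epsilon>)"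
  proof (rule pow_boundI)
    fix H :: real assume H: "H \<ge> 1"
    have "real (patterns (skeletal R C I J H) (R \<times> C)) \<le> K * H powr (real (card C) + \<epsilon>)"
    proof (rule K[rule_format])
      show "rank_one_on H R C (skeletal R C I J H)" unfolding rank_one_on_def
      proof (intro ballI conjI)
        fix f assume f: "f \<in> skeletal R C I J H"
        show "units_on H (curry f) R C" by (rule skeletal_units[OF f])
        fix i i' j j' assume i: "i \<in> R" "i' \<in> R" and j: "j \<in> C" "j' \<in> C"
        have sk: "skeleton R C I J (curry f)" using f by (simp add: skeletal_def)
        have "\<exists>d. \<forall>l\<in>C. f (k, l) = d * f (s, l)" if "k \<in> R" for k
          using skeleton_row_span[OF sk that] s by auto
        then obtain d d' where "\<forall>l\<in>C. f (i, l) = d * f (s, l)" "\<forall>l\<in>C. f (i', l) = d' * f (s, l)"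
          using i by meson
        then show "f (i, j) * f (i', j') = f (i, j') * f (i', j)" using j by simp
      qed
    qed (use H fin le IJ s finite_skeletal[OF fin] in auto)
    moreover have "patterns (skeletal R C I J H) (R \<times> C) = card (skeletal R C I J H)"
      by (rule patterns_extensional) (auto simp: skeletal_def PiE_def)
    ultimately show "real (card (skeletal R C I J H)) \<le> K * H powr (real (card C) + \<epsilon>)" by simp
  qed
qed

text \<open>Splits the matrices by the support \<sigma> of each row outside the minor and by a row
  \<open>i0\<close> with largest support. The number of pairs is independent of \<open>H\<close>, so
  it is enough to bound each exponent, with \<open>h = card (\<sigma> i0)\<close>.\<close>

lemma rank_bound:
  assumes fin: "finite R" "finite C" and r: "1 \<le> r" "r < card R"
    and t: "\<And>h. 1 \<le> h \<Longrightarrow> h \<le> r \<Longrightarrow> \<exists>t. eqn_bound (Suc h) t \<and>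
      real (r * r + h * (card R - r)) + real (card C - r) * (real (r - h) + t) \<le> c"
  shows "pow_bound (\<lambda>H. real (card (rank_patterns R C r H))) c"
proof (rule pow_bound_rank_patterns[OF fin])
  fix I J :: "nat set" assume IJ: "I \<subseteq> R" "J \<subseteq> C" "card I = r" "card J = r"
  have finI: "finite I" using IJ fin finite_subset by blast
  let ?P = "{(\<sigma>, i0). \<sigma> \<in> R - I \<rightarrow>\<^sub>E Pow I - {{}} \<and> i0 \<in> R - I \<and> (\<forall>i\<in>R - I. card (\<sigma> i) \<le> card (\<sigma> i0))}"
  show "pow_bound (\<lambda>H. real (card (skeletal R C I J H))) c"
  proof (rule pow_bound_UN[where P = ?P and
        X = "\<lambda>p H. {f \<in> skeletal R C I J H. \<forall>i\<in>R - I. row_comb (curry f) C (fst p i) i}"])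
    show "finite ?P"
      by (rule finite_subset[of _ "(R - I \<rightarrow>\<^sub>E Pow I - {{}}) \<times> R"]) (use fin finI in \<open>auto intro!: finite_PiE\<close>)
    fix p assume "p \<in> ?P"
    then obtain \<sigma> i0 where p: "p = (\<sigma>, i0)" "\<sigma> \<in> R - I \<rightarrow>\<^sub>E Pow I - {{}}" "i0 \<in> R - I"
      "\<And>i. i \<in> R - I \<Longrightarrow> card (\<sigma> i) \<le> card (\<sigma> i0)" by auto
    have \<sigma>: "\<sigma> i \<subseteq> I" "\<sigma> i \<noteq> {}" if "i \<in> R - I" for i using p(2) that by (auto dest: PiE_mem)
    have "1 \<le> card (\<sigma> i0)" "card (\<sigma> i0) \<le> r"
      using \<sigma>[OF p(3)] IJ finI by (auto simp: Suc_le_eq card_gt_0_iff intro: finite_subset card_mono)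
    then obtain t where t: "eqn_bound (Suc (card (\<sigma> i0))) t"
      "real (r * r + card (\<sigma> i0) * (card R - r)) + real (card C - r) * (real (r - card (\<sigma> i0)) + t) \<le> c"
      using assms(5) by blast
    have "pow_bound (\<lambda>H. real (card {f \<in> skeletal R C I J H. \<forall>i\<in>R - I. row_comb (curry f) C (\<sigma> i) i}))
        (real (r * r + card (\<sigma> i0) * (card R - r)) + real (card C - r) * (real (r - card (\<sigma> i0)) + t))"
      by (rule pow_bound_row_supports[OF fin IJ, of \<sigma> "card (\<sigma> i0)" i0 t]) (use p(3,4) \<sigma> t(1) in auto)
    from pow_bound_mono[OF this order_refl t(2)]
    show "pow_bound (\<lambda>H. real (card {f \<in> skeletal R C I J H. \<forall>i\<in>R - I. row_comb (curry f) C (fst p i) i})) c"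
      unfolding p(1) fst_conv .
  next
    fix H :: real assume "H \<ge> 1"
    show "skeletal R C I J H \<subseteq> (\<Union>p\<in>?P. {f \<in> skeletal R C I J H. \<forall>i\<in>R - I. row_comb (curry f) C (fst p i) i})"
    proof
      fix f assume f: "f \<in> skeletal R C I J H"
      have sk: "skeleton R C I J (curry f)" using f by (simp add: skeletal_def)
      have "C \<noteq> {}" using IJ r by auto
      then have "\<exists>S. S \<in> Pow I - {{}} \<and> row_comb (curry f) C S i" if "i \<in> R - I" for i
        using skeleton_row_comb[OF sk finI] row_comb_nonempty[OF _ skeletal_units[OF f]] that by blast
      then obtain \<sigma>0 where \<sigma>0: "\<And>i. i \<in> R - I \<Longrightarrow> \<sigma>0 i \<in> Pow I - {{}} \<and> row_comb (curry f) C (\<sigma>0 i) i"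
        by metis
      define \<sigma> where "\<sigma> = restrict \<sigma>0 (R - I)"
      have \<sigma>: "\<sigma> \<in> R - I \<rightarrow>\<^sub>E Pow I - {{}}" "\<And>i. i \<in> R - I \<Longrightarrow> row_comb (curry f) C (\<sigma> i) i"
        using \<sigma>0 by (auto simp: \<sigma>_def)
      have "card (R - I) > 0" using IJ r finI by (simp add: card_Diff_subset)
      then have "R - I \<noteq> {}" unfolding card_gt_0_iff by blast
      then have ne: "card ` \<sigma> ` (R - I) \<noteq> {}" by simp
      have "finite (card ` \<sigma> ` (R - I))" using fin by simp
      then obtain i0 where "i0 \<in> R - I" "card (\<sigma> i0) = Max (card ` \<sigma> ` (R - I))"
        using Max_in[OF _ ne] by force
      then have "(\<sigma>, i0) \<in> ?P" using \<sigma>(1) fin by auto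
      then show "f \<in> (\<Union>p\<in>?P. {f \<in> skeletal R C I J H. \<forall>i\<in>R - I. row_comb (curry f) C (fst p i) i})"
        by (rule UN_I) (use f \<sigma>(2) in simp)
    qed
  next
    fix p :: "(nat \<Rightarrow> nat set) \<times> nat" and H :: real
    show "finite {f \<in> skeletal R C I J H. \<forall>i\<in>R - I. row_comb (curry f) C (fst p i) i}"
      using finite_skeletal[OF fin] by simp
  qed
qed

section \<open>The bounds for each rank\<close>

lemma pow_bound_Un:
  assumes "pow_bound (\<lambda>H. real (card (A H))) c" "pow_bound (\<lambda>H. real (card (B H))) c"
    "\<And>H. finite (A H)" "\<And>H. finite (B H)" "\<And>H. H \<ge> 1 \<Longrightarrow> F H \<subseteq> A H \<union> B H"
  shows "pow_bound (\<lambda>H. real (card (F H))) c"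
proof -
  obtain K L where K: "\<And>H. H \<ge> 1 \<Longrightarrow> real (card (A H)) \<le> K * H powr c"
    and L: "\<And>H. H \<ge> 1 \<Longrightarrow> real (card (B H)) \<le> L * H powr c"
    using assms(1,2) unfolding pow_bound_def by blast
  show ?thesis
  proof (rule pow_boundI)
    fix H :: real assume H: "H \<ge> 1"
    have "card (F H) \<le> card (A H \<union> B H)" using assms H by (intro card_mono) auto
    also have "\<dots> \<le> card (A H) + card (B H)" by (rule card_Un_le)
    finally have "real (card (F H)) \<le> real (card (A H)) + real (card (B H))" by linarith
    also have "\<dots> \<le> (K + L) * H powr c" using K[OF H] L[OF H] by (simp add: distrib_right)
    finally show "real (card (F H)) \<le> (K + L) * H powr c" .
  qed
qed

lemma card_skeletal_transpose:
  assumes fin: "finite R" "finite C"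
  shows "card {f \<in> skeletal R C I J H. \<forall>l\<in>L. row_comb (\<lambda>j i. f (i, j)) R (\<sigma> l) l} \<le>
    card {g \<in> skeletal C R J I H. \<forall>l\<in>L. row_comb (curry g) R (\<sigma> l) l}" (is "card ?A \<le> card ?B")
proof (rule card_inj_on_le)
  show "inj_on (\<lambda>f. f \<circ> prod.swap) ?A"
    by (rule inj_onI) (metis comp_assoc comp_id swap_comp_swap)
  show "(\<lambda>f. f \<circ> prod.swap) ` ?A \<subseteq> ?B"
  proof (rule image_subsetI)
    fix f assume f: "f \<in> ?A"
    have cur: "curry (f \<circ> prod.swap) = (\<lambda>j i. f (i, j))" by (simp add: fun_eq_iff)
    have "skeleton R C I J (curry f)" using f by (simp add: skeletal_def)
    then have "skeleton C R J I (curry (f \<circ> prod.swap))"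
      unfolding cur using skeleton_transpose[of C R J I "curry f"] by simp
    moreover have "f \<circ> prod.swap \<in> C \<times> R \<rightarrow>\<^sub>E unit_fractions H"
    proof (rule PiE_I)
      fix x assume "x \<in> C \<times> R"
      then show "(f \<circ> prod.swap) x \<in> unit_fractions H" using f by (auto simp: skeletal_def)
    next
      fix x assume "x \<notin> C \<times> R"
      then have "prod.swap x \<notin> R \<times> C" by (cases x) auto
      then show "(f \<circ> prod.swap) x = undefined" using f by (auto simp: skeletal_def intro: PiE_arb)
    qed
    moreover have "\<forall>l\<in>L. row_comb (curry (f \<circ> prod.swap)) R (\<sigma> l) l" unfolding cur using f by blast
    ultimately show "f \<circ> prod.swap \<in> ?B" unfolding skeletal_def by (intro CollectI conjI)
  qed
  show "finite ?B" using finite_skeletal[OF fin(2,1)] by simp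
qed

text \<open>With \<open>t\<close> close to 1, \<open>X1\<close> has exponent
  \<open>6 + (n - 2) + (m - 3) = n + m + 1\<close>. \<open>X2\<close> has
  \<open>2 n + m - 3\<close>, and its transpose \<open>X3\<close> has \<open>2 m + n - 3\<close>,
  which is no larger as \<open>m \<le> n\<close>. These are the two lower bounds required of
  \<open>c\<close>.\<close>

lemma rank_two_bound:
  assumes fin: "finite R" "finite C" and mn: "3 \<le> card R" "card R \<le> card C" and \<epsilon>: "\<epsilon> > 0"
    and c: "real (card C + card R + 1) + \<epsilon> \<le> c" "real (2 * card C + card R) - 3 + \<epsilon> \<le> c"
  shows "pow_bound (\<lambda>H. real (card (rank_patterns R C 2 H))) c"
proof (rule pow_bound_rank_patterns[OF fin])
  fix I J :: "nat set" assume IJ: "I \<subseteq> R" "J \<subseteq> C" "card I = 2" "card J = 2"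
  have finIJ: "finite I" "finite J" using IJ fin finite_subset by blast+
  let ?F = "skeletal R C I J"
  define S where "S = (\<lambda>I :: nat set. (\<lambda>s. {s}) ` I)"
  define X1 where "X1 = (\<lambda>p H. {f \<in> ?F H. row_comb (curry f) C I (fst p) \<and> row_comb (\<lambda>j i. f (i, j)) R J (snd p)})"
  define X2 where "X2 = (\<lambda>\<sigma> H. {f \<in> ?F H. \<forall>i\<in>R - I. row_comb (curry f) C (\<sigma> i) i})"
  define X3 where "X3 = (\<lambda>\<sigma> H. {f \<in> ?F H. \<forall>l\<in>C - J. row_comb (\<lambda>j i. f (i, j)) R (\<sigma> l) l})"
  let ?P1 = "(R - I) \<times> (C - J)" and ?P2 = "R - I \<rightarrow>\<^sub>E S I" and ?P3 = "C - J \<rightarrow>\<^sub>E S J"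
  have finX: "finite (X1 p H)" "finite (X2 \<sigma> H)" "finite (X3 \<sigma> H)" for p \<sigma> H
    using finite_skeletal[OF fin] by (simp_all add: X1_def X2_def X3_def)
  have finP: "finite ?P1" "finite ?P2" "finite ?P3"
    using fin finIJ by (auto simp: S_def intro!: finite_PiE)
  have 1: "pow_bound (\<lambda>H. real (card (\<Union>p\<in>?P1. X1 p H))) c"
  proof (rule pow_bound_UN[OF finP(1) _ _ order_refl])
    fix p assume p: "p \<in> ?P1"
    \<comment> \<open>The equation is used \<open>card C + card R - 5\<close> times, so the total
      loss stays below \<epsilon>.\<close>
    define t where "t = 1 + \<epsilon> / real (card C + card R)"
    have "eqn_bound (Suc 2) t" using eqn_bound_3[of "\<epsilon> / real (card C + card R)"] \<epsilon> mn
      by (simp add: t_def numeral_3_eq_3 numeral_2_eq_2)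
    moreover have "real (2 * 2 + 2) + real (card C - 2 + (card R - 2 - 1)) * t \<le> c"
    proof -
      have "real (card C - 2 + (card R - 2 - 1)) = real (card C + card R) - 5" using mn by simp
      then have "real (card C - 2 + (card R - 2 - 1)) * t \<le> real (card C + card R) - 5 + \<epsilon>"
        using mn \<epsilon> by (simp add: t_def field_simps)
      then show ?thesis using c(1) by simp
    qed
    ultimately show "pow_bound (\<lambda>H. real (card (X1 p H))) c"
      unfolding X1_def using p IJ
      by (intro pow_bound_mono[OF pow_bound_full_supports[OF fin IJ, of "fst p" "snd p" t]]) auto
  qed (rule finX)
  have 2: "pow_bound (\<lambda>H. real (card (\<Union>\<sigma>\<in>?P2. X2 \<sigma> H))) c"
  proof (rule pow_bound_UN[OF finP(2) _ _ order_refl])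
    fix \<sigma> assume \<sigma>: "\<sigma> \<in> ?P2"
    have \<sigma>': "\<sigma> i \<subseteq> I \<and> card (\<sigma> i) = 1" if "i \<in> R - I" for i
      using PiE_mem[OF \<sigma> that] by (auto simp: S_def)
    have "card (R - I) > 0" using IJ finIJ fin mn by (simp add: card_Diff_subset)
    then obtain i0 where i0: "i0 \<in> R - I" unfolding card_gt_0_iff by blast
    have "pow_bound (\<lambda>H. real (card (X2 \<sigma> H))) (real (2 * card C + (card R - 2 - 1)) + \<epsilon>)"
      unfolding X2_def
      by (rule pow_bound_singleton_supports[OF fin IJ(1,2,3), of \<sigma> i0]) (use mn \<sigma>' i0 \<epsilon> in auto)
    then show "pow_bound (\<lambda>H. real (card (X2 \<sigma> H))) c"
      by (rule pow_bound_mono) (use mn c(2) in auto)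
  qed (rule finX)
  have 3: "pow_bound (\<lambda>H. real (card (\<Union>\<sigma>\<in>?P3. X3 \<sigma> H))) c"
  proof (rule pow_bound_UN[OF finP(3) _ _ order_refl])
    fix \<sigma> assume \<sigma>: "\<sigma> \<in> ?P3"
    have \<sigma>': "\<sigma> i \<subseteq> J \<and> card (\<sigma> i) = 1" if "i \<in> C - J" for i
      using PiE_mem[OF \<sigma> that] by (auto simp: S_def)
    have "card (C - J) > 0" using IJ finIJ fin mn by (simp add: card_Diff_subset)
    then obtain l0 where l0: "l0 \<in> C - J" unfolding card_gt_0_iff by blast
    have "pow_bound (\<lambda>H. real (card {f \<in> skeletal C R J I H. \<forall>i\<in>C - J. row_comb (curry f) R (\<sigma> i) i}))
        (real (2 * card R + (card C - 2 - 1)) + \<epsilon>)"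
      by (rule pow_bound_singleton_supports[OF fin(2,1) IJ(2,1,4), of \<sigma> l0]) (use mn \<sigma>' l0 \<epsilon> in auto)
    then show "pow_bound (\<lambda>H. real (card (X3 \<sigma> H))) c"
      unfolding X3_def
    proof (rule pow_bound_mono)
      fix H :: real
      show "real (card {f \<in> ?F H. \<forall>l\<in>C - J. row_comb (\<lambda>j i. f (i, j)) R (\<sigma> l) l}) \<le>
        real (card {f \<in> skeletal C R J I H. \<forall>i\<in>C - J. row_comb (curry f) R (\<sigma> i) i})"
        using card_skeletal_transpose[OF fin] by simp
    qed (use mn c(2) in auto)
  qed (rule finX)
  have fin1: "finite (\<Union>p\<in>?P1. X1 p H)" for H using finP(1) finX by blast
  have fin2: "finite (\<Union>\<sigma>\<in>?P2. X2 \<sigma> H)" for H using finP(2) finX by blast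
  have fin3: "finite (\<Union>\<sigma>\<in>?P3. X3 \<sigma> H)" for H using finP(3) finX by blast
  have 23: "pow_bound (\<lambda>H. real (card ((\<Union>\<sigma>\<in>?P2. X2 \<sigma> H) \<union> (\<Union>\<sigma>\<in>?P3. X3 \<sigma> H)))) c"
    by (rule pow_bound_Un[OF 2 3 fin2 fin3 order_refl])
  \<comment> \<open>A nonempty proper subset of a set with two elements is a singleton: if no row
    has full support, each is a multiple of one row of the minor.\<close>
  have single: "s \<in> S K" if "s \<subseteq> K" "s \<noteq> {}" "s \<noteq> K" "card K = 2" for s K
  proof -
    obtain x y where "K = {x, y}" using \<open>card K = 2\<close> by (auto simp: card_2_iff)
    with that show ?thesis by (auto simp: S_def)
  qed
  show "pow_bound (\<lambda>H. real (card (?F H))) c"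
  proof (rule pow_bound_Un[OF 1 23 fin1])
    show "finite ((\<Union>\<sigma>\<in>?P2. X2 \<sigma> H) \<union> (\<Union>\<sigma>\<in>?P3. X3 \<sigma> H))" for H using fin2 fin3 by blast
    fix H :: real assume "H \<ge> 1"
    show "?F H \<subseteq> (\<Union>p\<in>?P1. X1 p H) \<union> ((\<Union>\<sigma>\<in>?P2. X2 \<sigma> H) \<union> (\<Union>\<sigma>\<in>?P3. X3 \<sigma> H))"
    proof
      fix f assume f: "f \<in> ?F H"
      have sk: "skeleton R C I J (curry f)" using f by (simp add: skeletal_def)
      then have skT: "skeleton C R J I (\<lambda>j i. f (i, j))"
        using skeleton_transpose[of C R J I "curry f"] by simp
      have u: "units_on H (curry f) R C" by (rule skeletal_units[OF f])
      then have uT: "units_on H (\<lambda>j i. f (i, j)) C R" by (auto simp: units_on_def)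
      have ne: "R \<noteq> {}" "C \<noteq> {}" using mn by auto
      consider (full) i0 l0 where "i0 \<in> R - I" "l0 \<in> C - J" "row_comb (curry f) C I i0" "row_comb (\<lambda>j i. f (i, j)) R J l0"
        | (rows) "\<And>i. i \<in> R - I \<Longrightarrow> \<not> row_comb (curry f) C I i"
        | (cols) "\<And>l. l \<in> C - J \<Longrightarrow> \<not> row_comb (\<lambda>j i. f (i, j)) R J l" by blast
      then show "f \<in> (\<Union>p\<in>?P1. X1 p H) \<union> ((\<Union>\<sigma>\<in>?P2. X2 \<sigma> H) \<union> (\<Union>\<sigma>\<in>?P3. X3 \<sigma> H))"
      proof cases
        case full
        then have "(i0, l0) \<in> ?P1" "f \<in> X1 (i0, l0) H" using f by (auto simp: X1_def)
        then show ?thesis by blast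
      next
        case rows
        have "\<exists>s. s \<in> S I \<and> row_comb (curry f) C s i" if i: "i \<in> R - I" for i
        proof -
          obtain s where s: "s \<subseteq> I" "row_comb (curry f) C s i"
            using skeleton_row_comb[OF sk finIJ(1), of i] i by blast
          moreover have "s \<noteq> {}" using row_comb_nonempty[OF s(2) u _ ne(2)] i by blast
          moreover have "s \<noteq> I" using rows[OF i] s(2) by blast
          ultimately show ?thesis using single IJ(3) by blast
        qed
        then obtain \<sigma> where \<sigma>: "\<And>i. i \<in> R - I \<Longrightarrow> \<sigma> i \<in> S I \<and> row_comb (curry f) C (\<sigma> i) i" by metis
        then have "restrict \<sigma> (R - I) \<in> ?P2" by auto
        moreover have "f \<in> X2 (restrict \<sigma> (R - I)) H" unfolding X2_def using f \<sigma> by simp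
        ultimately show ?thesis by blast
      next
        case cols
        have "\<exists>s. s \<in> S J \<and> row_comb (\<lambda>j i. f (i, j)) R s l" if l: "l \<in> C - J" for l
        proof -
          obtain s where s: "s \<subseteq> J" "row_comb (\<lambda>j i. f (i, j)) R s l"
            using skeleton_row_comb[OF skT finIJ(2), of l] l by blast
          moreover have "s \<noteq> {}" using row_comb_nonempty[OF s(2) uT _ ne(1)] l by blast
          moreover have "s \<noteq> J" using cols[OF l] s(2) by blast
          ultimately show ?thesis using single IJ(4) by blast
        qed
        then obtain \<sigma> where \<sigma>: "\<And>l. l \<in> C - J \<Longrightarrow> \<sigma> l \<in> S J \<and> row_comb (\<lambda>j i. f (i, j)) R (\<sigma> l) l" by metis
        then have "restrict \<sigma> (C - J) \<in> ?P3" by auto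
        moreover have "f \<in> X3 (restrict \<sigma> (C - J)) H" unfolding X3_def using f \<sigma> by simp
        ultimately show ?thesis by blast
      qed
    qed
  qed
qed

text \<open>The exponent of \<open>pow_bound_row_supports\<close> is linear in $h$, so it is maximal at $h = 1$ or $h = r$.
  At $h = 1$ no $\varepsilon$ is lost.\<close>

lemma rank_ge_three_bound:
  assumes fin: "finite R" "finite C" and r: "3 \<le> r" "r < card R" "card R \<le> card C"
  shows "2 * card R \<ge> card C + r \<Longrightarrow> \<epsilon> > 0 \<Longrightarrow> pow_bound (\<lambda>H. real (card (rank_patterns R C r H)))
      ((real (card C) - real r) * (real r + 1) / 2 + real (card R) * real r + \<epsilon>)" (is "_ \<Longrightarrow> _ \<Longrightarrow> ?A")
    and "2 * card R < card C + r \<Longrightarrow> pow_bound (\<lambda>H. real (card (rank_patterns R C r H)))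
      (real (card C) * real r + real (card R) - real r)" (is "_ \<Longrightarrow> ?B")
proof -
  define a where "a = real (card R) - real r"
  define b where "b = real (card C) - real r"
  have ab: "real (card R - r) = a" "real (card C - r) = b" "a > 0" "b > 0" using r by (auto simp: a_def b_def)
  have mn: "real (card R) = a + real r" "real (card C) = b + real r" by (auto simp: a_def b_def)
  \<comment> \<open>The exponent \<open>(h + 1) / 2 + \<delta>\<close> describes both equation
    bounds in use: \<open>eqn_bound_2\<close> at \<open>h = 1\<close>, \<delta> = 0, and
    \<open>eqn_bound_half\<close> for larger \<open>h\<close>.\<close>
  have expo: "real (r * r + h * (card R - r)) + real (card C - r) * (real (r - h) + ((real h + 1) / 2 + \<delta>)) =
      real r * real r + real h * a + b * (real r - (real h - 1) / 2) + b * \<delta>" if "h \<le> r" for h \<delta>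
    unfolding of_nat_add of_nat_mult ab(1,2) of_nat_diff[OF that]
    by (simp add: algebra_simps add_divide_distrib diff_divide_distrib)
  have bnd: "\<exists>t. eqn_bound (Suc h) t \<and>
      real (r * r + h * (card R - r)) + real (card C - r) * (real (r - h) + t) \<le> c"
    if h: "1 \<le> h" "h \<le> r" and \<delta>: "\<delta> > 0"
      and c: "real r * real r + a + b * real r \<le> c"
        "h \<ge> 2 \<Longrightarrow> real r * real r + real h * a + b * (real r - (real h - 1) / 2) + b * \<delta> \<le> c" for h \<delta> c
  proof (cases "h = 1")
    case True
    have "eqn_bound (Suc h) 1" using eqn_bound_2 True by (simp add: numeral_2_eq_2)
    moreover have "real (r * r + h * (card R - r)) + real (card C - r) * (real (r - h) + 1) \<le> c"
      using expo[OF h(2), of 0] c(1) True by simp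
    ultimately show ?thesis by blast
  next
    case False
    have "eqn_bound (Suc h) ((real h + 1) / 2 + \<delta>)" using eqn_bound_half[OF \<delta>, of "Suc h"] by (simp add: add.commute)
    then show ?thesis using expo[OF h(2), of \<delta>] c(2) False h(1) by (intro exI[of _ "(real h + 1) / 2 + \<delta>"]) simp
  qed
  show ?A if le: "2 * card R \<ge> card C + r" and \<epsilon>: "\<epsilon> > 0"
  proof (rule rank_bound[OF fin])
    fix h assume h: "1 \<le> h" "h \<le> r"
    have "2 * real (card R) \<ge> real (card C) + real r" using le by linarith
    \<comment> \<open>This is the slope of the exponent in \<open>h\<close>; as it is nonnegative,
      \<open>h = r\<close> is the worst case.\<close>
    then have ba: "a - b / 2 \<ge> 0" using mn by simp
    have key: "real r * real r + real h' * a + b * (real r - (real h' - 1) / 2) \<le> b * (real r + 1) / 2 + (a + real r) * real r"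
      if "h' \<le> r" for h'
    proof -
      have "0 \<le> (real r - real h') * (a - b / 2)" using ba that by (intro mult_nonneg_nonneg) auto
      also have "\<dots> = b * (real r + 1) / 2 + (a + real r) * real r -
          (real r * real r + real h' * a + b * (real r - (real h' - 1) / 2))"
        by (simp add: field_simps)
      finally show ?thesis by simp
    qed
    show "\<exists>t. eqn_bound (Suc h) t \<and> real (r * r + h * (card R - r)) + real (card C - r) * (real (r - h) + t)
        \<le> (real (card C) - real r) * (real r + 1) / 2 + real (card R) * real r + \<epsilon>"
    proof (rule bnd[OF h, of "\<epsilon> / b"])
      show "\<epsilon> / b > 0" using \<epsilon> ab by simp
      show "real r * real r + a + b * real r \<le> (real (card C) - real r) * (real r + 1) / 2 + real (card R) * real r + \<epsilon>"
        using key[of 1] h \<epsilon> by (simp add: mn)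
      show "real r * real r + real h * a + b * (real r - (real h - 1) / 2) + b * (\<epsilon> / b)
          \<le> (real (card C) - real r) * (real r + 1) / 2 + real (card R) * real r + \<epsilon>"
        using key[OF h(2)] ab(4) by (simp add: mn)
    qed
  qed (use r in auto)
  show ?B if lt: "2 * card R < card C + r"
  proof (rule rank_bound[OF fin])
    fix h assume h: "1 \<le> h" "h \<le> r"
    have "2 * real (card R) + 1 \<le> real (card C) + real r" using lt by linarith
    \<comment> \<open>The inequality is strict between integers, so the slope is at most
      \<open>- 1 / 2\<close>, and for \<open>h \<ge> 2\<close> the exponent lies at least
      \<open>1 / 2\<close> below its value at \<open>h = 1\<close>.\<close>
    then have ba: "b / 2 - a \<ge> 1 / 2" using mn by simp
    show "\<exists>t. eqn_bound (Suc h) t \<and> real (r * r + h * (card R - r)) + real (card C - r) * (real (r - h) + t)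
        \<le> real (card C) * real r + real (card R) - real r"
    \<comment> \<open>With this \<delta> the loss \<open>b * \<delta>\<close> is exactly the gap
      \<open>1 / 2\<close>.\<close>
    proof (rule bnd[OF h, of "1 / (2 * b)"])
      show "1 / (2 * b) > 0" using ab by simp
      show "real r * real r + a + b * real r \<le> real (card C) * real r + real (card R) - real r"
        by (simp add: mn algebra_simps)
      assume h2: "h \<ge> 2"
      have "1 * (1 / 2) \<le> (real h - 1) * (b / 2 - a)" using ba h2 by (intro mult_mono) auto
      also have "\<dots> = real r * real r + a + b * real r - (real r * real r + real h * a + b * (real r - (real h - 1) / 2))"
        by (simp add: field_simps)
      finally have "real r * real r + real h * a + b * (real r - (real h - 1) / 2) + 1 / 2 \<le> real r * real r + a + b * real r"
        by simp
      then show "real r * real r + real h * a + b * (real r - (real h - 1) / 2) + b * (1 / (2 * b))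
          \<le> real (card C) * real r + real (card R) - real r"
        using ab(4) by (simp add: mn algebra_simps)
    qed
  qed (use r in auto)
qed

theorem theorem2p4:
  fixes m n r :: nat
  assumes "n \<ge> m" and "m > r" and "r \<ge> 1"
  shows "let N = (\<lambda>H :: real. real (card (unit_fraction_mats_rank m n r H))) in
    (r = 1 \<longrightarrow> le_powr_o1 N (real n)) \<and>
    (r = 2 \<longrightarrow>
      ((m, n) = (3, 3) \<longrightarrow> ll_powr_o1 N 7) \<and>
      ((m, n) \<noteq> (3, 3) \<longrightarrow> ll_powr_o1 N (2 * real n + real m - 3))) \<and>
    (r \<ge> 3 \<longrightarrow>
      (2 * m \<ge> n + r \<longrightarrow>
        ll_powr_o1 N ((real n - real r) * (real r + 1) / 2 + real m * real r)) \<and>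
      (2 * m < n + r \<longrightarrow>
        N \<in> O[at_top](\<lambda>H. H powr (real n * real r + real m - real r))))"
proof -
  define N where "N = (\<lambda>H :: real. real (card (unit_fraction_mats_rank m n r H)))"
  let ?R = "{..<m}" and ?C = "{..<n}"
  have N: "pow_bound N c" if "pow_bound (\<lambda>H. real (card (rank_patterns ?R ?C r H))) c" for c
    by (rule pow_bound_mono[OF that]) (auto simp: N_def card_unit_fraction_mats_rank_le)
  have "le_powr_o1 N (real n)" if "r = 1"
    using rank_one_bound[of ?R ?C] that assms by (intro pow_bound_imp_le_powr_o1 N) auto
  moreover have two: "ll_powr_o1 N c" if "r = 2" "real (n + m + 1) \<le> c" "real (2 * n + m) - 3 \<le> c" for c
    using that assms
    by (intro le_powr_o1_imp_ll_powr_o1 pow_bound_imp_le_powr_o1 N)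
      (auto intro!: rank_two_bound)
  \<comment> \<open>For \<open>m = n = 3\<close> the two exponents are 7 and 6, so the matrices with
    a full row and a full column give the larger bound.\<close>
  have "ll_powr_o1 N 7" if "r = 2" "(m, n) = (3, 3)" using two[of 7] that by simp
  moreover have "ll_powr_o1 N (2 * real n + real m - 3)" if "r = 2" "(m, n) \<noteq> (3, 3)"
  proof -
    \<comment> \<open>From \<open>n = 4\<close> on, \<open>2 n + m - 3\<close> is at least
      \<open>n + m + 1\<close>.\<close>
    have "n \<ge> 4" using that assms by auto
    then show ?thesis using two[of "2 * real n + real m - 3"] that by simp
  qed
  moreover have "ll_powr_o1 N ((real n - real r) * (real r + 1) / 2 + real m * real r)"
    if "r \<ge> 3" "2 * m \<ge> n + r"
    using rank_ge_three_bound(1)[of ?R ?C r] that assms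
    by (intro le_powr_o1_imp_ll_powr_o1 pow_bound_imp_le_powr_o1 N) simp
  moreover have "N \<in> O[at_top](\<lambda>H. H powr (real n * real r + real m - real r))"
    if "r \<ge> 3" "2 * m < n + r"
    using rank_ge_three_bound(2)[of ?R ?C r] that assms
    by (intro pow_bound_imp_bigo N) (simp_all add: N_def)
  ultimately show ?thesis unfolding Let_def N_def[symmetric] by blast
qed

end
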